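(* Consider the almost periodic Nicholson system $$y_i'(t)=-\tilde d_i(t)\,y_i(t)+\sum_{j=1}^n \tilde a_{ij}(t)\,y_j(t)+\tilde\beta_i(t)\,y_i(t-\tau_i)\,e^{-\tilde c_i(t)\,y_i(t-\tau_i)},\quad t\ge 0,\; i=1,\dots,n, \qquad (N)$$ with delays $\tau_i>0$, under the following assumptions: (a1) $\tilde d_i,\tilde a_{ij},\tilde c_i,\tilde\beta_i:\mathbb{R}\to\mathbb{R}$ are almost periodic; (a2) there is $d_0>0$ with $\tilde d_i(t)\ge d_0$ for all $t\in\mathbb{R}$ and all $i$; (a3) all $\tilde a_{ij}$ are nonnegative and $\tilde a_{ii}\equiv 0$; (a4) $\tilde\beta_i(t)>0$ for all $t\ge 0$ and all $i$; (a5) there is $c_0>0$ with $\tilde c_i(t)\ge c_0$ for all $t\ge 0$ and all $i$; (a6) $\tilde d_i(t)-\sum_{j=1}^n\tilde a_{ji}(t)>0$ for all $t\ge 0$ and all $i$. Let $\Omega$ be the hull of the vector of coefficients and consider the family of systems over the hull $$y_i'(t)=-d_i(\omega\cdot t)\,y_i(t)+\sum_{j=1}^n a_{ij}(\omega\cdot t)\,y_j(t)+\beta_i(\omega\cdot t)\,y_i(t-\tau_i)\,e^{-c_i(\omega\cdot t)\,y_i(t-\tau_i)},\quad i=1,\dots,n,\ \omega\in\Omega. \qquad (N_\Omega)$$ Then: (1) system $(N)$ is uniformly persistent at $0$ if and only if the family $(N_\Omega)$ is uniformly persistent; (2) system $(N)$ is strictly persistent at $0$ if and only if the family $(N_\Omega)$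 is strictly persistent at $0$.
   Context: Almost periodic: a continuous $g:\mathbb{R}\to\mathbb{R}$ is almost periodic if for every $\varepsilon>0$ the set $\{r\in\mathbb{R}: |g(t+r)-g(t)|<\varepsilon \text{ for all } t\in\mathbb{R}\}$ is relatively dense in $\mathbb{R}$. Hull: let $p:\mathbb{R}\to\mathbb{R}^N$ be the vector-valued map collecting all the coefficients $\tilde d_i,\tilde a_{ij},\tilde\beta_i,\tilde c_i$. The hull $\Omega$ is the closure, in the topology of uniform convergence on compact sets, of the set of translates $\{p(t+\cdot): t\in\mathbb{R}\}$; it is a compact metric space, with the continuous translation flow $(\omega\cdot t)(s)=\omega(t+s)$. The continuous functions $d_i,a_{ij},\beta_i,c_i:\Omega\to\mathbb{R}$ are the corresponding components of $\omega(0)$. The system $(N)$ is the member of the family $(N_\Omega)$ for $\omega=p$. Phase space and order: $X=C([-\tau_1,0])\times\cdots\times C([-\tau_n,0])$ (real-valued continuous functions) with the sup-norm and $X_+$ the cone of $\varphi=(\varphi_1,\dots,\varphi_n)$ with all $\varphi_i\ge 0$ pointwise. In $X$: $\varphi\ge\psi$ means $\varphi-\psi\in X_+$; $\varphi>0$ means $\varphi\ge0$ and $\varphi\ne0$; $\varphi\gg0$ means $\varphi_i(s)>0$ for all $s\in[-\tau_i,0]$ and all $i$. In $\mathbb{R}^n$: $x\ge 0$ componentwise, $x>0$ means $x\ge0$ and $x\neq 0$, $x\gg0$ means all components are positive. $\varphi(0)=(\varphi_1(0),\dots,\varphi_n(0))$. Solutions: $y(t,\varphi)$ is the solution of $(N)$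 with initial map $\varphi\in X_+$ (i.e. $y_i(s)=\varphi_i(s)$ for $s\in[-\tau_i,0]$), and $y(t,\omega,\varphi)$ is the solution of the system of $(N_\Omega)$ for $\omega$ with initial map $\varphi\in X_+$; $y_t(\omega,\varphi)\in X$ is given by $y_t(\omega,\varphi)_i(s)=y_i(t+s,\omega,\varphi)$, $s\in[-\tau_i,0]$. Under (a1)-(a6) these solutions are nonnegative and defined for all $t\ge 0$. Persistence of the single system $(N)$: - $(N)$ is uniformly persistent at $0$ if there exists $m>0$ such that for every $\varphi\ge0$ with $\varphi(0)\gg0$ there is $t_0=t_0(\varphi)$ with $y_i(t,\varphi)\ge m$ for all $t\ge t_0$ and all $i=1,\dots,n$. - $(N)$ is strictly persistent at $0$ if there exists $m>0$ such that for every $\varphi\ge0$ with $\varphi(0)>0$ there is $t_0=t_0(\varphi)$ such that for at least one component $i$, $y_i(t,\varphi)\ge m$ for all $t\ge t_0$. Persistence of the family $(N_\Omega)$: - $(N_\Omega)$ is uniformly persistent if there exists $\psi\in X$, $\psi\gg0$, such that for every $\omega\in\Omega$ and every $\varphi\gg0$ there is $t_0=t_0(\omega,\varphi)$ with $y_t(\omega,\varphi)\ge\psi$ for all $t\ge t_0$. - $(N_\Omega)$ is strictly persistent at $0$ if there exist finitely many $e_1,\dots,e_p\in X$, $e_k>0$, such that for every $\omega\in\Omega$ and every $\varphi\ge0$ with $\varphi(0)>0$ there are $t_0=t_0(\omega,\varphi)$ and $k\in\{1,\dots,p\}$ with $y_t(\omega,\varphi)\ge e_k$ for all $t\ge t_0$.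 *)

theory Defs
  imports "HOL-Analysis.Analysis"
begin

definition relatively_dense :: "real set \<Rightarrow> bool" where
  "relatively_dense S \<longleftrightarrow> (\<exists>L>0. \<forall>a. S \<inter> {a..a + L} \<noteq> {})"

definition almost_periodic :: "(real \<Rightarrow> real) \<Rightarrow> bool" where
  "almost_periodic g \<longleftrightarrow> continuous_on UNIV g \<and>
     (\<forall>\<epsilon>>0. relatively_dense {r. \<forall>t. \<bar>g (t + r) - g t\<bar> < \<epsilon>})"


subsection \<open>The hull\<close>

text \<open>The topology of uniform convergence on compact sets, on the space of continuous
  functions on the real line.\<close>

definition cc_nbhd ::
    "(real \<Rightarrow> 'a::metric_space) \<Rightarrow> real set \<Rightarrow> real \<Rightarrow> (real \<Rightarrow> 'a) set" where
  "cc_nbhd f K e = {g. continuous_on UNIV g \<and> (\<forall>s\<in>K. dist (g s) (f s) < e)}"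

definition cc_open :: "(real \<Rightarrow> 'a::metric_space) set \<Rightarrow> bool" where
  "cc_open U \<longleftrightarrow> U \<subseteq> {f. continuous_on UNIV f} \<and>
     (\<forall>f\<in>U. \<exists>K e. compact K \<and> e > 0 \<and> cc_nbhd f K e \<subseteq> U)"

definition cc_topology :: "(real \<Rightarrow> 'a::metric_space) topology" where
  "cc_topology = topology cc_open"

lemma istopology_cc_open: "istopology (cc_open :: (real \<Rightarrow> 'a::metric_space) set \<Rightarrow> bool)"
  unfolding istopology_def
proof (intro conjI allI impI)
  fix S T :: "(real \<Rightarrow> 'a) set"
  assume S: "cc_open S" and T: "cc_open T"
  have "\<exists>K e. compact K \<and> e > 0 \<and> cc_nbhd f K e \<subseteq> S \<inter> T" if f: "f \<in> S" "f \<in> T" for f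
  proof -
    obtain K e where K: "compact K" "e > 0" "cc_nbhd f K e \<subseteq> S"
      using S f unfolding cc_open_def by blast
    obtain K' e' where K': "compact K'" "e' > 0" "cc_nbhd f K' e' \<subseteq> T"
      using T f unfolding cc_open_def by blast
    have "cc_nbhd f (K \<union> K') (min e e') \<subseteq> cc_nbhd f K e \<inter> cc_nbhd f K' e'"
      by (auto simp: cc_nbhd_def)
    then have "compact (K \<union> K') \<and> min e e' > 0 \<and> cc_nbhd f (K \<union> K') (min e e') \<subseteq> S \<inter> T"
      using K K' by (auto intro: compact_Un)
    then show ?thesis by blast
  qed
  then show "cc_open (S \<inter> T)"
    using S unfolding cc_open_def by blast
next
  fix \<K> :: "(real \<Rightarrow> 'a) set set"
  assume *: "\<forall>S\<in>\<K>. cc_open S"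
  have "\<exists>K e. compact K \<and> e > 0 \<and> cc_nbhd f K e \<subseteq> \<Union>\<K>" if f: "f \<in> \<Union>\<K>" for f
  proof -
    obtain S where S: "S \<in> \<K>" "f \<in> S" using f by blast
    then obtain K e where "compact K" "e > 0" "cc_nbhd f K e \<subseteq> S"
      using * unfolding cc_open_def by meson
    then show ?thesis using S(1) by blast
  qed
  moreover have "\<Union>\<K> \<subseteq> {f. continuous_on UNIV f}"
    using * unfolding cc_open_def by blast
  ultimately show "cc_open (\<Union>\<K>)"
    unfolding cc_open_def by blast
qed

lemma openin_cc_topology: "openin cc_topology U \<longleftrightarrow> cc_open U"
  by (simp add: cc_topology_def istopology_cc_open)

definition translate :: "(real \<Rightarrow> 'a) \<Rightarrow> real \<Rightarrow> (real \<Rightarrow> 'a)"  (infixl "\<cdot>\<^sub>t" 70) where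
  "\<omega> \<cdot>\<^sub>t t = (\<lambda>s. \<omega> (t + s))"

definition translation_hull :: "(real \<Rightarrow> 'a::metric_space) \<Rightarrow> (real \<Rightarrow> 'a) set" where
  "translation_hull p = cc_topology closure_of (range (\<lambda>t. p \<cdot>\<^sub>t t))"

lemma openin_cc_nbhd:
  assumes f: "continuous_on UNIV f" and K: "compact K"
  shows "openin cc_topology (cc_nbhd f K e)"
proof -
  have "\<exists>L \<delta>. compact L \<and> \<delta> > 0 \<and> cc_nbhd g L \<delta> \<subseteq> cc_nbhd f K e"
    if g: "g \<in> cc_nbhd f K e" for g
  proof (cases "K = {}")
    case True
    have "cc_nbhd g {} 1 \<subseteq> cc_nbhd f K e" using True by (auto simp: cc_nbhd_def)
    then show ?thesis by (meson compact_empty zero_less_one)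
  next
    case False
    have gc: "continuous_on UNIV g" and ge: "\<forall>s\<in>K. dist (g s) (f s) < e"
      using g by (auto simp: cc_nbhd_def)
    have "continuous_on K (\<lambda>s. dist (g s) (f s))"
      by (intro continuous_on_dist continuous_on_subset[OF gc] continuous_on_subset[OF f]) auto
    from continuous_attains_sup[OF K False this]
    obtain x where x: "x \<in> K" "\<forall>s\<in>K. dist (g s) (f s) \<le> dist (g x) (f x)" by blast
    define \<delta> where "\<delta> = e - dist (g x) (f x)"
    have "\<delta> > 0" using ge x(1) by (simp add: \<delta>_def)
    moreover have "cc_nbhd g K \<delta> \<subseteq> cc_nbhd f K e"
    proof
      fix h assume h: "h \<in> cc_nbhd g K \<delta>"
      have "dist (h s) (f s) < e" if s: "s \<in> K" for s
      proof -
        have "dist (h s) (f s) \<le> dist (h s) (g s) + dist (g s) (f s)" by (rule dist_triangle)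
        moreover have "dist (h s) (g s) < \<delta>" using h s by (simp add: cc_nbhd_def)
        moreover have "dist (g s) (f s) \<le> dist (g x) (f x)" using x(2) s by blast
        ultimately show ?thesis by (simp add: \<delta>_def)
      qed
      then show "h \<in> cc_nbhd f K e" using h by (simp add: cc_nbhd_def)
    qed
    ultimately show ?thesis using K by blast
  qed
  then show ?thesis
    unfolding openin_cc_topology cc_open_def by (auto simp: cc_nbhd_def)
qed

lemma topspace_cc_topology: "topspace cc_topology = {f. continuous_on UNIV f}"
proof
  show "topspace cc_topology \<subseteq> {f. continuous_on UNIV f}"
    using openin_topspace[of cc_topology] unfolding openin_cc_topology cc_open_def by blast
next
  have "cc_open {f. continuous_on UNIV f}"
    unfolding cc_open_def cc_nbhd_def by (auto intro!: exI[of _ "{}"] exI[of _ 1])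
  then show "{f. continuous_on UNIV f} \<subseteq> topspace cc_topology"
    by (intro openin_subset) (simp add: openin_cc_topology)
qed

lemma mem_translation_hull_iff:
  assumes p: "continuous_on UNIV p"
  shows "\<omega> \<in> translation_hull p \<longleftrightarrow> continuous_on UNIV \<omega> \<and>
    (\<forall>K e. compact K \<longrightarrow> e > 0 \<longrightarrow> (\<exists>t. \<forall>s\<in>K. dist (p (t + s)) (\<omega> s) < e))"
    (is "_ \<longleftrightarrow> ?C \<and> ?A")
proof
  assume h: "\<omega> \<in> translation_hull p"
  then have c: ?C
    unfolding translation_hull_def by (simp add: in_closure_of topspace_cc_topology)
  have ?A
  proof (intro allI impI)
    fix K :: "real set" and e :: real
    assume "compact K" "e > 0"
    then have "openin cc_topology (cc_nbhd \<omega> K e)" "\<omega> \<in> cc_nbhd \<omega> K e"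
      using c by (auto simp: openin_cc_nbhd) (simp add: cc_nbhd_def)
    then obtain t where "p \<cdot>\<^sub>t t \<in> cc_nbhd \<omega> K e"
      using h unfolding translation_hull_def in_closure_of by blast
    then show "\<exists>t. \<forall>s\<in>K. dist (p (t + s)) (\<omega> s) < e"
      by (auto simp: cc_nbhd_def translate_def)
  qed
  then show "?C \<and> ?A" using c by blast
next
  assume h: "?C \<and> ?A"
  have "\<exists>g. g \<in> range (\<lambda>t. p \<cdot>\<^sub>t t) \<and> g \<in> T" if T: "\<omega> \<in> T" "openin cc_topology T" for T
  proof -
    obtain K e where K: "compact K" "e > 0" "cc_nbhd \<omega> K e \<subseteq> T"
      using T unfolding openin_cc_topology cc_open_def by blast
    then obtain t where t: "\<forall>s\<in>K. dist (p (t + s)) (\<omega> s) < e" using h by blast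
    have "continuous_on UNIV (\<lambda>s. p (t + s))"
      by (rule continuous_on_compose2[OF p]) (auto intro!: continuous_intros)
    then have "p \<cdot>\<^sub>t t \<in> cc_nbhd \<omega> K e" using t by (simp add: cc_nbhd_def translate_def)
    then show ?thesis using K by blast
  qed
  then show "\<omega> \<in> translation_hull p"
    using h unfolding translation_hull_def in_closure_of topspace_cc_topology by blast
qed


subsection \<open>Coefficients\<close>

text \<open>The space \<open>\<real>\<^sup>N\<close>, \<open>N = 3n + n\<^sup>2\<close>, of coefficient vectors
  \<open>(d, a, \<beta>, c)\<close>; the entry \<open>a $ i $ j\<close> is \<open>a\<^sub>i\<^sub>j\<close>.\<close>

type_synonym 'n coeffs = "(real^'n) \<times> (real^'n^'n) \<times> (real^'n) \<times> (real^'n)"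

definition coeff_map ::
    "('n \<Rightarrow> real \<Rightarrow> real) \<Rightarrow> ('n \<Rightarrow> 'n \<Rightarrow> real \<Rightarrow> real) \<Rightarrow> ('n \<Rightarrow> real \<Rightarrow> real) \<Rightarrow>
     ('n \<Rightarrow> real \<Rightarrow> real) \<Rightarrow> real \<Rightarrow> ('n::finite) coeffs" where
  "coeff_map d a \<beta> c =
     (\<lambda>t. (\<chi> i. d i t, \<chi> i j. a i j t, \<chi> i. \<beta> i t, \<chi> i. c i t))"

definition d_hull :: "'n::finite \<Rightarrow> (real \<Rightarrow> 'n coeffs) \<Rightarrow> real" where
  "d_hull i \<omega> = (case \<omega> 0 of (d, a, \<beta>, c) \<Rightarrow> d $ i)"

definition a_hull :: "'n::finite \<Rightarrow> 'n \<Rightarrow> (real \<Rightarrow> 'n coeffs) \<Rightarrow> real" where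
  "a_hull i j \<omega> = (case \<omega> 0 of (d, a, \<beta>, c) \<Rightarrow> a $ i $ j)"

definition beta_hull :: "'n::finite \<Rightarrow> (real \<Rightarrow> 'n coeffs) \<Rightarrow> real" where
  "beta_hull i \<omega> = (case \<omega> 0 of (d, a, \<beta>, c) \<Rightarrow> \<beta> $ i)"

definition c_hull :: "'n::finite \<Rightarrow> (real \<Rightarrow> 'n coeffs) \<Rightarrow> real" where
  "c_hull i \<omega> = (case \<omega> 0 of (d, a, \<beta>, c) \<Rightarrow> c $ i)"


subsection \<open>Phase space and order\<close>

text \<open>An element of \<open>X = C([-\<tau>\<^sub>1,0]) \<times> \<dots> \<times> C([-\<tau>\<^sub>n,0])\<close> is represented by any family of total
  functions with the given restrictions; the values of \<open>\<phi> i\<close> outside \<open>[-\<tau>\<^sub>i,0]\<close> are never used.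
  In particular \<open>\<phi> \<noteq> 0\<close> has to be read on these intervals only.\<close>

type_synonym 'n history = "'n \<Rightarrow> real \<Rightarrow> real"

definition phase_space :: "('n \<Rightarrow> real) \<Rightarrow> 'n history set" where
  "phase_space \<tau> = {\<phi>. \<forall>i. continuous_on {- \<tau> i..0} (\<phi> i)}"

definition phase_cone :: "('n \<Rightarrow> real) \<Rightarrow> 'n history set" where
  "phase_cone \<tau> = {\<phi> \<in> phase_space \<tau>. \<forall>i. \<forall>s\<in>{- \<tau> i..0}. 0 \<le> \<phi> i s}"

definition phase_ge :: "('n \<Rightarrow> real) \<Rightarrow> 'n history \<Rightarrow> 'n history \<Rightarrow> bool" where
  "phase_ge \<tau> \<phi> \<psi> \<longleftrightarrow> (\<lambda>i s. \<phi> i s - \<psi> i s) \<in> phase_cone \<tau>"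

definition phase_pos :: "('n \<Rightarrow> real) \<Rightarrow> 'n history \<Rightarrow> bool" where
  "phase_pos \<tau> \<phi> \<longleftrightarrow> \<phi> \<in> phase_cone \<tau> \<and> (\<exists>i. \<exists>s\<in>{- \<tau> i..0}. \<phi> i s \<noteq> 0)"

definition phase_spos :: "('n \<Rightarrow> real) \<Rightarrow> 'n history \<Rightarrow> bool" where
  "phase_spos \<tau> \<phi> \<longleftrightarrow> \<phi> \<in> phase_space \<tau> \<and> (\<forall>i. \<forall>s\<in>{- \<tau> i..0}. 0 < \<phi> i s)"

definition at_zero :: "'n::finite history \<Rightarrow> real^'n" where
  "at_zero \<phi> = (\<chi> i. \<phi> i 0)"

definition vec_pos :: "real^'n::finite \<Rightarrow> bool" where
  "vec_pos x \<longleftrightarrow> (\<forall>i. 0 \<le> x $ i) \<and> x \<noteq> 0"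

definition vec_spos :: "real^'n::finite \<Rightarrow> bool" where
  "vec_spos x \<longleftrightarrow> (\<forall>i. 0 < x $ i)"


subsection \<open>Solutions\<close>

text \<open>At \<open>t = 0\<close> the equation holds with the right derivative, as is usual for delay equations.
  The component \<open>y i\<close> lives on \<open>[-\<tau>\<^sub>i,\<infinity>)\<close>; being extensional makes it literally unique as a
  total function.\<close>

definition nicholson_solution ::
    "('n::finite \<Rightarrow> real) \<Rightarrow> ('n \<Rightarrow> real \<Rightarrow> real) \<Rightarrow> ('n \<Rightarrow> 'n \<Rightarrow> real \<Rightarrow> real) \<Rightarrow>
     ('n \<Rightarrow> real \<Rightarrow> real) \<Rightarrow> ('n \<Rightarrow> real \<Rightarrow> real) \<Rightarrow> 'n history \<Rightarrow> ('n \<Rightarrow> real \<Rightarrow> real) \<Rightarrow> bool" where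
  "nicholson_solution \<tau> d a \<beta> c \<phi> y \<longleftrightarrow>
     (\<forall>i. y i \<in> extensional {- \<tau> i..}) \<and>
     (\<forall>i. \<forall>s\<in>{- \<tau> i..0}. y i s = \<phi> i s) \<and>
     (\<forall>i. \<forall>t\<ge>0.
        (y i has_real_derivative
           (- d i t * y i t + (\<Sum>j\<in>UNIV. a i j t * y j t)
            + \<beta> i t * y i (t - \<tau> i) * exp (- c i t * y i (t - \<tau> i))))
        (at t within {0..}))"

definition nicholson_sol ::
    "('n::finite \<Rightarrow> real) \<Rightarrow> ('n \<Rightarrow> real \<Rightarrow> real) \<Rightarrow> ('n \<Rightarrow> 'n \<Rightarrow> real \<Rightarrow> real) \<Rightarrow>
     ('n \<Rightarrow> real \<Rightarrow> real) \<Rightarrow> ('n \<Rightarrow> real \<Rightarrow> real) \<Rightarrow> 'n history \<Rightarrow> 'n \<Rightarrow> real \<Rightarrow> real" where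
  "nicholson_sol \<tau> d a \<beta> c \<phi> = (THE y. nicholson_solution \<tau> d a \<beta> c \<phi> y)"

definition family_sol ::
    "('n::finite \<Rightarrow> real) \<Rightarrow> (real \<Rightarrow> 'n coeffs) \<Rightarrow> 'n history \<Rightarrow> 'n \<Rightarrow> real \<Rightarrow> real" where
  "family_sol \<tau> \<omega> =
     nicholson_sol \<tau> (\<lambda>i t. d_hull i (\<omega> \<cdot>\<^sub>t t)) (\<lambda>i j t. a_hull i j (\<omega> \<cdot>\<^sub>t t))
       (\<lambda>i t. beta_hull i (\<omega> \<cdot>\<^sub>t t)) (\<lambda>i t. c_hull i (\<omega> \<cdot>\<^sub>t t))"

definition segment :: "('n \<Rightarrow> real \<Rightarrow> real) \<Rightarrow> real \<Rightarrow> 'n history" where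
  "segment y t = (\<lambda>i s. y i (t + s))"

lemma family_sol_coeff_map:
  "family_sol \<tau> (coeff_map d a \<beta> c) = nicholson_sol \<tau> d a \<beta> c"
  by (simp add: family_sol_def coeff_map_def translate_def
      d_hull_def a_hull_def beta_hull_def c_hull_def)


subsection \<open>Persistence\<close>

definition uniformly_persistent_at_0 ::
    "('n::finite \<Rightarrow> real) \<Rightarrow> ('n \<Rightarrow> real \<Rightarrow> real) \<Rightarrow> ('n \<Rightarrow> 'n \<Rightarrow> real \<Rightarrow> real) \<Rightarrow>
     ('n \<Rightarrow> real \<Rightarrow> real) \<Rightarrow> ('n \<Rightarrow> real \<Rightarrow> real) \<Rightarrow> bool" where
  "uniformly_persistent_at_0 \<tau> d a \<beta> c \<longleftrightarrow>
     (\<exists>m>0. \<forall>\<phi>\<in>phase_cone \<tau>. vec_spos (at_zero \<phi>) \<longrightarrow>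
        (\<exists>t0\<ge>0. \<forall>t\<ge>t0. \<forall>i. nicholson_sol \<tau> d a \<beta> c \<phi> i t \<ge> m))"

definition strictly_persistent_at_0 ::
    "('n::finite \<Rightarrow> real) \<Rightarrow> ('n \<Rightarrow> real \<Rightarrow> real) \<Rightarrow> ('n \<Rightarrow> 'n \<Rightarrow> real \<Rightarrow> real) \<Rightarrow>
     ('n \<Rightarrow> real \<Rightarrow> real) \<Rightarrow> ('n \<Rightarrow> real \<Rightarrow> real) \<Rightarrow> bool" where
  "strictly_persistent_at_0 \<tau> d a \<beta> c \<longleftrightarrow>
     (\<exists>m>0. \<forall>\<phi>\<in>phase_cone \<tau>. vec_pos (at_zero \<phi>) \<longrightarrow>
        (\<exists>t0\<ge>0. \<exists>i. \<forall>t\<ge>t0. nicholson_sol \<tau> d a \<beta> c \<phi> i t \<ge> m))"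

definition family_uniformly_persistent ::
    "('n::finite \<Rightarrow> real) \<Rightarrow> (real \<Rightarrow> 'n coeffs) set \<Rightarrow> bool" where
  "family_uniformly_persistent \<tau> \<Omega> \<longleftrightarrow>
     (\<exists>\<psi>. phase_spos \<tau> \<psi> \<and>
        (\<forall>\<omega>\<in>\<Omega>. \<forall>\<phi>. phase_spos \<tau> \<phi> \<longrightarrow>
           (\<exists>t0\<ge>0. \<forall>t\<ge>t0. phase_ge \<tau> (segment (family_sol \<tau> \<omega> \<phi>) t) \<psi>)))"

definition family_strictly_persistent_at_0 ::
    "('n::finite \<Rightarrow> real) \<Rightarrow> (real \<Rightarrow> 'n coeffs) set \<Rightarrow> bool" where
  "family_strictly_persistent_at_0 \<tau> \<Omega> \<longleftrightarrow>
     (\<exists>E. finite E \<and> (\<forall>e\<in>E. phase_pos \<tau> e) \<and>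
        (\<forall>\<omega>\<in>\<Omega>. \<forall>\<phi>\<in>phase_cone \<tau>. vec_pos (at_zero \<phi>) \<longrightarrow>
           (\<exists>t0\<ge>0. \<exists>e\<in>E. \<forall>t\<ge>t0. phase_ge \<tau> (segment (family_sol \<tau> \<omega> \<phi>) t) e)))"

end

theory Submission
  imports Defs
begin

text \<open>
  Translates of \<open>p\<close> approximate every \<open>\<omega>\<close> in the hull uniformly on the line. Suppose a solution \<open>w\<close> of
  \<open>(N)\<close> stays above \<open>m\<close> on a set \<open>K\<close> of components and vanishes off \<open>K\<close>. Since \<open>exp (- c w) \<le> exp (- c0 m)\<close>,
  the bounded function \<open>w\<close> is a subsolution, with room to spare, of the cooperative linear system obtained
  by replacing \<open>exp (- c y)\<close> with a constant \<open>\<kappa>\<close> slightly above \<open>exp (- c0 m)\<close>. Small positive solutions of the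
  system for \<open>\<omega>\<close> are supersolutions of such a linear system, so \<open>\<epsilon> w(s + \<cdot>)\<close> can be placed below any solution that is
  positive on \<open>K\<close>, and the room to spare lets \<open>\<epsilon>\<close> grow exponentially up to a threshold that depends neither
  on \<open>\<omega>\<close> nor on the solution. For uniform persistence \<open>K\<close> consists of all components. For strict
  persistence \<open>K\<close> runs over the terminal strong components of the coupling graph: there a lower bound
  on one component spreads to all of \<open>K\<close>, and every solution with \<open>\<phi>(0) > 0\<close> becomes positive on some \<open>K\<close>.
\<close>

section \<open>Almost periodic maps and their hulls\<close>

text \<open>Two obstacles shape the argument. First, the strict inequalities (a4) and (a6) may
  degenerate: the birth rate and the dominance defect can have infimum 0, so over the hull only weak
  inequalities hold pointwise. Strictness is recovered on average: every orbit in the hull returns,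
  with gaps bounded by some \<open>L\<close>, to windows of length \<open>h\<close> on which it is
  close to the value of \<open>p\<close> at a chosen time. This yields ultimate boundedness, the
  spread of lower bounds along couplings, and a gain in the subsolution that is uniform in time.
  Second, u exp (- c u) is not monotone in u, so solutions cannot be compared with each other
  directly. Once solutions lie below a common bound \<open>M\<close>, this term is replaced from
  below by a multiple of a truncation of u. The factor that grows is a logistic curve: its rate is
  at most \<theta>, which the spare gain can pay for, and it saturates at \<epsilon>, which keeps
  the product below the truncation level. Several hypotheses concern t \<ge> 0 only; they reach the
  whole hull because approximating translates can be taken arbitrarily far to the right.\<close>

definition has_almost_periods :: "(real \<Rightarrow> 'a::metric_space) \<Rightarrow> bool" where
  "has_almost_periods f \<longleftrightarrow> (\<forall>\<epsilon>>0. relatively_dense {r. \<forall>t. dist (f (t + r)) (f t) < \<epsilon>})"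

text \<open>Total boundedness of the set of translates in the uniform metric (Bochner's form of
  almost periodicity), written as a finite colouring of the shifts. Unlike relative density of
  almost periods, this form passes to tuples at once, by pairing colours.\<close>

definition translation_precompact :: "(real \<Rightarrow> 'a::metric_space) \<Rightarrow> bool" where
  "translation_precompact f \<longleftrightarrow> (\<forall>\<epsilon>>0. \<exists>k :: real \<Rightarrow> real. finite (range k) \<and>
     (\<forall>s t. k s = k t \<longrightarrow> (\<forall>x. dist (f (x + s)) (f (x + t)) < \<epsilon>)))"

lemma dist_triangle_chain3:
  fixes a b c d :: "'a::metric_space"
  shows "dist a d \<le> dist a b + dist b c + dist c d"
  using dist_triangle[of a d b] dist_triangle[of b d c] by linarith

lemma relatively_denseE:
  assumes "relatively_dense S"
  obtains L where "L > 0" "\<And>a. \<exists>r\<in>S. a \<le> r \<and> r \<le> a + L"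
proof -
  obtain L where L: "L > 0" "\<forall>a. S \<inter> {a..a + L} \<noteq> {}"
    using assms unfolding relatively_dense_def by blast
  have "\<exists>r\<in>S. a \<le> r \<and> r \<le> a + L" for a
  proof -
    obtain r where "r \<in> S \<inter> {a..a + L}" using L(2) by blast
    then show ?thesis by auto
  qed
  then show ?thesis using that L(1) by blast
qed

lemma has_almost_periodsE:
  assumes "has_almost_periods f" "\<epsilon> > 0"
  obtains L where "L > 0" "\<And>a. \<exists>r. (\<forall>t. dist (f (t + r)) (f t) < \<epsilon>) \<and> a \<le> r \<and> r \<le> a + L"
proof -
  have "relatively_dense {r. \<forall>t. dist (f (t + r)) (f t) < \<epsilon>}"
    using assms unfolding has_almost_periods_def by blast
  then show ?thesis by (rule relatively_denseE) (use that in blast)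
qed

text \<open>Colours may come from any type: replacing each colour by one shift that carries it gives
  the real-valued colouring that the definition asks for.\<close>

lemma translation_precompactI:
  fixes f :: "real \<Rightarrow> 'a::metric_space"
  assumes "\<And>\<epsilon>. \<epsilon> > 0 \<Longrightarrow> \<exists>K :: real \<Rightarrow> 'c. finite (range K) \<and>
     (\<forall>s t. K s = K t \<longrightarrow> (\<forall>x. dist (f (x + s)) (f (x + t)) < \<epsilon>))"
  shows "translation_precompact f"
  unfolding translation_precompact_def
proof (intro allI impI)
  fix \<epsilon> :: real assume "\<epsilon> > 0"
  from assms[OF this] obtain K :: "real \<Rightarrow> 'c" where K: "finite (range K)"
    "\<forall>s t. K s = K t \<longrightarrow> (\<forall>x. dist (f (x + s)) (f (x + t)) < \<epsilon>)" by blast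
  define k where "k = (\<lambda>t. inv K (K t))"
  have "range k = inv K ` range K" by (auto simp: k_def)
  then have "finite (range k)" using K(1) by simp
  moreover have "K s = K t" if "k s = k t" for s t
  proof -
    have "K (k u) = K u" for u unfolding k_def by (rule f_inv_into_f) simp
    then show ?thesis using that by metis
  qed
  ultimately show "\<exists>k :: real \<Rightarrow> real. finite (range k) \<and>
     (\<forall>s t. k s = k t \<longrightarrow> (\<forall>x. dist (f (x + s)) (f (x + t)) < \<epsilon>))"
    using K(2) by blast
qed

text \<open>A single almost period carries both arguments into one compact window, where uniform
  continuity is available. The margins of length 1 keep the second point inside.\<close>

lemma has_almost_periods_imp_uniformly_continuous:
  fixes f :: "real \<Rightarrow> 'a::metric_space"
  assumes f: "continuous_on UNIV f" and ap: "has_almost_periods f" and e: "\<epsilon> > 0"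
  shows "\<exists>\<eta>>0. \<forall>x y. \<bar>x - y\<bar> < \<eta> \<longrightarrow> dist (f x) (f y) < \<epsilon>"
proof -
  obtain L where L: "L > 0"
    and r: "\<And>a. \<exists>r. (\<forall>t. dist (f (t + r)) (f t) < \<epsilon> / 3) \<and> a \<le> r \<and> r \<le> a + L"
    using has_almost_periodsE[OF ap, of "\<epsilon> / 3"] e by auto
  have "uniformly_continuous_on {-1..L+1} f"
    by (intro compact_uniformly_continuous continuous_on_subset[OF f]) auto
  then obtain \<eta> where eta: "\<eta> > 0"
    and u: "\<forall>x\<in>{-1..L+1}. \<forall>y\<in>{-1..L+1}. dist y x < \<eta> \<longrightarrow> dist (f y) (f x) < \<epsilon> / 3"
    using e unfolding uniformly_continuous_on_def
    by (elim allE[of _ "\<epsilon> / 3"] impE) auto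
  have "dist (f x) (f y) < \<epsilon>" if xy: "\<bar>x - y\<bar> < min \<eta> 1" for x y
  proof -
    obtain r where r: "\<forall>t. dist (f (t + r)) (f t) < \<epsilon> / 3" "- x \<le> r" "r \<le> - x + L" using r by blast
    have "dist (f (x + r)) (f (y + r)) < \<epsilon> / 3"
    proof (rule u[rule_format])
      show "x + r \<in> {-1..L+1}" "y + r \<in> {-1..L+1}"
        unfolding atLeastAtMost_iff using xy r(2,3) by linarith+
    qed (use xy in \<open>auto simp: dist_real_def\<close>)
    moreover have "dist (f (x + r)) (f x) < \<epsilon> / 3" "dist (f (y + r)) (f y) < \<epsilon> / 3" using r(1) by auto
    moreover have "dist (f x) (f y) \<le> dist (f (x + r)) (f x) + dist (f (x + r)) (f (y + r)) + dist (f (y + r)) (f y)"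
      using dist_triangle_chain3[of "f x" "f y" "f (x + r)" "f (y + r)"] by (simp add: dist_commute)
    ultimately show ?thesis by linarith
  qed
  then show ?thesis using eta by (intro exI[of _ "min \<eta> 1"]) auto
qed

text \<open>One half of Bochner's theorem: an almost period \<open>r t\<close> brings the shift t
  into [0, L], and the colour of t is the cell of length \<eta> that contains t + r t.\<close>

lemma has_almost_periods_imp_precompact:
  fixes f :: "real \<Rightarrow> 'a::metric_space"
  assumes f: "continuous_on UNIV f" and ap: "has_almost_periods f"
  shows "translation_precompact f"
proof (rule translation_precompactI)
  fix \<epsilon> :: real assume e: "\<epsilon> > 0"
  obtain L where L: "L > 0"
    and "\<And>a. \<exists>r. (\<forall>t. dist (f (t + r)) (f t) < \<epsilon> / 3) \<and> a \<le> r \<and> r \<le> a + L"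
    using has_almost_periodsE[OF ap, of "\<epsilon> / 3"] e by auto
  then have "\<forall>t. \<exists>r. (\<forall>x. dist (f (x + r)) (f x) < \<epsilon> / 3) \<and> - t \<le> r \<and> r \<le> - t + L" by blast
  then obtain r where r: "\<And>t x. dist (f (x + r t)) (f x) < \<epsilon> / 3" "\<And>t. - t \<le> r t" "\<And>t. r t \<le> - t + L"
    by metis
  obtain \<eta> where eta: "\<eta> > 0" and u: "\<And>x y. \<bar>x - y\<bar> < \<eta> \<Longrightarrow> dist (f x) (f y) < \<epsilon> / 3"
    using has_almost_periods_imp_uniformly_continuous[OF f ap, of "\<epsilon> / 3"] e by auto
  define K where "K = (\<lambda>t. \<lfloor>(t + r t) / \<eta>\<rfloor>)"
  have "range K \<subseteq> {0..\<lfloor>L / \<eta>\<rfloor>}"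
  proof
    fix z assume "z \<in> range K"
    then obtain t where z: "z = \<lfloor>(t + r t) / \<eta>\<rfloor>" by (auto simp: K_def)
    have "0 \<le> (t + r t) / \<eta>" "(t + r t) / \<eta> \<le> L / \<eta>"
      using r(2,3)[of t] eta by (auto intro!: divide_right_mono divide_nonneg_pos)
    then show "z \<in> {0..\<lfloor>L / \<eta>\<rfloor>}" by (auto simp: z intro: floor_mono)
  qed
  then have "finite (range K)" using finite_subset by blast
  moreover have "dist (f (x + s)) (f (x + t)) < \<epsilon>" if st: "K s = K t" for s t x
  proof -
    have "\<bar>(s + r s) / \<eta> - (t + r t) / \<eta>\<bar> < 1"
      using st unfolding K_def by linarith
    then have "\<bar>(s + r s) - (t + r t)\<bar> < \<eta>"
      using eta by (simp add: diff_divide_distrib[symmetric] field_simps)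
    then have "dist (f (x + s + r s)) (f (x + t + r t)) < \<epsilon> / 3" by (intro u) (simp add: algebra_simps)
    moreover have "dist (f (x + s + r s)) (f (x + s)) < \<epsilon> / 3" "dist (f (x + t + r t)) (f (x + t)) < \<epsilon> / 3"
      using r(1) by auto
    moreover have "dist (f (x + s)) (f (x + t)) \<le> dist (f (x + s + r s)) (f (x + s)) +
        dist (f (x + s + r s)) (f (x + t + r t)) + dist (f (x + t + r t)) (f (x + t))"
      using dist_triangle_chain3[of "f (x + s)" "f (x + t)" "f (x + s + r s)" "f (x + t + r t)"]
      by (simp add: dist_commute)
    ultimately show ?thesis by linarith
  qed
  ultimately show "\<exists>K :: real \<Rightarrow> int. finite (range K) \<and>
      (\<forall>s t. K s = K t \<longrightarrow> (\<forall>x. dist (f (x + s)) (f (x + t)) < \<epsilon>))" by blast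
qed

text \<open>If \<open>R t\<close> is the representative of the colour of t, then t - R t is an
  almost period. As \<open>R\<close> takes finitely many values, these differences stay within
  bounded distance of t and hence are relatively dense.\<close>

lemma precompact_imp_has_almost_periods:
  fixes f :: "real \<Rightarrow> 'a::metric_space"
  assumes "translation_precompact f"
  shows "has_almost_periods f"
  unfolding has_almost_periods_def
proof (intro allI impI)
  fix \<epsilon> :: real assume "\<epsilon> > 0"
  then obtain k :: "real \<Rightarrow> real" where k: "finite (range k)"
    "\<forall>s t. k s = k t \<longrightarrow> (\<forall>x. dist (f (x + s)) (f (x + t)) < \<epsilon>)"
    using assms unfolding translation_precompact_def by blast
  define R where "R = (\<lambda>t. inv k (k t))"
  have R: "k (R t) = k t" for t unfolding R_def by (rule f_inv_into_f) simp
  have "range R = inv k ` range k" by (auto simp: R_def)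
  then have "finite (range R)" using k(1) by simp
  then obtain B where B: "\<And>t. \<bar>R t\<bar> \<le> B"
    using finite_imp_bounded[of "range R"] unfolding bounded_iff by auto
  define L where "L = 2 * (\<bar>B\<bar> + 1)"
  have "\<exists>r\<in>{a..a+L}. \<forall>t. dist (f (t + r)) (f t) < \<epsilon>" for a
  proof -
    define t where "t = a + \<bar>B\<bar> + 1"
    have "dist (f (x + (t - R t))) (f x) < \<epsilon>" for x
      using k(2)[rule_format, of t "R t" "x - R t"] R[of t] by (simp add: algebra_simps)
    moreover have "t - R t \<in> {a..a+L}" using B[of t] by (auto simp: t_def L_def)
    ultimately show ?thesis by blast
  qed
  then have "\<forall>a. {r. \<forall>t. dist (f (t + r)) (f t) < \<epsilon>} \<inter> {a..a+L} \<noteq> {}" by blast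
  moreover have "L > 0" by (simp add: L_def)
  ultimately show "relatively_dense {r. \<forall>t. dist (f (t + r)) (f t) < \<epsilon>}"
    unfolding relatively_dense_def by blast
qed

lemma translation_precompact_Pair:
  fixes f :: "real \<Rightarrow> 'a::metric_space" and g :: "real \<Rightarrow> 'b::metric_space"
  assumes "translation_precompact f" "translation_precompact g"
  shows "translation_precompact (\<lambda>t. (f t, g t))"
proof (rule translation_precompactI)
  fix \<epsilon> :: real assume "\<epsilon> > 0"
  then have e: "\<epsilon> / 2 > 0" by simp
  obtain k :: "real \<Rightarrow> real" where k: "finite (range k)"
    "\<forall>s t. k s = k t \<longrightarrow> (\<forall>x. dist (f (x + s)) (f (x + t)) < \<epsilon> / 2)"
    using assms(1) e unfolding translation_precompact_def by blast
  obtain l :: "real \<Rightarrow> real" where l: "finite (range l)"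
    "\<forall>s t. l s = l t \<longrightarrow> (\<forall>x. dist (g (x + s)) (g (x + t)) < \<epsilon> / 2)"
    using assms(2) e unfolding translation_precompact_def by blast
  have "range (\<lambda>t. (k t, l t)) \<subseteq> range k \<times> range l" by auto
  then have "finite (range (\<lambda>t. (k t, l t)))" using k(1) l(1) by (meson finite_SigmaI finite_subset)
  moreover have "dist (f (x + s), g (x + s)) (f (x + t), g (x + t)) < \<epsilon>"
    if "(k s, l s) = (k t, l t)" for s t x
  proof -
    have "dist (f (x + s)) (f (x + t)) < \<epsilon> / 2" "dist (g (x + s)) (g (x + t)) < \<epsilon> / 2"
      using that k(2) l(2) by auto
    moreover have "dist (f (x + s), g (x + s)) (f (x + t), g (x + t)) \<le>
        dist (f (x + s)) (f (x + t)) + dist (g (x + s)) (g (x + t))"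
      unfolding dist_Pair_Pair by (rule sqrt_sum_squares_le_sum) auto
    ultimately show ?thesis by linarith
  qed
  ultimately show "\<exists>K :: real \<Rightarrow> real \<times> real. finite (range K) \<and> (\<forall>s t. K s = K t \<longrightarrow>
      (\<forall>x. dist (f (x + s), g (x + s)) (f (x + t), g (x + t)) < \<epsilon>))"
    by (intro exI[of _ "\<lambda>t. (k t, l t)"]) blast
qed

lemma translation_precompact_vec:
  fixes f :: "'n::finite \<Rightarrow> real \<Rightarrow> 'a::metric_space"
  assumes "\<And>i. translation_precompact (f i)"
  shows "translation_precompact (\<lambda>t. \<chi> i. f i t)"
proof (rule translation_precompactI)
  fix \<epsilon> :: real assume "\<epsilon> > 0"
  then have e: "\<epsilon> / real CARD('n) > 0" by simp
  have "\<forall>i. \<exists>k :: real \<Rightarrow> real. finite (range k) \<and>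
    (\<forall>s t. k s = k t \<longrightarrow> (\<forall>x. dist (f i (x + s)) (f i (x + t)) < \<epsilon> / real CARD('n)))"
    using assms e unfolding translation_precompact_def by blast
  then obtain k :: "'n \<Rightarrow> real \<Rightarrow> real" where k: "\<And>i. finite (range (k i))"
    "\<And>i s t x. k i s = k i t \<Longrightarrow> dist (f i (x + s)) (f i (x + t)) < \<epsilon> / real CARD('n)"
    by metis
  have "range (\<lambda>t i. k i t) \<subseteq> PiE UNIV (\<lambda>i. range (k i))" by (auto simp: PiE_def)
  moreover have "finite (PiE UNIV (\<lambda>i. range (k i)))" by (intro finite_PiE) (auto simp: k(1))
  ultimately have "finite (range (\<lambda>t i. k i t))" by (rule finite_subset)
  moreover have "dist (\<chi> i. f i (x + s)) (\<chi> i. f i (x + t)) < \<epsilon>"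
    if "(\<lambda>i. k i s) = (\<lambda>i. k i t)" for s t x
  proof -
    have "k i s = k i t" for i using that by meson
    then have "dist (f i (x + s)) (f i (x + t)) < \<epsilon> / real CARD('n)" for i using k(2) by blast
    then have "(\<Sum>i\<in>(UNIV::'n set). dist (f i (x + s)) (f i (x + t))) < (\<Sum>i\<in>(UNIV::'n set). \<epsilon> / real CARD('n))"
      by (intro sum_strict_mono) auto
    moreover have "(\<Sum>i\<in>(UNIV::'n set). \<epsilon> / real CARD('n)) = \<epsilon>" by simp
    moreover have "dist (\<chi> i. f i (x + s)) (\<chi> i. f i (x + t)) \<le> (\<Sum>i\<in>UNIV. dist (f i (x + s)) (f i (x + t)))"
      unfolding dist_vec_def by (rule order_trans[OF L2_set_le_sum]) auto
    ultimately show ?thesis by linarith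
  qed
  ultimately show "\<exists>K :: real \<Rightarrow> 'n \<Rightarrow> real. finite (range K) \<and> (\<forall>s t. K s = K t \<longrightarrow>
      (\<forall>x. dist (\<chi> i. f i (x + s)) (\<chi> i. f i (x + t)) < \<epsilon>))"
    by (intro exI[of _ "\<lambda>t i. k i t"]) blast
qed

section \<open>Uniform approximation and recurrence in the hull\<close>

lemma has_almost_periods_hull:
  fixes p :: "real \<Rightarrow> 'a::metric_space"
  assumes p: "continuous_on UNIV p" and w: "\<omega> \<in> translation_hull p"
    and r: "\<forall>t. dist (p (t + r)) (p t) < \<epsilon>"
  shows "dist (\<omega> (t + r)) (\<omega> t) \<le> \<epsilon>"
proof (rule field_le_epsilon)
  fix e :: real assume "e > 0"
  then have "compact {t + r, t}" "e / 2 > 0" by auto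
  then obtain s where s: "\<forall>u\<in>{t + r, t}. dist (p (s + u)) (\<omega> u) < e / 2"
    using w unfolding mem_translation_hull_iff[OF p] by blast
  have "dist (p (s + (t + r))) (p (s + t)) < \<epsilon>" using r[rule_format, of "s + t"] by (simp add: add.assoc)
  moreover have "dist (p (s + (t + r))) (\<omega> (t + r)) < e / 2" "dist (p (s + t)) (\<omega> t) < e / 2" using s by auto
  moreover have "dist (\<omega> (t + r)) (\<omega> t) \<le> dist (p (s + (t + r))) (\<omega> (t + r)) +
      dist (p (s + (t + r))) (p (s + t)) + dist (p (s + t)) (\<omega> t)"
    using dist_triangle_chain3[of "\<omega> (t + r)" "\<omega> t" "p (s + (t + r))" "p (s + t)"]
    by (simp add: dist_commute)
  ultimately show "dist (\<omega> (t + r)) (\<omega> t) \<le> \<epsilon> + e" by linarith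
qed

text \<open>Approximation on compact sets improves to approximation on the line: it is used on the
  one window [0, L], and any t is moved into that window by an almost period that \<open>p\<close>
  and \<omega> share.\<close>

lemma hull_uniform_approx:
  fixes p :: "real \<Rightarrow> 'a::metric_space"
  assumes p: "continuous_on UNIV p" and ap: "has_almost_periods p"
    and w: "\<omega> \<in> translation_hull p" and z: "\<zeta> > 0"
  shows "\<exists>s\<ge>T. \<forall>t. dist (p (s + t)) (\<omega> t) < \<zeta>"
proof -
  have z4: "\<zeta> / 4 > 0" using z by simp
  obtain L where L: "L > 0"
    and r: "\<And>a. \<exists>r. (\<forall>t. dist (p (t + r)) (p t) < \<zeta> / 4) \<and> a \<le> r \<and> r \<le> a + L"
    using has_almost_periodsE[OF ap, of "\<zeta> / 4"] z by auto
  obtain s0 where s0: "\<forall>u\<in>{0..L}. dist (p (s0 + u)) (\<omega> u) < \<zeta> / 4"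
    using w z4 unfolding mem_translation_hull_iff[OF p] by (meson compact_Icc)
  \<comment> \<open>A further almost period pushes the shift beyond \<open>T\<close>, into the range
    where the hypotheses on the half-line apply.\<close>
  obtain q where q: "\<forall>t. dist (p (t + q)) (p t) < \<zeta> / 4" "T - s0 \<le> q" using r by blast
  have "dist (p (s0 + q + t)) (\<omega> t) < \<zeta>" for t
  proof -
    obtain r where r: "\<forall>t. dist (p (t + r)) (p t) < \<zeta> / 4" "- t \<le> r" "r \<le> - t + L" using r by blast
    have "dist (p (s0 + t + q)) (p (s0 + t)) < \<zeta> / 4" using q by blast
    moreover have "dist (p (s0 + t + r)) (p (s0 + t)) < \<zeta> / 4" using r by blast
    moreover have "dist (p (s0 + (t + r))) (\<omega> (t + r)) < \<zeta> / 4" using s0 r by auto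
    moreover have "dist (\<omega> (t + r)) (\<omega> t) \<le> \<zeta> / 4" by (rule has_almost_periods_hull[OF p w r(1)])
    moreover have "dist (p (s0 + q + t)) (\<omega> t) \<le> dist (p (s0 + t + q)) (p (s0 + t)) +
        dist (p (s0 + t + r)) (p (s0 + t)) + dist (p (s0 + (t + r))) (\<omega> t)"
      using dist_triangle_chain3[of "p (s0 + t + q)" "\<omega> t" "p (s0 + t)" "p (s0 + t + r)"]
      by (simp add: dist_commute ac_simps)
    moreover have "dist (p (s0 + (t + r))) (\<omega> t) \<le> dist (p (s0 + (t + r))) (\<omega> (t + r)) + dist (\<omega> (t + r)) (\<omega> t)"
      by (rule dist_triangle)
    ultimately show ?thesis by linarith
  qed
  moreover have "s0 + q \<ge> T" using q by linarith
  ultimately show ?thesis by blast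
qed

text \<open>Uniform continuity of \<open>p\<close> gives the window length, relative density the
  gap, and uniform approximation by translates of \<open>p\<close> makes both independent of
  \<omega>.\<close>

lemma hull_recurrence:
  fixes p :: "real \<Rightarrow> 'a::metric_space"
  assumes p: "continuous_on UNIV p" and ap: "has_almost_periods p" and z: "\<zeta> > 0"
  shows "\<exists>h>0. \<exists>L>0. \<forall>\<omega>\<in>translation_hull p. \<forall>t. \<exists>s\<ge>t. s + h \<le> t + L \<and>
           (\<forall>r\<in>{s..s+h}. dist (\<omega> r) (p t0) < \<zeta>)"
proof -
  have z3: "\<zeta> / 3 > 0" using z by simp
  obtain L where L: "L > 0"
    and r: "\<And>a. \<exists>r. (\<forall>t. dist (p (t + r)) (p t) < \<zeta> / 3) \<and> a \<le> r \<and> r \<le> a + L"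
    using has_almost_periodsE[OF ap, of "\<zeta> / 3"] z by auto
  obtain \<eta> where eta: "\<eta> > 0" "\<And>x y. \<bar>x - y\<bar> < \<eta> \<Longrightarrow> dist (p x) (p y) < \<zeta> / 3"
    using has_almost_periods_imp_uniformly_continuous[OF p ap z3] by blast
  define h where "h = \<eta> / 2"
  have h: "h > 0" using eta by (simp add: h_def)
  have "\<exists>s\<ge>t. s + h \<le> t + (L + h) \<and> (\<forall>r\<in>{s..s+h}. dist (\<omega> r) (p t0) < \<zeta>)"
    if w: "\<omega> \<in> translation_hull p" for \<omega> t
  proof -
    obtain s0 where s0: "\<forall>t. dist (p (s0 + t)) (\<omega> t) < \<zeta> / 3"
      using hull_uniform_approx[OF p ap w z3] by blast
    obtain r where r: "\<forall>t. dist (p (t + r)) (p t) < \<zeta> / 3"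
      "s0 + t - t0 \<le> r" "r \<le> s0 + t - t0 + L" using r by blast
    \<comment> \<open>Solves s0 + s - r = t0, so that at the left end of the window the translate of
      \<open>p\<close>, moved back by its almost period, is exactly at t0.\<close>
    define s where "s = t0 + r - s0"
    have "dist (\<omega> u) (p t0) < \<zeta>" if u: "u \<in> {s..s+h}" for u
    proof -
      have "dist (p (s0 + u)) (\<omega> u) < \<zeta> / 3" using s0 by blast
      moreover have "dist (p (s0 + u)) (p (s0 + u - r)) < \<zeta> / 3"
        using r(1)[rule_format, of "s0 + u - r"] by simp
      moreover have "dist (p (s0 + u - r)) (p t0) < \<zeta> / 3"
        using u eta(1) by (intro eta(2)) (auto simp: s_def h_def)
      moreover have "dist (\<omega> u) (p t0) \<le> dist (p (s0 + u)) (\<omega> u) +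
          dist (p (s0 + u)) (p (s0 + u - r)) + dist (p (s0 + u - r)) (p t0)"
        using dist_triangle_chain3[of "\<omega> u" "p t0" "p (s0 + u)" "p (s0 + u - r)"] by (simp add: dist_commute)
      ultimately show ?thesis by linarith
    qed
    moreover have "s \<ge> t" "s + h \<le> t + (L + h)" using r by (auto simp: s_def)
    ultimately show ?thesis by blast
  qed
  moreover have "L + h > 0" using L h by simp
  ultimately show ?thesis using h by blast
qed

lemma has_almost_periods_imp_bounded:
  fixes p :: "real \<Rightarrow> 'a::metric_space"
  assumes p: "continuous_on UNIV p" and ap: "has_almost_periods p"
  shows "bounded (range p)"
proof -
  obtain L where L: "L > 0"
    and r: "\<And>a. \<exists>r. (\<forall>t. dist (p (t + r)) (p t) < 1) \<and> a \<le> r \<and> r \<le> a + L"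
    using has_almost_periodsE[OF ap, of "1"]  by auto
  have "compact (p ` {0..L})" by (intro compact_continuous_image continuous_on_subset[OF p]) auto
  then have "bounded (p ` {0..L})" by (rule compact_imp_bounded)
  then obtain x e where xe: "\<forall>t\<in>{0..L}. dist x (p t) \<le> e" unfolding bounded_def by auto
  have "dist x (p t) \<le> e + 1" for t
  proof -
    obtain r where r: "\<forall>t. dist (p (t + r)) (p t) < 1" "- t \<le> r" "r \<le> - t + L" using r by blast
    have "dist x (p (t + r)) \<le> e" using xe r by auto
    moreover have "dist (p (t + r)) (p t) < 1" using r by blast
    moreover have "dist x (p t) \<le> dist x (p (t + r)) + dist (p (t + r)) (p t)" by (rule dist_triangle)
    ultimately show ?thesis by linarith
  qed
  then show ?thesis unfolding bounded_def by blast
qed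

section \<open>Differential inequalities\<close>

text \<open>Adding e exp (\<mu> (t - T)) makes all signs strict: at the first time a perturbed
  component reaches 0 its derivative would be positive, although the component was positive before.
  Then e tends to 0.\<close>

lemma cooperative_nonneg:
  fixes v v' :: "'k \<Rightarrow> real \<Rightarrow> real"
  assumes I: "finite I" and C: "C \<ge> 0"
    and deriv: "\<And>i t. i \<in> I \<Longrightarrow> T \<le> t \<Longrightarrow> t \<le> S \<Longrightarrow> (v i has_real_derivative v' i t) (at t within {T..S})"
    and ineq: "\<And>i t. i \<in> I \<Longrightarrow> T \<le> t \<Longrightarrow> t \<le> S \<Longrightarrow>
                 - D i t * v i t + (\<Sum>j\<in>I. A i j t * v j t) \<le> v' i t"
    and D: "\<And>i t. i \<in> I \<Longrightarrow> T \<le> t \<Longrightarrow> t \<le> S \<Longrightarrow> \<bar>D i t\<bar> \<le> C"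
    and A: "\<And>i j t. i \<in> I \<Longrightarrow> j \<in> I \<Longrightarrow> T \<le> t \<Longrightarrow> t \<le> S \<Longrightarrow> 0 \<le> A i j t \<and> A i j t \<le> C"
    and init: "\<And>i. i \<in> I \<Longrightarrow> 0 \<le> v i T"
    and i: "i \<in> I" and t: "T \<le> t" "t \<le> S"
  shows "0 \<le> v i t"
proof -
  \<comment> \<open>At the first zero, with E the value of the perturbation, every component of
    \<open>v\<close> is at least - E. The diagonal term costs at most C E, the coupling at most
    \<open>card I\<close> times as much, and the final 1 leaves a positive derivative.\<close>
  define \<mu> where "\<mu> = C + real (card I) * C + 1"
  have pos: "0 < v j s + e * exp (\<mu> * (s - T))"
    if e: "e > 0" and j: "j \<in> I" and s: "T \<le> s" "s \<le> S" for e j s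
  proof (rule ccontr)
    assume neg: "\<not> ?thesis"
    define u where "u = (\<lambda>i t. v i t + e * exp (\<mu> * (t - T)))"
    have du: "(u i has_real_derivative (v' i t + e * \<mu> * exp (\<mu> * (t - T)))) (at t within {T..S})"
      if "i \<in> I" "T \<le> t" "t \<le> S" for i t
      unfolding u_def by (rule derivative_eq_intros deriv[OF that] refl | simp)+
    have cu: "continuous_on {T..S} (u i)" if "i \<in> I" for i
      by (rule DERIV_continuous_on) (use du that in auto)
    \<comment> \<open>The times at which some perturbed component is not positive. This set is
      compact, so it has a first element.\<close>
    define Z where "Z = (\<Union>i\<in>I. {T..S} \<inter> u i -` {..0})"
    have cl: "closed ({T..S} \<inter> u i -` {..0})" if "i \<in> I" for i
      by (rule continuous_closed_preimage[OF cu[OF that]]) auto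
    have "closed Z" unfolding Z_def using I cl by (intro closed_UN) auto
    moreover have "bounded Z" by (rule bounded_subset[of "{T..S}"]) (auto simp: Z_def)
    ultimately have cZ: "compact Z" by (simp add: compact_eq_bounded_closed)
    have "s \<in> Z" using neg j s by (auto simp: Z_def u_def not_less)
    then obtain z where z: "z \<in> Z" "\<And>x. x \<in> Z \<Longrightarrow> z \<le> x"
      using compact_attains_inf[OF cZ] by blast
    then obtain k where k: "k \<in> I" "T \<le> z" "z \<le> S" "u k z \<le> 0" by (auto simp: Z_def)
    have "z \<noteq> T" using k init[OF k(1)] e by (auto simp: u_def)
    then have zT: "T < z" using k by simp
    have before: "0 < u i x" if "i \<in> I" "T \<le> x" "x < z" for i x
    proof (rule ccontr)
      assume "\<not> 0 < u i x"
      then have "x \<in> Z" using that k unfolding Z_def by (intro UN_I[of i]) auto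
      then show False using z(2) that by fastforce
    qed
    have at: "0 \<le> u i z" if i: "i \<in> I" for i
    proof (rule ccontr)
      assume n: "\<not> 0 \<le> u i z"
      then obtain d where d: "d > 0" "\<And>x. x \<in> {T..S} \<Longrightarrow> dist x z < d \<Longrightarrow> dist (u i x) (u i z) < - u i z"
        using cu[OF i] k unfolding continuous_on_iff by (metis atLeastAtMost_iff neg_0_less_iff_less not_le)
      define x where "x = max T (z - d / 2)"
      have x: "T \<le> x" "x < z" "dist x z < d" using d(1) zT by (auto simp: x_def dist_real_def)
      then have "dist (u i x) (u i z) < - u i z" using d(2)[of x] k by auto
      then have "u i x < 0" by (auto simp: dist_real_def)
      then show False using before[OF i x(1,2)] by simp
    qed
    have "u k z = 0" using at[OF k(1)] k by simp
    define E where "E = e * exp (\<mu> * (z - T))"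
    have E: "E > 0" using e by (simp add: E_def)
    have vk: "v k z = - E" using \<open>u k z = 0\<close> by (simp add: u_def E_def)
    have "- C * E \<le> - D k z * v k z"
    proof -
      have "- C \<le> D k z" using D[OF k(1-3)] by linarith
      then show ?thesis using vk E mult_right_mono[of "- C" "D k z" E] by simp
    qed
    moreover have "(\<Sum>j\<in>I. - C * E) \<le> (\<Sum>j\<in>I. A k j z * v j z)"
    proof (rule sum_mono)
      fix j assume j: "j \<in> I"
      have "- E \<le> v j z" using at[OF j] by (simp add: u_def E_def)
      then have "A k j z * (- E) \<le> A k j z * v j z" using A[OF k(1) j k(2,3)] by (intro mult_left_mono) auto
      moreover have "A k j z * E \<le> C * E" using A[OF k(1) j k(2,3)] E by (intro mult_right_mono) auto
      ultimately show "- C * E \<le> A k j z * v j z" by linarith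
    qed
    ultimately have "v' k z + \<mu> * E \<ge> E"
      using ineq[OF k(1-3)] by (simp add: \<mu>_def algebra_simps)
    then have d: "0 < v' k z + e * \<mu> * exp (\<mu> * (z - T))" using E by (simp add: E_def algebra_simps)
    obtain d where d: "d > 0" "\<And>h. h > 0 \<Longrightarrow> z - h \<in> {T..S} \<Longrightarrow> h < d \<Longrightarrow> u k (z - h) < u k z"
      using has_real_derivative_pos_inc_left[OF du[OF k(1-3)] d] by blast
    define h where "h = min (d / 2) (z - T)"
    have "h > 0" "h < d" "z - h \<in> {T..S}" using d(1) zT k by (auto simp: h_def)
    then have "u k (z - h) < 0" using d(2) \<open>u k z = 0\<close> by fastforce
    moreover have "0 < u k (z - h)" using before[OF k(1)] \<open>h > 0\<close> \<open>z - h \<in> {T..S}\<close> by auto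
    ultimately show False by simp
  qed
  show ?thesis
  proof (rule field_le_epsilon)
    fix e :: real assume "e > 0"
    then show "0 \<le> v i t + e" using pos[of "e / exp (\<mu> * (t - T))" i t] i t by simp
  qed
qed

text \<open>Method of steps with the smallest delay as step: on each new interval the delayed
  arguments lie where nonnegativity is already known. The premise inside \<open>ineq\<close> allows
  a nonlinear delayed term to be discarded as soon as the delayed values are known to be
  nonnegative.\<close>

lemma delay_cooperative_nonneg:
  fixes v v' :: "'k \<Rightarrow> real \<Rightarrow> real"
  assumes I: "finite I" and C: "C \<ge> 0" and tau: "\<And>i. i \<in> I \<Longrightarrow> \<tau> i > 0"
    and deriv: "\<And>i t. i \<in> I \<Longrightarrow> T \<le> t \<Longrightarrow> (v i has_real_derivative v' i t) (at t within {T..})"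
    and ineq: "\<And>i t. i \<in> I \<Longrightarrow> T \<le> t \<Longrightarrow> (\<And>j. j \<in> I \<Longrightarrow> 0 \<le> v j (t - \<tau> j)) \<Longrightarrow>
                 - D i t * v i t + (\<Sum>j\<in>I. A i j t * v j t) \<le> v' i t"
    and D: "\<And>i t. i \<in> I \<Longrightarrow> T \<le> t \<Longrightarrow> \<bar>D i t\<bar> \<le> C"
    and A: "\<And>i j t. i \<in> I \<Longrightarrow> j \<in> I \<Longrightarrow> T \<le> t \<Longrightarrow> 0 \<le> A i j t \<and> A i j t \<le> C"
    and init: "\<And>i t. i \<in> I \<Longrightarrow> T - \<tau> i \<le> t \<Longrightarrow> t \<le> T \<Longrightarrow> 0 \<le> v i t"
    and i: "i \<in> I" and t: "T \<le> t"
  shows "0 \<le> v i t"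
proof -
  define \<sigma> where "\<sigma> = Min (\<tau> ` I)"
  have s: "\<sigma> > 0" "\<And>j. j \<in> I \<Longrightarrow> \<sigma> \<le> \<tau> j"
  proof -
    have "\<sigma> \<in> \<tau> ` I" unfolding \<sigma>_def using I i by (intro Min_in) auto
    then show "\<sigma> > 0" using tau by auto
  qed (use I in \<open>auto simp: \<sigma>_def\<close>)
  have step: "\<forall>j\<in>I. \<forall>r. T \<le> r \<and> r \<le> T + real k * \<sigma> \<longrightarrow> 0 \<le> v j r" for k
  proof (induction k)
    case 0
    then show ?case using init tau by (auto simp: order_less_imp_le)
  next
    case (Suc k)
    show ?case
    proof (intro ballI allI impI)
      fix j r assume j: "j \<in> I" and r: "T \<le> r \<and> r \<le> T + real (Suc k) * \<sigma>"
      show "0 \<le> v j r"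
      proof (rule cooperative_nonneg[OF I C, of T "T + real (Suc k) * \<sigma>" v v' D A])
        fix i t assume h: "i \<in> I" "T \<le> t" "t \<le> T + real (Suc k) * \<sigma>"
        show "(v i has_real_derivative v' i t) (at t within {T..T + real (Suc k) * \<sigma>})"
          by (rule DERIV_subset[OF deriv[OF h(1,2)]]) auto
        have "0 \<le> v j (t - \<tau> j)" if "j \<in> I" for j
        proof (cases "t - \<tau> j \<le> T")
          case True
          then show ?thesis using init[OF that] h by auto
        next
          case False
          then show ?thesis using Suc.IH that h s(2)[OF that] by (auto simp: algebra_simps)
        qed
        then show "- D i t * v i t + (\<Sum>j\<in>I. A i j t * v j t) \<le> v' i t" using ineq h by blast
      qed (use D A init tau j r in \<open>auto simp: order_less_imp_le\<close>)
    qed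
  qed
  obtain k :: nat where "(t - T) / \<sigma> \<le> real k" using real_arch_simple by blast
  then have "t \<le> T + real k * \<sigma>" using s(1) by (simp add: field_simps)
  then show ?thesis using step[of k] i t by blast
qed

section \<open>Scalar inequalities with recurrent source or damping\<close>

lemma DERIV_within_nonneg_imp_le:
  fixes f :: "real \<Rightarrow> real"
  assumes "T \<le> S" and "\<And>t. T \<le> t \<Longrightarrow> t \<le> S \<Longrightarrow> (f has_real_derivative f' t) (at t within {T..S})"
    and "\<And>t. T \<le> t \<Longrightarrow> t \<le> S \<Longrightarrow> 0 \<le> f' t"
  shows "f T \<le> f S"
proof (cases "T = S")
  case False
  then have "T < S" using assms(1) by simp
  then obtain x where "x \<in> {T<..<S}" "f S - f T = f' x * (S - T)"
    using mvt_simple[of T S f "\<lambda>x h. f' x * h"] assms(2)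
    unfolding has_field_derivative_def by auto
  moreover have "f' x * (S - T) \<ge> 0"
    using assms(3)[of x] \<open>x \<in> _\<close> \<open>T < S\<close> by (intro mult_nonneg_nonneg) auto
  ultimately show ?thesis by linarith
qed simp

lemma linear_lower_bound:
  fixes f :: "real \<Rightarrow> real"
  assumes k: "k > 0" and TS: "T \<le> S"
    and deriv: "\<And>t. T \<le> t \<Longrightarrow> t \<le> S \<Longrightarrow> (f has_real_derivative f' t) (at t within {T..S})"
    and ineq: "\<And>t. T \<le> t \<Longrightarrow> t \<le> S \<Longrightarrow> - k * f t + b \<le> f' t"
  shows "exp (- k * (S - T)) * f T + b / k * (1 - exp (- k * (S - T))) \<le> f S"
proof -
  define g where "g = (\<lambda>t. exp (k * (t - T)) * (f t - b / k))"
  have "g T \<le> g S"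
  proof (rule DERIV_within_nonneg_imp_le[OF TS])
    fix t assume t: "T \<le> t" "t \<le> S"
    show "(g has_real_derivative exp (k * (t - T)) * (k * f t - b + f' t)) (at t within {T..S})"
      unfolding g_def
      by (rule derivative_eq_intros deriv[OF t] refl | simp)+ (use k in \<open>simp add: field_simps\<close>)
    show "0 \<le> exp (k * (t - T)) * (k * f t - b + f' t)" using ineq[OF t] by simp
  qed
  then have "f T - b / k \<le> exp (k * (S - T)) * (f S - b / k)" by (simp add: g_def)
  then have "exp (- k * (S - T)) * (f T - b / k) \<le> exp (- k * (S - T)) * (exp (k * (S - T)) * (f S - b / k))"
    by (intro mult_left_mono) auto
  also have "\<dots> = f S - b / k"
    by (simp add: mult.assoc[symmetric] exp_add[symmetric])
  finally show ?thesis by (simp add: algebra_simps)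
qed

lemma linear_upper_bound:
  fixes f :: "real \<Rightarrow> real"
  assumes k: "k > 0" and TS: "T \<le> S"
    and deriv: "\<And>t. T \<le> t \<Longrightarrow> t \<le> S \<Longrightarrow> (f has_real_derivative f' t) (at t within {T..S})"
    and ineq: "\<And>t. T \<le> t \<Longrightarrow> t \<le> S \<Longrightarrow> f' t \<le> - k * f t + b"
  shows "f S \<le> exp (- k * (S - T)) * f T + b / k * (1 - exp (- k * (S - T)))"
  using linear_lower_bound[OF k TS, of "\<lambda>t. - f t" "\<lambda>t. - f' t" "- b"] deriv ineq
  by (force intro: derivative_intros)

text \<open>A window inside [t - L, t] raises \<open>f\<close> from any nonnegative value to at
  least \<delta> / k * (1 - exp (- k * h)). From its end up to t at most the factor exp (- k * L) is
  lost.\<close>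

lemma recurrent_source_lower_bound:
  fixes f :: "real \<Rightarrow> real"
  assumes k: "k > 0" and d: "\<delta> \<ge> 0" and h: "h > 0" and L: "L > 0"
    and deriv: "\<And>t. T \<le> t \<Longrightarrow> (f has_real_derivative f' t) (at t within {T..})"
    and nonneg: "\<And>t. T \<le> t \<Longrightarrow> 0 \<le> f t"
    and ineq: "\<And>t. T \<le> t \<Longrightarrow> - k * f t + b t \<le> f' t"
    and b: "\<And>t. T \<le> t \<Longrightarrow> 0 \<le> b t"
    and rec: "\<And>t. T \<le> t \<Longrightarrow> \<exists>s\<ge>t. s + h \<le> t + L \<and> (\<forall>r\<in>{s..s+h}. \<delta> \<le> b r)"
    and t: "T + L \<le> t"
  shows "exp (- k * L) * (\<delta> / k * (1 - exp (- k * h))) \<le> f t"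
proof -
  obtain s where s: "t - L \<le> s" "s + h \<le> t" "\<And>r. r \<in> {s..s+h} \<Longrightarrow> \<delta> \<le> b r"
    using rec[of "t - L"] t by auto
  have D: "(f has_real_derivative f' r) (at r within {x..y})" if "T \<le> x" "x \<le> r" for r x y
    by (rule DERIV_subset[OF deriv]) (use that in auto)
  have "exp (- k * (s + h - s)) * f s + \<delta> / k * (1 - exp (- k * (s + h - s))) \<le> f (s + h)"
  proof (rule linear_lower_bound[OF k])
    fix r assume r: "s \<le> r" "r \<le> s + h"
    show "- k * f r + \<delta> \<le> f' r" using ineq[of r] s(3)[of r] r s(1) t by force
  qed (use h D s t in auto)
  moreover have "0 \<le> exp (- k * (s + h - s)) * f s" using nonneg[of s] s t by simp
  ultimately have 1: "\<delta> / k * (1 - exp (- k * h)) \<le> f (s + h)" by simp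
  have "exp (- k * (t - (s + h))) * f (s + h) + 0 / k * (1 - exp (- k * (t - (s + h)))) \<le> f t"
  proof (rule linear_lower_bound[OF k])
    fix r assume r: "s + h \<le> r" "r \<le> t"
    then have "T \<le> r" using s t h by linarith
    then show "- k * f r + 0 \<le> f' r" using ineq[of r] b[of r] by linarith
  qed (use h D s t in auto)
  moreover have "exp (- k * L) * f (s + h) \<le> exp (- k * (t - (s + h))) * f (s + h)"
    using s t h k nonneg[of "s + h"] by (intro mult_right_mono) (auto intro: mult_left_mono)
  moreover have "exp (- k * L) * (\<delta> / k * (1 - exp (- k * h))) \<le> exp (- k * L) * f (s + h)"
    using 1 by (intro mult_left_mono) auto
  ultimately show ?thesis by linarith
qed

text \<open>Over a stretch of length \<open>L\<close> the window contracts \<open>V\<close> by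
  \<rho> = exp (- \<delta> * h), while growth adds at most C * L. So \<open>V\<close> obeys an
  affine recursion at the times T + n L, and its limit bound forgets the initial value.\<close>

lemma recurrent_damping_ultimate_bound:
  fixes V :: "real \<Rightarrow> real"
  assumes d: "\<delta> > 0" and h: "h > 0" and L: "L > 0" and C: "C \<ge> 0"
    and deriv: "\<And>t. T \<le> t \<Longrightarrow> (V has_real_derivative V' t) (at t within {T..})"
    and nonneg: "\<And>t. T \<le> t \<Longrightarrow> 0 \<le> V t"
    and ineq: "\<And>t. T \<le> t \<Longrightarrow> V' t \<le> C"
    and ineq': "\<And>t. T \<le> t \<Longrightarrow> \<delta> \<le> \<gamma> t \<Longrightarrow> V' t \<le> - \<delta> * V t + C"
    and rec: "\<And>t. T \<le> t \<Longrightarrow> \<exists>s\<ge>t. s + h \<le> t + L \<and> (\<forall>r\<in>{s..s+h}. \<delta> \<le> \<gamma> r)"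
  shows "\<exists>T'\<ge>T. \<forall>t\<ge>T'. V t \<le> C * L / (1 - exp (- \<delta> * h)) + C * L + 1"
proof -
  define \<rho> where "\<rho> = exp (- \<delta> * h)"
  have rho: "0 < \<rho>" "\<rho> < 1" using d h by (auto simp: \<rho>_def)
  have D: "(V has_real_derivative V' r) (at r within {x..y})" if "T \<le> x" "x \<le> r" for r x y
    by (rule DERIV_subset[OF deriv]) (use that in auto)
  have grow: "V y \<le> V x + C * (y - x)" if "T \<le> x" "x \<le> y" for x y
  proof -
    have "C * x - V x \<le> C * y - V y"
      by (rule DERIV_within_nonneg_imp_le[where f' = "\<lambda>r. C - V' r"])
        (use that ineq in \<open>auto intro!: derivative_eq_intros D\<close>)
    then show ?thesis by (simp add: algebra_simps)
  qed
  have step: "V (t + L) \<le> \<rho> * V t + C * L" if t: "T \<le> t" for t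
  proof -
    obtain s where s: "t \<le> s" "s + h \<le> t + L" "\<forall>r\<in>{s..s+h}. \<delta> \<le> \<gamma> r" using rec[OF t] by blast
    have "V (s + h) \<le> exp (- \<delta> * (s + h - s)) * V s + C / \<delta> * (1 - exp (- \<delta> * (s + h - s)))"
    proof (rule linear_upper_bound[OF d])
      fix r assume "s \<le> r" "r \<le> s + h"
      then show "V' r \<le> - \<delta> * V r + C" using ineq'[of r] s t by auto
    qed (use h D s t in auto)
    moreover have "1 - exp (- \<delta> * h) \<le> \<delta> * h" using exp_ge_add_one_self[of "- \<delta> * h"] by simp
    then have "C / \<delta> * (1 - exp (- \<delta> * h)) \<le> C / \<delta> * (\<delta> * h)"
      using C d by (intro mult_left_mono) auto
    ultimately have 1: "V (s + h) \<le> \<rho> * V s + C * h" using d by (simp add: \<rho>_def)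
    have "\<rho> * V s \<le> \<rho> * (V t + C * (s - t))" using grow[of t s] rho s t by (intro mult_left_mono) auto
    also have "\<dots> \<le> \<rho> * V t + C * (s - t)"
      using rho C s mult_right_mono[of \<rho> 1 "C * (s - t)"] by (simp add: distrib_left)
    finally have "\<rho> * V s \<le> \<rho> * V t + C * (s - t)" .
    moreover have "V (t + L) \<le> V (s + h) + C * (t + L - (s + h))" using grow[of "s + h" "t + L"] s t h by simp
    ultimately show ?thesis using 1 by (simp add: algebra_simps)
  qed
  \<comment> \<open>The fixed point of the recursion. In the final bound a further C * L covers the
    times between two sampling points, and 1 absorbs the decaying remainder of the initial
    value.\<close>
  define B where "B = C * L / (1 - \<rho>)"
  have B: "\<rho> * B + C * L = B" using rho by (simp add: B_def field_simps)
  have B0: "B \<ge> 0" using C L rho by (simp add: B_def)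
  have it: "V (T + real n * L) \<le> \<rho> ^ n * V T + B" for n
  proof (induction n)
    case 0
    then show ?case using B0 by simp
  next
    case (Suc n)
    have "V (T + real (Suc n) * L) = V (T + real n * L + L)" by (simp add: algebra_simps)
    also have "\<dots> \<le> \<rho> * V (T + real n * L) + C * L" using step L by simp
    also have "\<dots> \<le> \<rho> * (\<rho> ^ n * V T + B) + C * L" using Suc rho by simp
    also have "\<dots> = \<rho> ^ Suc n * V T + B" using B by (simp add: algebra_simps)
    finally show ?case .
  qed
  have "(\<lambda>n. \<rho> ^ n * V T) \<longlonglongrightarrow> 0 * V T" using rho by (intro tendsto_intros LIMSEQ_realpow_zero) auto
  then have "\<forall>\<^sub>F n in sequentially. \<rho> ^ n * V T < 1" by (intro order_tendstoD(2)[of _ "0 * V T"]) auto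
  then obtain N where N: "\<And>n. n \<ge> N \<Longrightarrow> \<rho> ^ n * V T < 1" by (auto simp: eventually_sequentially)
  have "V t \<le> B + C * L + 1" if t: "T + real N * L \<le> t" for t
  proof -
    define n where "n = nat \<lfloor>(t - T) / L\<rfloor>"
    have "real N \<le> (t - T) / L" using t L by (simp add: field_simps)
    then have n: "real n \<le> (t - T) / L" "(t - T) / L < real n + 1" "N \<le> n"
      unfolding n_def by linarith+
    then have n': "T + real n * L \<le> t" "t \<le> T + real n * L + L" using L by (auto simp: field_simps)
    have "V t \<le> V (T + real n * L) + C * (t - (T + real n * L))" using grow n' L by simp
    also have "C * (t - (T + real n * L)) \<le> C * L" using C n' by (intro mult_left_mono) auto
    finally show ?thesis using it[of n] N[OF n(3)] by linarith
  qed
  moreover have "T \<le> T + real N * L" using L by simp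
  ultimately show ?thesis unfolding B_def \<rho>_def by blast
qed

section \<open>Existence and uniqueness of solutions\<close>

lemma integral_has_vector_derivative_atLeast:
  fixes f :: "real \<Rightarrow> 'a::banach"
  assumes f: "continuous_on {0..} f" and t: "0 \<le> t"
  shows "((\<lambda>u. integral {0..u} f) has_vector_derivative f t) (at t within {0..})"
proof -
  have "((\<lambda>u. integral {0..u} f) has_vector_derivative f t) (at t within {0..t+1})"
    by (rule integral_has_vector_derivative) (use t in \<open>auto intro: continuous_on_subset[OF f]\<close>)
  moreover have "at t within {0..t+1} = at t within {0..}"
    by (rule at_within_nhd[where S = "{..<t+1}"]) auto
  ultimately show ?thesis by simp
qed

lemma weighted_integral_bound:
  fixes g :: "real \<Rightarrow> 'a::euclidean_space"
  assumes g: "continuous_on {0..t} g" and t: "0 \<le> t" and \<mu>: "\<mu> > 0" and K: "K \<ge> 0"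
    and le: "\<And>s. 0 \<le> s \<Longrightarrow> s \<le> t \<Longrightarrow> norm (g s) \<le> K * exp (\<mu> * s)"
  shows "exp (- \<mu> * t) * norm (integral {0..t} g) \<le> K / \<mu>"
proof -
  have I: "((\<lambda>s. K * exp (\<mu> * s)) has_integral (K / \<mu> * exp (\<mu> * t) - K / \<mu> * exp (\<mu> * 0))) {0..t}"
    using t \<mu> by (intro fundamental_theorem_of_calculus)
      (auto intro!: derivative_eq_intros simp: has_real_derivative_iff_has_vector_derivative[symmetric])
  have "norm (integral {0..t} g) \<le> integral {0..t} (\<lambda>s. K * exp (\<mu> * s))"
    using le I by (intro integral_norm_bound_integral integrable_continuous_real g)
      (auto intro!: continuous_intros)
  also have "\<dots> = K / \<mu> * exp (\<mu> * t) - K / \<mu>" by (subst integral_unique[OF I]) simp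
  also have "\<dots> \<le> K / \<mu> * exp (\<mu> * t)" using K \<mu> by simp
  finally have "exp (- \<mu> * t) * norm (integral {0..t} g) \<le> exp (- \<mu> * t) * (K / \<mu> * exp (\<mu> * t))"
    by (intro mult_left_mono) auto
  also have "\<dots> = K / \<mu>" by (simp add: exp_minus field_simps)
  finally show ?thesis .
qed

text \<open>The weight \<open>exp (- \<mu> t)\<close> makes the integral operator a contraction on the whole half-line at
  once, so that no continuation argument is needed.\<close>

lemma causal_solution_exists:
  fixes \<Phi> :: "(real \<Rightarrow> 'a::euclidean_space) \<Rightarrow> real \<Rightarrow> 'a"
  assumes C: "C \<ge> 0"
    and cont: "\<And>y. continuous_on UNIV y \<Longrightarrow> continuous_on {0..} (\<Phi> y)"
    and lip: "\<And>y z s B. continuous_on UNIV y \<Longrightarrow> continuous_on UNIV z \<Longrightarrow> 0 \<le> s \<Longrightarrow>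
                (\<And>r. 0 \<le> r \<Longrightarrow> r \<le> s \<Longrightarrow> norm (y r - z r) \<le> B) \<Longrightarrow> norm (\<Phi> y s - \<Phi> z s) \<le> C * B"
    and bnd: "\<And>s. 0 \<le> s \<Longrightarrow> norm (\<Phi> (\<lambda>_. y0) s) \<le> M"
  shows "\<exists>y. continuous_on UNIV y \<and> y 0 = y0 \<and>
           (\<forall>t\<ge>0. (y has_vector_derivative \<Phi> y t) (at t within {0..}))"
proof -
  \<comment> \<open>A weight larger than \<open>C\<close> gives the contraction factor C / \<mu> <
    1; this one is positive also for C = 0.\<close>
  define \<mu> where "\<mu> = 2 * C + 1"
  have mu: "\<mu> > 0" using C by (simp add: \<mu>_def)
  have M: "M \<ge> 0" using bnd[of 0] norm_ge_zero order_trans by blast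
  \<comment> \<open>The unknown is the weighted deviation \<open>u\<close> from y0, a bounded
    continuous function. The use of max 0 extends the weight to the whole line, and u = 0 stands for
    the constant y0.\<close>
  define Y where "Y = (\<lambda>(u :: real \<Rightarrow>\<^sub>C 'a) s. y0 + exp (\<mu> * max 0 s) *\<^sub>R u s)"
  have Yc: "continuous_on UNIV (Y u)" for u unfolding Y_def by (intro continuous_intros) auto
  have Yd: "norm (\<Phi> (Y u) s - \<Phi> (Y v) s) \<le> (C * dist u v) * exp (\<mu> * s)" if s: "0 \<le> s" for u v s
  proof -
    have "norm (\<Phi> (Y u) s - \<Phi> (Y v) s) \<le> C * (dist u v * exp (\<mu> * s))"
    proof (rule lip[OF Yc Yc s])
      fix r assume r: "0 \<le> r" "r \<le> s"
      have "Y u r - Y v r = exp (\<mu> * r) *\<^sub>R (u r - v r)"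
        using r by (simp add: Y_def scaleR_diff_right)
      then have "norm (Y u r - Y v r) = dist (u r) (v r) * exp (\<mu> * r)"
        by (simp add: dist_norm)
      also have "\<dots> \<le> dist u v * exp (\<mu> * s)"
        using r mu by (intro mult_mono dist_bounded) auto
      finally show "norm (Y u r - Y v r) \<le> dist u v * exp (\<mu> * s)" .
    qed
    then show ?thesis by (simp add: ac_simps)
  qed
  have Y0: "Y 0 = (\<lambda>_. y0)" by (auto simp: Y_def)
  define J where "J = (\<lambda>u t. integral {0..t} (\<Phi> (Y u)))"
  have Jd: "(J u has_vector_derivative \<Phi> (Y u) t) (at t within {0..})" if "0 \<le> t" for u t
    unfolding J_def by (rule integral_has_vector_derivative_atLeast[OF cont[OF Yc] that])
  have Jc: "continuous_on {0..} (J u)" for u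
    unfolding continuous_on_eq_continuous_within
    using Jd has_vector_derivative_continuous by (metis atLeast_iff)
  define g where "g = (\<lambda>u t. exp (- \<mu> * max 0 t) *\<^sub>R J u (max 0 t))"
  have gc: "continuous_on UNIV (g u)" for u
    unfolding g_def by (intro continuous_intros continuous_on_compose2[OF Jc]) auto
  have gb: "norm (g u t) \<le> (M + C * norm u) / \<mu>" for u t
  proof -
    have "exp (- \<mu> * max 0 t) * norm (integral {0..max 0 t} (\<Phi> (Y u))) \<le> (M + C * norm u) / \<mu>"
    proof (rule weighted_integral_bound[OF _ _ mu])
      fix s assume s: "0 \<le> s" "s \<le> max 0 t"
      have "norm (\<Phi> (Y u) s) \<le> norm (\<Phi> (Y u) s - \<Phi> (Y 0) s) + norm (\<Phi> (Y 0) s)"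
        using norm_triangle_ineq[of "\<Phi> (Y u) s - \<Phi> (Y 0) s" "\<Phi> (Y 0) s"] by simp
      also have "\<dots> \<le> C * norm u * exp (\<mu> * s) + M"
        using Yd[OF s(1), of u 0] bnd[OF s(1)] by (simp add: Y0)
      also have "M \<le> M * exp (\<mu> * s)" using M s mu by (simp add: mult_le_cancel_left1)
      finally show "norm (\<Phi> (Y u) s) \<le> (M + C * norm u) * exp (\<mu> * s)" by (simp add: algebra_simps)
    qed (use M C in \<open>auto intro: continuous_on_subset[OF cont[OF Yc]]\<close>)
    then show ?thesis by (simp add: g_def J_def)
  qed
  define G where "G = (\<lambda>u. Bcontfun (g u))"
  have G: "apply_bcontfun (G u) = g u" for u
    unfolding G_def by (rule Bcontfun_inverse, rule bcontfun_normI, rule gc, rule gb)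
  have "\<exists>!u. G u = u"
  proof (rule banach_fix_type[of "C / \<mu>"])
    show "0 \<le> C / \<mu>" "C / \<mu> < 1" using C mu by (auto simp: \<mu>_def field_simps)
    show "\<forall>u v. dist (G u) (G v) \<le> C / \<mu> * dist u v"
    proof (intro allI dist_bound)
      fix u v t
      have int: "\<Phi> (Y w) integrable_on {0..max 0 t}" for w
        by (intro integrable_continuous_real continuous_on_subset[OF cont[OF Yc]]) auto
      have "exp (- \<mu> * max 0 t) * norm (integral {0..max 0 t} (\<lambda>s. \<Phi> (Y u) s - \<Phi> (Y v) s)) \<le> C * dist u v / \<mu>"
        by (rule weighted_integral_bound[OF _ _ mu])
          (use C Yd in \<open>auto intro!: continuous_on_diff continuous_on_subset[OF cont[OF Yc]]\<close>)
      moreover have "integral {0..max 0 t} (\<lambda>s. \<Phi> (Y u) s - \<Phi> (Y v) s) = J u (max 0 t) - J v (max 0 t)"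
        unfolding J_def by (rule integral_diff[OF int int])
      ultimately show "dist (G u t) (G v t) \<le> C / \<mu> * dist u v"
        unfolding G by (simp add: g_def dist_norm scaleR_diff_right[symmetric])
    qed
  qed
  then obtain u where "G u = u" by blast
  then have u: "apply_bcontfun u = g u" using G[of u] by simp
  have Yu: "Y u t = y0 + J u t" if "t \<in> {0..}" for t
    using that by (simp add: Y_def u g_def mult_exp_exp)
  have "(Y u has_vector_derivative \<Phi> (Y u) t) (at t within {0..})" if t: "0 \<le> t" for t
  proof (rule has_vector_derivative_transform[OF _ Yu])
    show "((\<lambda>t. y0 + J u t) has_vector_derivative \<Phi> (Y u) t) (at t within {0..})"
      using has_vector_derivative_add[OF has_vector_derivative_const Jd[OF t]] by simp
  qed (use t in auto)
  moreover have "Y u 0 = y0" using Yu[of 0] by (simp add: J_def)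
  ultimately show ?thesis using Yc by blast
qed

section \<open>Estimates for the nonlinear birth term\<close>

lemma mult_exp_le_inverse:
  fixes x c :: real
  assumes "c > 0"
  shows "x * exp (- c * x) \<le> 1 / c"
proof -
  have "c * x \<le> exp (c * x)" using exp_ge_add_one_self[of "c * x"] by linarith
  then have "c * x * exp (- c * x) \<le> exp (c * x) * exp (- c * x)" by (intro mult_right_mono) auto
  then show ?thesis using assms by (simp add: mult_exp_exp field_simps)
qed

text \<open>On x \<ge> 0 the derivative (1 - c x) exp (- c x) is at most 1 in absolute value. The
  inner absolute values extend the estimate to arguments of either sign, since existence is proved
  before nonnegativity.\<close>

lemma ricker_lipschitz:
  fixes x z c :: real
  assumes c: "c > 0"
  shows "\<bar>\<bar>x\<bar> * exp (- c * \<bar>x\<bar>) - \<bar>z\<bar> * exp (- c * \<bar>z\<bar>)\<bar> \<le> \<bar>x - z\<bar>"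
proof -
  have main: "\<bar>p * exp (- c * p) - q * exp (- c * q)\<bar> \<le> q - p" if pq: "0 \<le> p" "p \<le> q" for p q
  proof -
    have "q * exp (- c * q) - p * exp (- c * p) \<le> q * exp (- c * p) - p * exp (- c * p)"
      using c pq by (simp add: mult_left_mono)
    also have "\<dots> = (q - p) * exp (- c * p)" by (simp add: algebra_simps)
    also have "\<dots> \<le> q - p" using pq c mult_left_mono[of "exp (- c * p)" 1 "q - p"] by simp
    finally have 1: "q * exp (- c * q) - p * exp (- c * p) \<le> q - p" .
    have "p * exp (- c * p) - q * exp (- c * q) \<le> p * exp (- c * p) - p * exp (- c * q)"
      using pq by (simp add: mult_right_mono)
    also have "\<dots> = p * exp (- c * p) * (1 - exp (- c * (q - p)))"
      by (simp add: algebra_simps mult_exp_exp)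
    also have "\<dots> \<le> p * exp (- c * p) * (c * (q - p))"
      using pq exp_ge_add_one_self[of "- c * (q - p)"] by (intro mult_left_mono) auto
    also have "\<dots> \<le> 1 / c * (c * (q - p))"
      using mult_exp_le_inverse[OF c, of p] pq c by (intro mult_right_mono) auto
    also have "\<dots> = q - p" using c by simp
    finally show ?thesis using 1 by linarith
  qed
  show ?thesis
  proof (cases "\<bar>x\<bar> \<le> \<bar>z\<bar>")
    case True
    have "\<bar>z\<bar> - \<bar>x\<bar> \<le> \<bar>x - z\<bar>" by simp
    with main[of "\<bar>x\<bar>" "\<bar>z\<bar>"] True show ?thesis by (meson abs_ge_zero order_trans)
  next
    case False
    have "\<bar>x\<bar> - \<bar>z\<bar> \<le> \<bar>x - z\<bar>" by simp
    with main[of "\<bar>z\<bar>" "\<bar>x\<bar>"] False show ?thesis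
      by (subst abs_minus_commute) (meson abs_ge_zero nle_le order_trans)
  qed
qed

section \<open>One fixed system: nonnegativity, uniqueness, existence\<close>

locale nicholson_system =
  fixes \<tau> :: "'n::finite \<Rightarrow> real" and d \<beta> c :: "'n \<Rightarrow> real \<Rightarrow> real"
    and a :: "'n \<Rightarrow> 'n \<Rightarrow> real \<Rightarrow> real" and C c0 :: real
  assumes tau: "\<tau> i > 0" and c0: "c0 > 0"
    and cont: "continuous_on {0..} (d i)" "continuous_on {0..} (a i j)"
      "continuous_on {0..} (\<beta> i)" "continuous_on {0..} (c i)"
    and bounds: "0 \<le> t \<Longrightarrow> 0 \<le> d i t \<and> d i t \<le> C" "0 \<le> t \<Longrightarrow> 0 \<le> a i j t \<and> a i j t \<le> C"
      "0 \<le> t \<Longrightarrow> 0 \<le> \<beta> i t \<and> \<beta> i t \<le> C" "0 \<le> t \<Longrightarrow> c0 \<le> c i t \<and> c i t \<le> C"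
begin

lemma C_pos: "C > 0"
  using c0 bounds(4)[of 0 undefined] by simp

abbreviation is_solution :: "'n history \<Rightarrow> ('n \<Rightarrow> real \<Rightarrow> real) \<Rightarrow> bool" where
  "is_solution \<equiv> nicholson_solution \<tau> d a \<beta> c"

definition rhs :: "('n \<Rightarrow> real \<Rightarrow> real) \<Rightarrow> 'n \<Rightarrow> real \<Rightarrow> real" where
  "rhs y i t = - d i t * y i t + (\<Sum>j\<in>UNIV. a i j t * y j t)
            + \<beta> i t * y i (t - \<tau> i) * exp (- c i t * y i (t - \<tau> i))"

text \<open>The birth term is nonnegative once the delayed values are, and dropping it leaves a
  cooperative linear inequality. The derivative is arbitrary because the existence proof applies
  this to a modified right-hand side.\<close>

lemma nonneg_of_linear_lower:
  assumes deriv: "\<And>i t. t \<ge> 0 \<Longrightarrow> (y i has_real_derivative y' i t) (at t within {0..})"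
    and ineq: "\<And>i t. t \<ge> 0 \<Longrightarrow> (\<And>j. 0 \<le> y j (t - \<tau> j)) \<Longrightarrow>
       - d i t * y i t + (\<Sum>j\<in>UNIV. a i j t * y j t) \<le> y' i t"
    and init: "\<And>i t. - \<tau> i \<le> t \<Longrightarrow> t \<le> 0 \<Longrightarrow> 0 \<le> y i t"
    and t: "- \<tau> i \<le> t"
  shows "0 \<le> y i t"
proof (cases "t \<le> 0")
  case False
  show ?thesis
  proof (rule delay_cooperative_nonneg[where I = UNIV and T = 0 and \<tau> = \<tau> and v = y and v' = y' and D = d
          and A = a and C = C])
    show "\<bar>d i t\<bar> \<le> C" if "0 \<le> t" for i t using bounds(1)[OF that, of i] by auto
  qed (use False tau C_pos deriv ineq init bounds(2) in auto)
qed (use init t in auto)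

lemma is_solution_deriv:
  assumes "is_solution \<phi> y" "t \<ge> 0"
  shows "(y i has_real_derivative rhs y i t) (at t within {0..})"
  using assms by (simp add: nicholson_solution_def rhs_def)

lemma is_solution_nonneg:
  assumes y: "is_solution \<phi> y" and \<phi>: "\<phi> \<in> phase_cone \<tau>" and t: "- \<tau> i \<le> t"
  shows "0 \<le> y i t"
proof (rule nonneg_of_linear_lower[OF is_solution_deriv[OF y] _ _ t])
  show "- d i t * y i t + (\<Sum>j\<in>UNIV. a i j t * y j t) \<le> rhs y i t"
    if "t \<ge> 0" "\<And>j. 0 \<le> y j (t - \<tau> j)" for i t
    using that bounds(3)[OF that(1), of i] by (simp add: rhs_def)
  show "0 \<le> y i t" if "- \<tau> i \<le> t" "t \<le> 0" for i t
    using y \<phi> that unfolding nicholson_solution_def phase_cone_def by auto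
qed

lemma is_solution_unique:
  assumes y: "is_solution \<phi> y" and z: "is_solution \<phi> z"
  shows "y = z"
proof -
  \<comment> \<open>Comparison for \<open>y - z\<close> and \<open>z - y\<close> simultaneously: if both are nonnegative at the delayed times, the
    delayed terms cancel and the system for the differences is cooperative.\<close>
  define v where "v = (\<lambda>(i, b) t. if b then y i t - z i t else z i t - y i t)"
  define v' where "v' = (\<lambda>(i, b) t. if b then rhs y i t - rhs z i t else rhs z i t - rhs y i t)"
  define A where "A = (\<lambda>(i, b) (j, b') t. if b = (b' :: bool) then a i j t else 0)"
  have nn: "0 \<le> v k t" if t: "0 \<le> t" for k t
  proof (rule delay_cooperative_nonneg[where I = UNIV and T = 0 and v' = v' and v = v and C = C and A = A
        and D = "\<lambda>(i, b). d i" and \<tau> = "\<lambda>(i, b). \<tau> i"])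
    fix k :: "'n \<times> bool" and t :: real assume t: "0 \<le> t"
    obtain i b where k: "k = (i, b)" by (cases k)
    show "(v k has_real_derivative v' k t) (at t within {0..})"
      using t unfolding k v_def v'_def by (cases b) (auto intro!: derivative_intros is_solution_deriv[OF y] is_solution_deriv[OF z])
    show "\<bar>(case k of (i, b) \<Rightarrow> d i) t\<bar> \<le> C" using bounds(1)[OF t, of i] by (auto simp: k)
    show "0 \<le> A k l t \<and> A k l t \<le> C" for l using bounds(2)[OF t] C_pos by (auto simp: A_def k split: prod.split)
    assume "\<And>j. j \<in> UNIV \<Longrightarrow> 0 \<le> v j (t - (case j of (i, b) \<Rightarrow> \<tau> i))"
    from this[of "(i, True)"] this[of "(i, False)"]
    have e: "y i (t - \<tau> i) = z i (t - \<tau> i)" by (simp add: v_def)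
    have "(\<Sum>l\<in>UNIV. A k l t * v l t) = (\<Sum>j\<in>UNIV. \<Sum>b'\<in>UNIV. A k (j, b') t * v (j, b') t)"
      by (simp add: sum.cartesian_product)
    also have "\<dots> = (\<Sum>j\<in>UNIV. a i j t * v (j, b) t)"
      by (cases b) (auto simp: A_def k UNIV_bool)
    finally show "- (case k of (i, b) \<Rightarrow> d i) t * v k t + (\<Sum>l\<in>UNIV. A k l t * v l t) \<le> v' k t"
      by (cases b) (simp_all add: k v_def v'_def rhs_def e algebra_simps sum_subtractf)
  next
    fix k :: "'n \<times> bool" and t :: real
    assume "0 - (case k of (i, b) \<Rightarrow> \<tau> i) \<le> t" "t \<le> 0"
    then show "0 \<le> v k t" using y z by (auto simp: v_def nicholson_solution_def split: prod.splits)
  qed (use tau C_pos t in auto)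
  have "y i t = z i t" for i t
  proof -
    consider "t < - \<tau> i" | "- \<tau> i \<le> t" "t \<le> 0" | "0 < t" by linarith
    then show ?thesis
    proof cases
      case 1
      \<comment> \<open>To the left of its domain each solution has the default value of an
        extensional function.\<close>
      then show ?thesis using y z unfolding nicholson_solution_def
        by (metis atLeast_iff extensional_arb not_le)
    next
      case 2
      then show ?thesis using y z unfolding nicholson_solution_def by auto
    next
      case 3
      then show ?thesis using nn[of t "(i, True)"] nn[of t "(i, False)"] by (simp add: v_def)
    qed
  qed
  then show ?thesis by blast
qed

text \<open>Absolute values in the birth term \<open>R\<close> make the right-hand side globally
  Lipschitz, so the fixed point theorem applies. The function obtained is then shown to be
  nonnegative, and the absolute values disappear.\<close>

lemma is_solution_exists:
  assumes \<phi>: "\<phi> \<in> phase_cone \<tau>"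
  shows "\<exists>y. is_solution \<phi> y"
proof -
  define R where "R = (\<lambda>c x :: real. \<bar>x\<bar> * exp (- c * \<bar>x\<bar>))"
  \<comment> \<open>The delayed value without a case distinction: given y 0 = \<phi>(0), the last
    two terms cancel while t \<le> \<tau> i, and the first and the last cancel afterwards.
    Continuity in t is then immediate.\<close>
  define H where "H = (\<lambda>(y :: real \<Rightarrow> real^'n) i t. \<phi> i (min (t - \<tau> i) 0) + (y (max (t - \<tau> i) 0) $ i - \<phi> i 0))"
  define F where "F = (\<lambda>(y :: real \<Rightarrow> real^'n) i t. - d i t * y t $ i + (\<Sum>j\<in>UNIV. a i j t * y t $ j)
      + \<beta> i t * R (c i t) (H y i t))"
  define \<Phi> where "\<Phi> = (\<lambda>y t. \<chi> i. F y i t)"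
  \<comment> \<open>Lipschitz constant of one component: \<open>C\<close> each for decay, birth and
    every coupling.\<close>
  define K where "K = 2 * C + real CARD('n) * C"
  have \<phi>c: "continuous_on {- \<tau> i..0} (\<phi> i)" for i using \<phi> by (auto simp: phase_cone_def phase_space_def)
  have Hc: "continuous_on {0..} (H y i)" if "continuous_on UNIV y" for y i
    unfolding H_def
    by (intro continuous_intros continuous_on_compose2[OF \<phi>c] continuous_on_compose2[OF that])
      (use tau[of i] in auto)
  have "\<exists>y. continuous_on UNIV y \<and> y 0 = at_zero \<phi> \<and>
           (\<forall>t\<ge>0. (y has_vector_derivative \<Phi> y t) (at t within {0..}))"
  proof (rule causal_solution_exists[where C = "real CARD('n) * K"])
    show "0 \<le> real CARD('n) * K" using C_pos by (simp add: K_def)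
    show "continuous_on {0..} (\<Phi> y)" if "continuous_on UNIV y" for y
      unfolding \<Phi>_def F_def R_def
      by (intro continuous_intros cont Hc that continuous_on_subset[OF that]) auto
  next
    fix y z :: "real \<Rightarrow> real^'n" and s B :: real
    assume yz: "continuous_on UNIV y" "continuous_on UNIV z" and s: "0 \<le> s"
      and le: "\<And>r. 0 \<le> r \<Longrightarrow> r \<le> s \<Longrightarrow> norm (y r - z r) \<le> B"
    have comp: "\<bar>y r $ i - z r $ i\<bar> \<le> B" if "0 \<le> r" "r \<le> s" for r i
      using component_le_norm_cart[of "y r - z r" i] le[OF that] by simp
    have "\<bar>F y i s - F z i s\<bar> \<le> K * B" for i
    proof -
      have "\<bar>H y i s - H z i s\<bar> \<le> B"
        using comp[of "max (s - \<tau> i) 0" i] tau[of i] s by (auto simp: H_def)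
      moreover have "\<bar>R (c i s) (H y i s) - R (c i s) (H z i s)\<bar> \<le> \<bar>H y i s - H z i s\<bar>"
        unfolding R_def by (rule ricker_lipschitz) (use bounds(4)[OF s, of i] c0 in auto)
      ultimately have 1: "\<bar>\<beta> i s * R (c i s) (H y i s) - \<beta> i s * R (c i s) (H z i s)\<bar> \<le> C * B"
        unfolding right_diff_distrib[symmetric] abs_mult
        using bounds(3)[OF s, of i] by (intro mult_mono) auto
      have 2: "\<bar>d i s * y s $ i - d i s * z s $ i\<bar> \<le> C * B"
        unfolding right_diff_distrib[symmetric] abs_mult
        using bounds(1)[OF s, of i] comp[OF s order.refl, of i] by (intro mult_mono) auto
      have "\<bar>\<Sum>j\<in>UNIV. a i j s * y s $ j - a i j s * z s $ j\<bar> \<le> (\<Sum>j\<in>(UNIV::'n set). C * B)"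
      proof (rule order_trans[OF sum_abs sum_mono])
        fix j
        show "\<bar>a i j s * y s $ j - a i j s * z s $ j\<bar> \<le> C * B"
          unfolding right_diff_distrib[symmetric] abs_mult
          using bounds(2)[OF s, of i j] comp[OF s order.refl, of j] by (intro mult_mono) auto
      qed
      then have 3: "\<bar>(\<Sum>j\<in>UNIV. a i j s * y s $ j) - (\<Sum>j\<in>UNIV. a i j s * z s $ j)\<bar> \<le> real CARD('n) * (C * B)"
        by (simp add: sum_subtractf)
      have "K * B = C * B + real CARD('n) * (C * B) + C * B" by (simp add: K_def algebra_simps)
      then show ?thesis using 1 2 3 unfolding F_def by linarith
    qed
    then have "(\<Sum>i\<in>UNIV. \<bar>F y i s - F z i s\<bar>) \<le> (\<Sum>i\<in>(UNIV::'n set). K * B)" by (intro sum_mono) auto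
    then show "norm (\<Phi> y s - \<Phi> z s) \<le> real CARD('n) * K * B"
      using norm_le_l1_cart[of "\<Phi> y s - \<Phi> z s"] by (simp add: \<Phi>_def)
  next
    fix s :: real assume s: "0 \<le> s"
    define y :: "real \<Rightarrow> real^'n" where "y = (\<lambda>_. at_zero \<phi>)"
    have "\<bar>F y i s\<bar> \<le> C * norm (at_zero \<phi>) + real CARD('n) * (C * norm (at_zero \<phi>)) + C * (1 / c0)" for i
    proof -
      have n: "\<bar>y s $ j\<bar> \<le> norm (at_zero \<phi>)" for j using component_le_norm_cart by (auto simp: y_def)
      have ci: "c i s > 0" "c0 \<le> c i s" using bounds(4)[OF s, of i] c0 by auto
      have "R (c i s) (H y i s) \<le> 1 / c i s" unfolding R_def by (rule mult_exp_le_inverse[OF ci(1)])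
      also have "\<dots> \<le> 1 / c0" using ci c0 by (simp add: frac_le)
      finally have "R (c i s) (H y i s) \<le> 1 / c0" .
      then have 1: "\<bar>\<beta> i s * R (c i s) (H y i s)\<bar> \<le> C * (1 / c0)"
        unfolding abs_mult using bounds(3)[OF s, of i] by (intro mult_mono) (auto simp: R_def)
      have 2: "\<bar>d i s * y s $ i\<bar> \<le> C * norm (at_zero \<phi>)"
        unfolding abs_mult using bounds(1)[OF s, of i] n by (intro mult_mono) auto
      have "\<bar>\<Sum>j\<in>UNIV. a i j s * y s $ j\<bar> \<le> (\<Sum>j\<in>(UNIV::'n set). C * norm (at_zero \<phi>))"
      proof (rule order_trans[OF sum_abs sum_mono])
        fix j
        show "\<bar>a i j s * y s $ j\<bar> \<le> C * norm (at_zero \<phi>)"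
          unfolding abs_mult using bounds(2)[OF s, of i j] n by (intro mult_mono) auto
      qed
      then have 3: "\<bar>\<Sum>j\<in>UNIV. a i j s * y s $ j\<bar> \<le> real CARD('n) * (C * norm (at_zero \<phi>))" by simp
      show ?thesis using 1 2 3 unfolding F_def by linarith
    qed
    then have "(\<Sum>i\<in>UNIV. \<bar>F y i s\<bar>) \<le>
        (\<Sum>i\<in>(UNIV::'n set). C * norm (at_zero \<phi>) + real CARD('n) * (C * norm (at_zero \<phi>)) + C * (1 / c0))"
      by (intro sum_mono) auto
    then show "norm (\<Phi> (\<lambda>_. at_zero \<phi>) s) \<le>
        (\<Sum>i\<in>(UNIV::'n set). C * norm (at_zero \<phi>) + real CARD('n) * (C * norm (at_zero \<phi>)) + C * (1 / c0))"
      using norm_le_l1_cart[of "\<Phi> y s"] by (simp add: \<Phi>_def y_def)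
  qed
  then obtain y where y: "continuous_on UNIV y" "y 0 = at_zero \<phi>"
    and dy: "\<And>t. t \<ge> 0 \<Longrightarrow> (y has_vector_derivative \<Phi> y t) (at t within {0..})" by blast
  define z where "z = (\<lambda>i. restrict (\<lambda>t. if t \<le> 0 then \<phi> i t else y t $ i) {- \<tau> i..})"
  have z0: "z i t = y t $ i" if "0 \<le> t" for i t
    using that tau[of i] y(2) by (auto simp: z_def at_zero_def)
  have zH: "z i (t - \<tau> i) = H y i t" if "0 \<le> t" for i t
    using that tau[of i] y(2) by (auto simp: z_def H_def at_zero_def min_def max_def)
  have dz: "(z i has_real_derivative F y i t) (at t within {0..})" if t: "t \<ge> 0" for i t
  proof -
    have "((\<lambda>t. y t $ i) has_vector_derivative \<Phi> y t $ i) (at t within {0..})"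
      by (rule bounded_linear.has_vector_derivative[OF bounded_linear_vec_nth dy[OF t]])
    then have "((\<lambda>t. y t $ i) has_vector_derivative F y i t) (at t within {0..})" by (simp add: \<Phi>_def)
    then have "(z i has_vector_derivative F y i t) (at t within {0..})"
      by (rule has_vector_derivative_transform[rotated -1]) (use t z0 in auto)
    then show ?thesis by (simp add: has_real_derivative_iff_has_vector_derivative)
  qed
  have znn: "0 \<le> z i t" if "- \<tau> i \<le> t" for i t
  proof (rule nonneg_of_linear_lower[OF dz _ _ that])
    show "- d i t * z i t + (\<Sum>j\<in>UNIV. a i j t * z j t) \<le> F y i t" if "t \<ge> 0" for i t
      using bounds(3)[OF that, of i] by (simp add: F_def z0[OF that] R_def)
    show "0 \<le> z i t" if "- \<tau> i \<le> t" "t \<le> 0" for i t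
      using \<phi> that by (auto simp: z_def phase_cone_def)
  qed
  have "F y i t = rhs z i t" if t: "t \<ge> 0" for i t
    using znn[of i "t - \<tau> i"] t unfolding F_def rhs_def z0[OF t] zH[OF t] R_def by simp
  then have "is_solution \<phi> z"
    unfolding nicholson_solution_def using dz unfolding rhs_def[symmetric]
    by (auto simp: z_def)
  then show ?thesis by blast
qed

abbreviation sol :: "'n history \<Rightarrow> 'n \<Rightarrow> real \<Rightarrow> real" where
  "sol \<equiv> nicholson_sol \<tau> d a \<beta> c"

lemma is_solution_iff:
  assumes "\<phi> \<in> phase_cone \<tau>"
  shows "is_solution \<phi> y \<longleftrightarrow> y = sol \<phi>"
proof -
  obtain z where z: "is_solution \<phi> z" using is_solution_exists[OF assms] by blast
  then have "sol \<phi> = z"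
    unfolding nicholson_sol_def using is_solution_unique by (blast intro: the_equality)
  then show ?thesis using z is_solution_unique by blast
qed

end

section \<open>The family over the hull\<close>

abbreviation dC :: "('n::finite) coeffs \<Rightarrow> 'n \<Rightarrow> real" where "dC z i \<equiv> fst z $ i"
abbreviation aC :: "('n::finite) coeffs \<Rightarrow> 'n \<Rightarrow> 'n \<Rightarrow> real" where "aC z i j \<equiv> fst (snd z) $ i $ j"
abbreviation bC :: "('n::finite) coeffs \<Rightarrow> 'n \<Rightarrow> real" where "bC z i \<equiv> fst (snd (snd z)) $ i"
abbreviation cC :: "('n::finite) coeffs \<Rightarrow> 'n \<Rightarrow> real" where "cC z i \<equiv> snd (snd (snd z)) $ i"

lemma coeff_dist_le:
  fixes z z' :: "('n::finite) coeffs"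
  shows "\<bar>dC z i - dC z' i\<bar> \<le> dist z z'" "\<bar>aC z i j - aC z' i j\<bar> \<le> dist z z'"
    "\<bar>bC z i - bC z' i\<bar> \<le> dist z z'" "\<bar>cC z i - cC z' i\<bar> \<le> dist z z'"
proof -
  have 1: "dist (fst z) (fst z') \<le> dist z z'" "dist (snd z) (snd z') \<le> dist z z'"
    by (rule dist_fst_le dist_snd_le)+
  have 2: "dist (fst (snd z)) (fst (snd z')) \<le> dist (snd z) (snd z')"
    "dist (snd (snd z)) (snd (snd z')) \<le> dist (snd z) (snd z')" by (rule dist_fst_le dist_snd_le)+
  have 3: "dist (fst (snd (snd z))) (fst (snd (snd z'))) \<le> dist (snd (snd z)) (snd (snd z'))"
    "dist (snd (snd (snd z))) (snd (snd (snd z'))) \<le> dist (snd (snd z)) (snd (snd z'))"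
    by (rule dist_fst_le dist_snd_le)+
  have 4: "\<bar>x $ i - y $ i\<bar> \<le> dist x y" for x y :: "real^'n"
    using dist_vec_nth_le[of x i y] by (simp add: dist_real_def)
  have 5: "dist (fst (snd z) $ i) (fst (snd z') $ i) \<le> dist (fst (snd z)) (fst (snd z'))"
    by (rule dist_vec_nth_le)
  show "\<bar>dC z i - dC z' i\<bar> \<le> dist z z'" using 4 1 order_trans by blast
  show "\<bar>aC z i j - aC z' i j\<bar> \<le> dist z z'"
    using dist_vec_nth_le[of "fst (snd z) $ i" j "fst (snd z') $ i"] 5 1 2 by (simp add: dist_real_def)
  show "\<bar>bC z i - bC z' i\<bar> \<le> dist z z'"
    using 4[of "fst (snd (snd z))" "fst (snd (snd z'))"] 1 2 3 by linarith
  show "\<bar>cC z i - cC z' i\<bar> \<le> dist z z'"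
    using 4[of "snd (snd (snd z))" "snd (snd (snd z'))"] 1 2 3 by linarith
qed

text \<open>Translates far to the right approximate \<omega>, so even at negative times \<omega>
  takes limits of values of \<open>p\<close> on the half-line. This carries hypotheses for t \<ge> 0
  to the whole line and the whole hull.\<close>

lemma hull_mem_closure:
  fixes p :: "real \<Rightarrow> 'a::metric_space"
  assumes p: "continuous_on UNIV p" and ap: "has_almost_periods p" and w: "\<omega> \<in> translation_hull p"
  shows "\<omega> t \<in> closure (p ` {0..})"
  unfolding closure_approachable
proof (intro allI impI)
  fix e :: real assume "e > 0"
  then obtain s where "s \<ge> - t" "\<forall>t. dist (p (s + t)) (\<omega> t) < e"
    using hull_uniform_approx[OF p ap w] by blast
  then show "\<exists>y\<in>p ` {0..}. dist y (\<omega> t) < e" by (intro bexI[of _ "p (s + t)"]) auto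
qed

text \<open>Turns a strict inequality that holds at the single time t0 into recurring windows, with
  \<open>h\<close> and \<open>L\<close> common to the family.\<close>

lemma hull_recurrence_open:
  fixes p :: "real \<Rightarrow> 'a::metric_space"
  assumes p: "continuous_on UNIV p" and ap: "has_almost_periods p" and U: "open U" "p t0 \<in> U"
  obtains h L where "h > 0" "L > 0"
    "\<And>\<omega> t. \<omega> \<in> translation_hull p \<Longrightarrow> \<exists>s\<ge>t. s + h \<le> t + L \<and> (\<forall>r\<in>{s..s+h}. \<omega> r \<in> U)"
proof -
  obtain \<zeta> where z: "\<zeta> > 0" "\<And>x. dist x (p t0) < \<zeta> \<Longrightarrow> x \<in> U" using U unfolding open_dist by blast
  obtain h L where "h > 0" "L > 0" and *: "\<And>\<omega> t. \<omega> \<in> translation_hull p \<Longrightarrow>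
      \<exists>s\<ge>t. s + h \<le> t + L \<and> (\<forall>r\<in>{s..s+h}. dist (\<omega> r) (p t0) < \<zeta>)"
    using hull_recurrence[OF p ap z(1), of t0] by blast
  moreover have "\<exists>s\<ge>t. s + h \<le> t + L \<and> (\<forall>r\<in>{s..s+h}. \<omega> r \<in> U)" if "\<omega> \<in> translation_hull p" for \<omega> t
    using *[OF that, of t] z(2) by blast
  ultimately show ?thesis using that by blast
qed

lemma self_in_hull:
  fixes p :: "real \<Rightarrow> 'a::metric_space"
  assumes "continuous_on UNIV p"
  shows "p \<in> translation_hull p"
  unfolding mem_translation_hull_iff[OF assms] using assms by (auto intro!: exI[of _ 0])

lemma translate_in_hull:
  fixes p :: "real \<Rightarrow> 'a::metric_space"
  assumes "continuous_on UNIV p"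
  shows "p \<cdot>\<^sub>t T \<in> translation_hull p"
  unfolding mem_translation_hull_iff[OF assms]
proof (intro conjI allI impI)
  show "continuous_on UNIV (p \<cdot>\<^sub>t T)" unfolding translate_def
    by (rule continuous_on_compose2[OF assms]) (auto intro!: continuous_intros)
qed (auto simp: translate_def intro!: exI[of _ T])

lemma family_sol_eq:
  "family_sol \<tau> \<omega> = nicholson_sol \<tau> (\<lambda>i t. dC (\<omega> t) i) (\<lambda>i j t. aC (\<omega> t) i j) (\<lambda>i t. bC (\<omega> t) i)
     (\<lambda>i t. cC (\<omega> t) i)"
  by (simp add: family_sol_def translate_def d_hull_def a_hull_def beta_hull_def c_hull_def case_prod_beta)

definition vector_field ::
  "('n::finite \<Rightarrow> real) \<Rightarrow> (real \<Rightarrow> 'n coeffs) \<Rightarrow> ('n \<Rightarrow> real \<Rightarrow> real) \<Rightarrow> 'n \<Rightarrow> real \<Rightarrow> real" where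
  "vector_field \<tau> \<omega> y i t = - dC (\<omega> t) i * y i t + (\<Sum>j\<in>UNIV. aC (\<omega> t) i j * y j t)
     + bC (\<omega> t) i * y i (t - \<tau> i) * exp (- cC (\<omega> t) i * y i (t - \<tau> i))"

text \<open>Weak inequalities for \<open>p\<close> pass to the hull by closure. Strict ones act
  through recurrence to the value of \<open>p\<close> at time 0, where positivity of the birth rate
  is recorded.\<close>

locale nicholson_hull =
  fixes \<tau> :: "'n::finite \<Rightarrow> real" and p :: "real \<Rightarrow> 'n coeffs" and C c0 :: real
  assumes tau: "\<tau> i > 0" and c0: "c0 > 0"
    and p_cont: "continuous_on UNIV p" and p_ap: "has_almost_periods p"
    and p_bounds: "0 \<le> t \<Longrightarrow> 0 \<le> dC (p t) i \<and> dC (p t) i \<le> C" "0 \<le> t \<Longrightarrow> 0 \<le> aC (p t) i j \<and> aC (p t) i j \<le> C"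
      "0 \<le> t \<Longrightarrow> 0 \<le> bC (p t) i \<and> bC (p t) i \<le> C" "0 \<le> t \<Longrightarrow> c0 \<le> cC (p t) i \<and> cC (p t) i \<le> C"
    and p_dominant: "0 \<le> t \<Longrightarrow> 0 < dC (p t) i - (\<Sum>j\<in>UNIV. aC (p t) j i)"
    and p_birth: "0 < bC (p 0) i"
begin

abbreviation \<Omega> :: "(real \<Rightarrow> 'n coeffs) set" where "\<Omega> \<equiv> translation_hull p"

lemmas recurrence = hull_recurrence_open[OF p_cont p_ap]

lemma p_in_hull: "p \<in> \<Omega>" by (rule self_in_hull[OF p_cont])

lemma hull_cont: "\<omega> \<in> \<Omega> \<Longrightarrow> continuous_on S \<omega>"
  using mem_translation_hull_iff[OF p_cont] continuous_on_subset by blast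

lemma hull_closed_property:
  assumes "closed S" "\<And>t. 0 \<le> t \<Longrightarrow> p t \<in> S" "\<omega> \<in> \<Omega>"
  shows "\<omega> t \<in> S"
  using hull_mem_closure[OF p_cont p_ap assms(3), of t] closure_minimal[OF _ assms(1), of "p ` {0..}"] assms(2) by auto

text \<open>Closed conditions on the coefficient vector survive the closure of the values of
  \<open>p\<close>; the strict column dominance becomes weak on the way.\<close>

lemma hull_bounds:
  assumes w: "\<omega> \<in> \<Omega>"
  shows "0 \<le> dC (\<omega> t) i \<and> dC (\<omega> t) i \<le> C" "0 \<le> aC (\<omega> t) i j \<and> aC (\<omega> t) i j \<le> C"
      "0 \<le> bC (\<omega> t) i \<and> bC (\<omega> t) i \<le> C" "c0 \<le> cC (\<omega> t) i \<and> cC (\<omega> t) i \<le> C"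
      "0 \<le> dC (\<omega> t) i - (\<Sum>j\<in>UNIV. aC (\<omega> t) j i)"
proof -
  show "0 \<le> dC (\<omega> t) i \<and> dC (\<omega> t) i \<le> C"
    by (rule hull_closed_property[OF _ _ w, of "{z. 0 \<le> dC z i \<and> dC z i \<le> C}", simplified])
      (auto intro!: closed_Collect_conj closed_Collect_le continuous_intros p_bounds)
  show "0 \<le> aC (\<omega> t) i j \<and> aC (\<omega> t) i j \<le> C"
    by (rule hull_closed_property[OF _ _ w, of "{z. 0 \<le> aC z i j \<and> aC z i j \<le> C}", simplified])
      (auto intro!: closed_Collect_conj closed_Collect_le continuous_intros p_bounds)
  show "0 \<le> bC (\<omega> t) i \<and> bC (\<omega> t) i \<le> C"
    by (rule hull_closed_property[OF _ _ w, of "{z. 0 \<le> bC z i \<and> bC z i \<le> C}", simplified])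
      (auto intro!: closed_Collect_conj closed_Collect_le continuous_intros p_bounds)
  show "c0 \<le> cC (\<omega> t) i \<and> cC (\<omega> t) i \<le> C"
    by (rule hull_closed_property[OF _ _ w, of "{z. c0 \<le> cC z i \<and> cC z i \<le> C}", simplified])
      (auto intro!: closed_Collect_conj closed_Collect_le continuous_intros p_bounds)
  have "\<omega> t \<in> {z. 0 \<le> dC z i - (\<Sum>j\<in>UNIV. aC z j i)}"
    using p_dominant
    by (intro hull_closed_property[OF _ _ w])
      (auto intro!: closed_Collect_le continuous_intros order_less_imp_le simp del: diff_ge_0_iff_ge)
  then show "0 \<le> dC (\<omega> t) i - (\<Sum>j\<in>UNIV. aC (\<omega> t) j i)" by simp
qed

lemma hull_system:
  assumes w: "\<omega> \<in> \<Omega>"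
  shows "nicholson_system \<tau> (\<lambda>i t. dC (\<omega> t) i) (\<lambda>i t. bC (\<omega> t) i) (\<lambda>i t. cC (\<omega> t) i)
     (\<lambda>i j t. aC (\<omega> t) i j) C c0"
  by standard (use tau c0 hull_bounds[OF w] in \<open>auto intro!: continuous_intros hull_cont[OF w]\<close>)

lemma C_pos: "C > 0"
  by (rule nicholson_system.C_pos[OF hull_system[OF p_in_hull]])

section \<open>Solutions over the hull and the cocycle property\<close>

lemma sol_iff:
  assumes "\<omega> \<in> \<Omega>" "\<phi> \<in> phase_cone \<tau>"
  shows "nicholson_solution \<tau> (\<lambda>i t. dC (\<omega> t) i) (\<lambda>i j t. aC (\<omega> t) i j) (\<lambda>i t. bC (\<omega> t) i)
     (\<lambda>i t. cC (\<omega> t) i) \<phi> y \<longleftrightarrow> y = family_sol \<tau> \<omega> \<phi>"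
  unfolding family_sol_eq by (rule nicholson_system.is_solution_iff[OF hull_system]) fact+

lemma sol_nonneg:
  assumes "\<omega> \<in> \<Omega>" "\<phi> \<in> phase_cone \<tau>" "- \<tau> i \<le> t"
  shows "0 \<le> family_sol \<tau> \<omega> \<phi> i t"
  by (rule nicholson_system.is_solution_nonneg[OF hull_system[OF assms(1)] _ assms(2,3)])
    (simp add: sol_iff[OF assms(1,2)])

lemma sol_init:
  assumes "\<omega> \<in> \<Omega>" "\<phi> \<in> phase_cone \<tau>" "- \<tau> i \<le> t" "t \<le> 0"
  shows "family_sol \<tau> \<omega> \<phi> i t = \<phi> i t"
  using sol_iff[OF assms(1,2), of "family_sol \<tau> \<omega> \<phi>"] assms(3,4) unfolding nicholson_solution_def by auto

lemma sol_deriv: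
  assumes "\<omega> \<in> \<Omega>" "\<phi> \<in> phase_cone \<tau>" "0 \<le> t"
  shows "(family_sol \<tau> \<omega> \<phi> i has_real_derivative vector_field \<tau> \<omega> (family_sol \<tau> \<omega> \<phi>) i t) (at t within {0..})"
  using sol_iff[OF assms(1,2), of "family_sol \<tau> \<omega> \<phi>"] assms(3) unfolding nicholson_solution_def vector_field_def by auto

lemma sol_deriv_subset:
  assumes "\<omega> \<in> \<Omega>" "\<phi> \<in> phase_cone \<tau>" "0 \<le> t" "S \<subseteq> {0..}"
  shows "(family_sol \<tau> \<omega> \<phi> i has_real_derivative vector_field \<tau> \<omega> (family_sol \<tau> \<omega> \<phi>) i t) (at t within S)"
  by (rule DERIV_subset[OF sol_deriv[OF assms(1-3)] assms(4)])

lemma sol_cont: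
  assumes "\<omega> \<in> \<Omega>" "\<phi> \<in> phase_cone \<tau>"
  shows "continuous_on {0..} (family_sol \<tau> \<omega> \<phi> i)"
  by (rule DERIV_continuous_on[OF sol_deriv[OF assms]]) auto

text \<open>The cocycle identity. Taking \<open>T\<close> at least as large as every delay places
  the whole segment in t \<ge> 0, where its continuity follows from differentiability.\<close>

lemma sol_shift:
  assumes w: "\<omega> \<in> \<Omega>" and w': "\<omega> \<cdot>\<^sub>t T \<in> \<Omega>" and \<phi>: "\<phi> \<in> phase_cone \<tau>" and T: "\<And>i. \<tau> i \<le> T"
  shows "segment (family_sol \<tau> \<omega> \<phi>) T \<in> phase_cone \<tau>"
    and "- \<tau> i \<le> t \<Longrightarrow> family_sol \<tau> (\<omega> \<cdot>\<^sub>t T) (segment (family_sol \<tau> \<omega> \<phi>) T) i t = family_sol \<tau> \<omega> \<phi> i (T + t)"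
proof -
  have "continuous_on {- \<tau> i..0} (segment (family_sol \<tau> \<omega> \<phi>) T i)" for i
    unfolding segment_def
    by (rule continuous_on_compose2[OF sol_cont[OF w \<phi>]]) (use T[of i] in \<open>auto intro!: continuous_intros\<close>)
  moreover have "0 \<le> segment (family_sol \<tau> \<omega> \<phi>) T i s" if "s \<in> {- \<tau> i..0}" for i s
    unfolding segment_def by (rule sol_nonneg[OF w \<phi>]) (use that T[of i] tau[of i] in auto)
  ultimately show seg: "segment (family_sol \<tau> \<omega> \<phi>) T \<in> phase_cone \<tau>"
    by (auto simp: phase_cone_def phase_space_def)
  define y where "y = family_sol \<tau> \<omega> \<phi>"
  define z where "z = (\<lambda>i. restrict (\<lambda>t. y i (T + t)) {- \<tau> i..})"
  have "(z i has_real_derivative vector_field \<tau> (\<omega> \<cdot>\<^sub>t T) z i t) (at t within {0..})" if t: "0 \<le> t" for i t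
  proof -
    have T0: "0 \<le> T" using T[of i] tau[of i] by linarith
    have "(y i has_real_derivative vector_field \<tau> \<omega> y i (T + t)) (at (T + t) within (+) T ` {0..})"
      unfolding y_def by (rule sol_deriv_subset[OF w \<phi>]) (use T0 t in auto)
    then have "(y i \<circ> (+) T has_real_derivative vector_field \<tau> \<omega> y i (T + t) * 1) (at t within {0..})"
      by (rule DERIV_image_chain) (auto intro!: derivative_eq_intros)
    then have "((\<lambda>t. y i (T + t)) has_real_derivative vector_field \<tau> \<omega> y i (T + t)) (at t within {0..})"
      by (simp add: o_def)
    then have "(z i has_real_derivative vector_field \<tau> \<omega> y i (T + t)) (at t within {0..})"
      by (rule has_field_derivative_transform_within[OF _ zero_less_one]) (use t tau[of i] in \<open>auto simp: z_def\<close>)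
    moreover have "vector_field \<tau> \<omega> y i (T + t) = vector_field \<tau> (\<omega> \<cdot>\<^sub>t T) z i t"
    proof -
      have "z j t = y j (T + t)" for j using t tau[of j] by (simp add: z_def)
      moreover have "z i (t - \<tau> i) = y i (T + t - \<tau> i)" using t by (simp add: z_def algebra_simps)
      ultimately show ?thesis by (simp add: vector_field_def translate_def)
    qed
    ultimately show ?thesis by simp
  qed
  then have "nicholson_solution \<tau> (\<lambda>i t. dC ((\<omega> \<cdot>\<^sub>t T) t) i) (\<lambda>i j t. aC ((\<omega> \<cdot>\<^sub>t T) t) i j) (\<lambda>i t. bC ((\<omega> \<cdot>\<^sub>t T) t) i)
     (\<lambda>i t. cC ((\<omega> \<cdot>\<^sub>t T) t) i) (segment y T) z"
    unfolding nicholson_solution_def vector_field_def[symmetric] by (auto simp: z_def segment_def)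
  then have zeq: "z = family_sol \<tau> (\<omega> \<cdot>\<^sub>t T) (segment y T)"
    using sol_iff[OF w' seg] by (simp add: y_def)
  have "z i t = family_sol \<tau> (\<omega> \<cdot>\<^sub>t T) (segment y T) i t" by (simp only: zeq)
  then show "family_sol \<tau> (\<omega> \<cdot>\<^sub>t T) (segment (family_sol \<tau> \<omega> \<phi>) T) i t = family_sol \<tau> \<omega> \<phi> i (T + t)"
    if "- \<tau> i \<le> t" using that by (simp add: y_def[symmetric] z_def)
qed

section \<open>Lower bounds and their spread along couplings\<close>

lemma vector_field_ge:
  assumes w: "\<omega> \<in> \<Omega>" and \<phi>: "\<phi> \<in> phase_cone \<tau>" and t: "0 \<le> t"
  defines "y \<equiv> family_sol \<tau> \<omega> \<phi>"
  shows "- C * y i t + aC (\<omega> t) i j * y j t \<le> vector_field \<tau> \<omega> y i t"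
proof -
  have nn: "0 \<le> y i t" "0 \<le> y i (t - \<tau> i)" for i
    unfolding y_def by (rule sol_nonneg[OF w \<phi>]; use t tau[of i] in auto)+
  have "- C * y i t \<le> - dC (\<omega> t) i * y i t"
    using hull_bounds(1)[OF w, of t i] nn(1)[of i] by (simp add: mult_right_mono)
  moreover have "aC (\<omega> t) i j * y j t \<le> (\<Sum>j\<in>UNIV. aC (\<omega> t) i j * y j t)"
    by (rule member_le_sum) (use hull_bounds(2)[OF w] nn(1) in auto)
  moreover have "0 \<le> bC (\<omega> t) i * y i (t - \<tau> i) * exp (- cC (\<omega> t) i * y i (t - \<tau> i))"
    using hull_bounds(3)[OF w, of t i] nn(2)[of i] by simp
  ultimately show ?thesis unfolding vector_field_def by linarith
qed

lemma sol_decay: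
  assumes w: "\<omega> \<in> \<Omega>" and \<phi>: "\<phi> \<in> phase_cone \<tau>" and t: "0 \<le> T" "T \<le> t"
  shows "exp (- C * (t - T)) * family_sol \<tau> \<omega> \<phi> i T \<le> family_sol \<tau> \<omega> \<phi> i t"
proof -
  define y where "y = family_sol \<tau> \<omega> \<phi>"
  have "exp (- C * (t - T)) * y i T + 0 / C * (1 - exp (- C * (t - T))) \<le> y i t"
  proof (rule linear_lower_bound[OF C_pos t(2)])
    fix r assume r: "T \<le> r" "r \<le> t"
    show "(y i has_real_derivative vector_field \<tau> \<omega> y i r) (at r within {T..t})"
      unfolding y_def by (rule sol_deriv_subset[OF w \<phi>]) (use r t in auto)
    have "0 \<le> aC (\<omega> r) i i * y i r" unfolding y_def
      using sol_nonneg[OF w \<phi>, of i r] hull_bounds(2)[OF w, of r i i] tau[of i] r t by simp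
    then show "- C * y i r + 0 \<le> vector_field \<tau> \<omega> y i r"
      using vector_field_ge[OF w \<phi>, of r i i] r t unfolding y_def by linarith
  qed
  then show ?thesis by (simp add: y_def)
qed

lemma sol_pos:
  assumes w: "\<omega> \<in> \<Omega>" and \<phi>: "\<phi> \<in> phase_cone \<tau>" and t: "0 \<le> T" "T \<le> t" and pos: "0 < family_sol \<tau> \<omega> \<phi> i T"
  shows "0 < family_sol \<tau> \<omega> \<phi> i t"
  using sol_decay[OF w \<phi> t, of i] pos by (smt (verit) exp_gt_zero mult_pos_pos)

text \<open>The coupling may vanish when component \<open>j\<close> becomes positive. Positivity of
  \<open>j\<close> lasts, and recurrence provides a later time with positive coupling; there
  component \<open>i\<close> is either positive already or equal to 0 with positive
  derivative.\<close>

lemma positivity_spreads: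
  assumes w: "\<omega> \<in> \<Omega>" and \<phi>: "\<phi> \<in> phase_cone \<tau>" and T: "0 \<le> T" and pos: "0 < family_sol \<tau> \<omega> \<phi> j T"
    and edge: "aC (p t0) i j \<noteq> 0"
  shows "\<exists>T'\<ge>0. 0 < family_sol \<tau> \<omega> \<phi> i T'"
proof -
  define y where "y = family_sol \<tau> \<omega> \<phi>"
  have "open {z :: 'n coeffs. 0 < aC z i j}" by (intro open_Collect_less continuous_intros)
  moreover have "p t0 \<in> {z. 0 < aC z i j}" using edge hull_bounds(2)[OF p_in_hull, of t0 i j] by auto
  ultimately obtain h L where hL: "h > 0" "L > 0"
    "\<And>\<omega> t. \<omega> \<in> \<Omega> \<Longrightarrow> \<exists>s\<ge>t. s + h \<le> t + L \<and> (\<forall>r\<in>{s..s+h}. \<omega> r \<in> {z. 0 < aC z i j})"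
    by (rule recurrence) blast
  obtain s where s: "s \<ge> T" "\<forall>r\<in>{s..s+h}. \<omega> r \<in> {z. 0 < aC z i j}" using hL(3)[OF w, of T] by blast
  have as: "0 < aC (\<omega> s) i j" using s(2) hL(1) by auto
  have s0: "0 \<le> s" using s T by simp
  show ?thesis
  proof (cases "0 < y i s")
    case True
    then show ?thesis using s0 by (auto simp: y_def)
  next
    case False
    then have yi: "y i s = 0" using sol_nonneg[OF w \<phi>, of i s] s0 tau[of i] by (simp add: y_def)
    have "0 < y j s" unfolding y_def by (rule sol_pos[OF w \<phi> T s(1) pos])
    then have "0 < aC (\<omega> s) i j * y j s" using as by simp
    then have "0 < vector_field \<tau> \<omega> y i s"
      using vector_field_ge[OF w \<phi> s0, of i j] yi unfolding y_def[symmetric] by simp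
    then obtain d where d: "d > 0" "\<And>h. 0 < h \<Longrightarrow> s + h \<in> {0..} \<Longrightarrow> h < d \<Longrightarrow> y i s < y i (s + h)"
      using has_real_derivative_pos_inc_right[OF sol_deriv[OF w \<phi> s0, of i]] unfolding y_def by blast
    then have "0 < y i (s + d / 2)" using d(2)[of "d / 2"] s0 yi by simp
    then show ?thesis using s0 d(1) by (intro exI[of _ "s + d / 2"]) (simp add: y_def)
  qed
qed

text \<open>Component \<open>j\<close> feeds \<open>i\<close> with a source that is at least
  \<delta> * m on recurring windows. The windows are common to the family, so \<open>m'\<close>
  depends neither on \<omega> nor on the solution.\<close>

lemma lower_bound_spreads:
  assumes edge: "aC (p t0) i j \<noteq> 0" and m: "m > 0"
  shows "\<exists>m'>0. \<forall>\<omega>\<in>\<Omega>. \<forall>\<phi>\<in>phase_cone \<tau>. (\<exists>T\<ge>0. \<forall>t\<ge>T. m \<le> family_sol \<tau> \<omega> \<phi> j t) \<longrightarrow>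
           (\<exists>T\<ge>0. \<forall>t\<ge>T. m' \<le> family_sol \<tau> \<omega> \<phi> i t)"
proof -
  define \<delta> where "\<delta> = aC (p t0) i j / 2"
  have a0: "0 < aC (p t0) i j" using edge hull_bounds(2)[OF p_in_hull, of t0 i j] by auto
  then have d: "\<delta> > 0" by (simp add: \<delta>_def)
  have "open {z :: 'n coeffs. \<delta> < aC z i j}" by (intro open_Collect_less continuous_intros)
  moreover have "p t0 \<in> {z. \<delta> < aC z i j}" using a0 by (simp add: \<delta>_def)
  ultimately obtain h L where hL: "h > 0" "L > 0"
    "\<And>\<omega> t. \<omega> \<in> \<Omega> \<Longrightarrow> \<exists>s\<ge>t. s + h \<le> t + L \<and> (\<forall>r\<in>{s..s+h}. \<omega> r \<in> {z. \<delta> < aC z i j})"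
    by (rule recurrence) blast
  define m' where "m' = exp (- C * L) * (\<delta> * m / C * (1 - exp (- C * h)))"
  have "m' > 0" using C_pos d m hL by (simp add: m'_def)
  moreover have "\<exists>T\<ge>0. \<forall>t\<ge>T. m' \<le> family_sol \<tau> \<omega> \<phi> i t"
    if w: "\<omega> \<in> \<Omega>" and \<phi>: "\<phi> \<in> phase_cone \<tau>" and T: "T \<ge> 0" "\<forall>t\<ge>T. m \<le> family_sol \<tau> \<omega> \<phi> j t" for \<omega> \<phi> T
  proof -
    define y where "y = family_sol \<tau> \<omega> \<phi>"
    have "m' \<le> y i t" if t: "T + L \<le> t" for t
      unfolding m'_def
    proof (rule recurrent_source_lower_bound[OF C_pos _ hL(1,2), where T = T and f = "y i" and t = t and \<delta> = "\<delta> * m"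
          and f' = "vector_field \<tau> \<omega> y i" and b = "\<lambda>t. aC (\<omega> t) i j * m"])
      fix t assume t: "T \<le> t"
      show "(y i has_real_derivative vector_field \<tau> \<omega> y i t) (at t within {T..})"
        unfolding y_def by (rule sol_deriv_subset[OF w \<phi>]) (use t T in auto)
      show "0 \<le> y i t" unfolding y_def by (rule sol_nonneg[OF w \<phi>]) (use t T tau[of i] in auto)
      have "aC (\<omega> t) i j * m \<le> aC (\<omega> t) i j * y j t"
        using T t hull_bounds(2)[OF w, of t i j] by (intro mult_left_mono) (auto simp: y_def)
      then show "- C * y i t + aC (\<omega> t) i j * m \<le> vector_field \<tau> \<omega> y i t"
        using vector_field_ge[OF w \<phi>, of t i j] T t unfolding y_def by linarith
      show "0 \<le> aC (\<omega> t) i j * m" using m hull_bounds(2)[OF w, of t i j] by simp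
      obtain s where "s \<ge> t" "s + h \<le> t + L" "\<forall>r\<in>{s..s+h}. \<delta> < aC (\<omega> r) i j"
        using hL(3)[OF w, of t] by auto
      then show "\<exists>s\<ge>t. s + h \<le> t + L \<and> (\<forall>r\<in>{s..s+h}. \<delta> * m \<le> aC (\<omega> r) i j * m)"
        using m by (auto intro!: exI[of _ s])
    qed (use d m t in auto)
    then show ?thesis using T hL by (intro exI[of _ "T + L"]) (auto simp: y_def)
  qed
  ultimately show ?thesis by blast
qed

text \<open>Comparison for - y on the complement of \<open>K\<close>: where - y is nonnegative at
  the delayed times, y \<ge> 0 forces the delayed values to be 0. The birth term vanishes and a
  closed cooperative system remains.\<close>

lemma zero_off_closed_set:
  assumes w: "\<omega> \<in> \<Omega>" and \<phi>: "\<phi> \<in> phase_cone \<tau>"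
    and zero: "\<And>i s. i \<notin> K \<Longrightarrow> - \<tau> i \<le> s \<Longrightarrow> s \<le> 0 \<Longrightarrow> \<phi> i s = 0"
    and noedge: "\<And>i j t. i \<notin> K \<Longrightarrow> j \<in> K \<Longrightarrow> aC (\<omega> t) i j = 0"
    and i: "i \<notin> K" and t: "0 \<le> t"
  shows "family_sol \<tau> \<omega> \<phi> i t = 0"
proof -
  define y where "y = family_sol \<tau> \<omega> \<phi>"
  have "0 \<le> - y i t"
  proof (rule delay_cooperative_nonneg[where I = "- K" and T = 0 and v = "\<lambda>i t. - y i t" and C = C and \<tau> = \<tau>
        and v' = "\<lambda>i t. - vector_field \<tau> \<omega> y i t" and D = "\<lambda>i t. dC (\<omega> t) i" and A = "\<lambda>i j t. aC (\<omega> t) i j"])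
    fix i t assume i: "i \<in> - K" and t: "(0::real) \<le> t" and h: "\<And>j. j \<in> - K \<Longrightarrow> 0 \<le> - y j (t - \<tau> j)"
    have "0 \<le> y i (t - \<tau> i)" unfolding y_def by (rule sol_nonneg[OF w \<phi>]) (use t in auto)
    then have z: "y i (t - \<tau> i) = 0" using h[OF i] by simp
    have "(\<Sum>j\<in>UNIV. aC (\<omega> t) i j * y j t) = (\<Sum>j\<in>-K. aC (\<omega> t) i j * y j t)"
      by (rule sum.mono_neutral_right) (use noedge i in auto)
    then show "- dC (\<omega> t) i * - y i t + (\<Sum>j\<in>- K. aC (\<omega> t) i j * - y j t) \<le> - vector_field \<tau> \<omega> y i t"
      by (simp add: vector_field_def z sum_negf)
  next
    fix i t assume i: "i \<in> - K" and t: "(0::real) \<le> t"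
    show "((\<lambda>t. - y i t) has_real_derivative - vector_field \<tau> \<omega> y i t) (at t within {0..})"
      unfolding y_def by (rule DERIV_minus[OF sol_deriv[OF w \<phi> t]])
    show "\<bar>dC (\<omega> t) i\<bar> \<le> C" using hull_bounds(1)[OF w, of t i] by auto
  next
    fix i t assume i: "i \<in> - K" and t: "(0::real) - \<tau> i \<le> t" "t \<le> 0"
    then show "0 \<le> - y i t" using sol_init[OF w \<phi>, of i t] zero[of i t] by (simp add: y_def)
  qed (use tau C_pos hull_bounds(2)[OF w] i t in auto)
  moreover have "0 \<le> y i t" unfolding y_def by (rule sol_nonneg[OF w \<phi>]) (use t tau[of i] in auto)
  ultimately show ?thesis by (simp add: y_def)
qed

section \<open>Dissipativity\<close>

lemma total_mass_derivative_le:
  assumes w: "\<omega> \<in> \<Omega>" and \<phi>: "\<phi> \<in> phase_cone \<tau>" and t: "0 \<le> t"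
    and \<delta>: "\<And>i. \<delta> \<le> dC (\<omega> t) i - (\<Sum>j\<in>UNIV. aC (\<omega> t) j i)"
  defines "y \<equiv> family_sol \<tau> \<omega> \<phi>"
  shows "(\<Sum>i\<in>UNIV. vector_field \<tau> \<omega> y i t) \<le> - \<delta> * (\<Sum>i\<in>UNIV. y i t) + real CARD('n) * (C / c0)"
proof -
  have nn: "0 \<le> y i t" "0 \<le> y i (t - \<tau> i)" for i
    unfolding y_def by (rule sol_nonneg[OF w \<phi>]; use t tau[of i] in auto)+
  \<comment> \<open>Swapping the sums replaces the row sums of the couplings by column sums, which
    are the ones that (a6) controls.\<close>
  have "(\<Sum>i\<in>UNIV. \<Sum>j\<in>UNIV. aC (\<omega> t) i j * y j t) = (\<Sum>j\<in>UNIV. \<Sum>i\<in>UNIV. aC (\<omega> t) i j * y j t)"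
    by (rule sum.swap)
  also have "\<dots> = (\<Sum>i\<in>UNIV. (\<Sum>j\<in>UNIV. aC (\<omega> t) j i) * y i t)"
    by (simp add: sum_distrib_right)
  finally have "(\<Sum>i\<in>UNIV. vector_field \<tau> \<omega> y i t) =
      (\<Sum>i\<in>UNIV. - (dC (\<omega> t) i - (\<Sum>j\<in>UNIV. aC (\<omega> t) j i)) * y i t) +
      (\<Sum>i\<in>UNIV. bC (\<omega> t) i * y i (t - \<tau> i) * exp (- cC (\<omega> t) i * y i (t - \<tau> i)))"
    unfolding vector_field_def by (simp add: sum.distrib algebra_simps sum_subtractf sum_negf)
  also have "\<dots> \<le> (\<Sum>i\<in>UNIV. - \<delta> * y i t) + (\<Sum>i\<in>(UNIV::'n set). C / c0)"
  proof (intro add_mono sum_mono)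
    fix i
    show "- (dC (\<omega> t) i - (\<Sum>j\<in>UNIV. aC (\<omega> t) j i)) * y i t \<le> - \<delta> * y i t"
      using \<delta>[of i] nn(1)[of i] by (intro mult_right_mono) auto
    have ci: "0 < cC (\<omega> t) i" "c0 \<le> cC (\<omega> t) i" using hull_bounds(4)[OF w, of t i] c0 by auto
    have "y i (t - \<tau> i) * exp (- cC (\<omega> t) i * y i (t - \<tau> i)) \<le> 1 / cC (\<omega> t) i"
      by (rule mult_exp_le_inverse[OF ci(1)])
    also have "\<dots> \<le> 1 / c0" using ci c0 by (simp add: frac_le)
    finally have "bC (\<omega> t) i * (y i (t - \<tau> i) * exp (- cC (\<omega> t) i * y i (t - \<tau> i))) \<le> C * (1 / c0)"
      using hull_bounds(3)[OF w, of t i] nn(2)[of i] by (intro mult_mono) auto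
    then show "bC (\<omega> t) i * y i (t - \<tau> i) * exp (- cC (\<omega> t) i * y i (t - \<tau> i)) \<le> C / c0"
      by (simp add: mult.assoc)
  qed
  finally show ?thesis by (simp add: sum_distrib_left sum_negf)
qed

text \<open>The total mass grows at rate at most \<open>B\<close> at all times and is damped at rate
  \<delta> on recurring windows. Windows and rates are common to the family, hence so is
  \<open>M\<close>.\<close>

lemma ultimate_bound:
  obtains M where "M > 0"
    "\<And>\<omega> \<phi>. \<omega> \<in> \<Omega> \<Longrightarrow> \<phi> \<in> phase_cone \<tau> \<Longrightarrow> \<exists>T\<ge>0. \<forall>t\<ge>T. \<forall>i. family_sol \<tau> \<omega> \<phi> i t \<le> M"
proof -
  define f where "f = (\<lambda>z (i::'n). dC z i - (\<Sum>j\<in>UNIV. aC z j i))"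
  \<comment> \<open>Half of the smallest dominance defect at time 0, so that p 0 lies in the open
    set where all defects exceed \<delta>.\<close>
  define \<delta> where "\<delta> = Min (range (f (p 0))) / 2"
  have "Min (range (f (p 0))) \<in> range (f (p 0))" by (intro Min_in) auto
  then have d: "\<delta> > 0" using p_dominant[of 0] by (auto simp: \<delta>_def f_def)
  have dl: "\<delta> < f (p 0) i" for i
  proof -
    have "Min (range (f (p 0))) \<le> f (p 0) i" by (intro Min_le) auto
    then show ?thesis using d unfolding \<delta>_def by linarith
  qed
  have "open (\<Inter>i. {z. \<delta> < f z i})"
    unfolding f_def by (intro open_INT open_Collect_less continuous_intros ballI) auto
  moreover have "p 0 \<in> (\<Inter>i. {z. \<delta> < f z i})" using dl by auto
  ultimately obtain h L where hL: "h > 0" "L > 0"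
    "\<And>\<omega> t. \<omega> \<in> \<Omega> \<Longrightarrow> \<exists>s\<ge>t. s + h \<le> t + L \<and> (\<forall>r\<in>{s..s+h}. \<omega> r \<in> (\<Inter>i. {z. \<delta> < f z i}))"
    by (rule recurrence) blast
  define B where "B = real CARD('n) * (C / c0)"
  define M where "M = B * L / (1 - exp (- \<delta> * h)) + B * L + 1"
  have B: "B \<ge> 0" using C_pos c0 by (simp add: B_def)
  have "0 \<le> B * L / (1 - exp (- \<delta> * h))" using B hL d by (intro divide_nonneg_nonneg) auto
  then have "M > 0" using B hL by (simp add: M_def add_nonneg_pos)
  moreover have "\<exists>T\<ge>0. \<forall>t\<ge>T. \<forall>i. family_sol \<tau> \<omega> \<phi> i t \<le> M" if w: "\<omega> \<in> \<Omega>" and \<phi>: "\<phi> \<in> phase_cone \<tau>" for \<omega> \<phi>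
  proof -
    define y where "y = family_sol \<tau> \<omega> \<phi>"
    have nn: "0 \<le> y i t" if "0 \<le> t" for i t
      unfolding y_def by (rule sol_nonneg[OF w \<phi>]) (use that tau[of i] in auto)
    have "\<exists>T'\<ge>0. \<forall>t\<ge>T'. (\<Sum>i\<in>UNIV. y i t) \<le> B * L / (1 - exp (- \<delta> * h)) + B * L + 1"
    proof (rule recurrent_damping_ultimate_bound[OF d hL(1,2) B, where V' = "\<lambda>t. \<Sum>i\<in>UNIV. vector_field \<tau> \<omega> y i t"
          and \<gamma> = "\<lambda>t. Min (range (f (\<omega> t)))"])
      fix t :: real assume t: "0 \<le> t"
      show "((\<lambda>t. \<Sum>i\<in>UNIV. y i t) has_real_derivative (\<Sum>i\<in>UNIV. vector_field \<tau> \<omega> y i t)) (at t within {0..})"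
        unfolding y_def by (intro DERIV_sum sol_deriv[OF w \<phi> t])
      show "0 \<le> (\<Sum>i\<in>UNIV. y i t)" using nn[OF t] by (intro sum_nonneg) auto
      show "(\<Sum>i\<in>UNIV. vector_field \<tau> \<omega> y i t) \<le> B"
        using total_mass_derivative_le[OF w \<phi> t, of 0] hull_bounds(5)[OF w] by (simp add: y_def B_def)
      show "(\<Sum>i\<in>UNIV. vector_field \<tau> \<omega> y i t) \<le> - \<delta> * (\<Sum>i\<in>UNIV. y i t) + B"
        if "\<delta> \<le> Min (range (f (\<omega> t)))"
        unfolding y_def B_def
        by (rule total_mass_derivative_le[OF w \<phi> t]) (use that in \<open>auto simp: f_def\<close>)
      obtain s where "s \<ge> t" "s + h \<le> t + L" "\<forall>r\<in>{s..s+h}. \<omega> r \<in> (\<Inter>i. {z. \<delta> < f z i})"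
        using hL(3)[OF w, of t] by blast
      then show "\<exists>s\<ge>t. s + h \<le> t + L \<and> (\<forall>r\<in>{s..s+h}. \<delta> \<le> Min (range (f (\<omega> r))))"
        by (intro exI[of _ s]) (auto intro: order_less_imp_le)
    qed
    then obtain T where T: "T \<ge> 0" "\<forall>t\<ge>T. (\<Sum>i\<in>UNIV. y i t) \<le> M" unfolding M_def by blast
    have "y i t \<le> M" if "t \<ge> T" for i t
    proof -
      have "y i t \<le> (\<Sum>i\<in>UNIV. y i t)" by (rule member_le_sum) (use nn that T in auto)
      then show ?thesis using T that by force
    qed
    then show ?thesis using T by (auto simp: y_def)
  qed
  ultimately show ?thesis using that by blast
qed

end

section \<open>Transfer of persistence to the hull\<close>

text \<open>Up to \<eta> the exponential is at least exp (- C * \<eta>); between \<eta> and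
  \<open>M\<close> the product is at least \<eta> * exp (- C * M). Truncation at that level gives a
  minorant that is nondecreasing in \<open>u\<close>, as comparison requires.\<close>

lemma ricker_ge_truncation:
  fixes u :: real
  assumes "0 \<le> u" "u \<le> M" "0 \<le> x" "x \<le> C" "0 \<le> \<eta>"
  shows "exp (- C * \<eta>) * min u (\<eta> * exp (- C * M)) \<le> u * exp (- x * u)"
proof (cases "u \<le> \<eta>")
  case True
  have "x * u \<le> C * \<eta>" using assms True by (intro mult_mono) auto
  then have "exp (- C * \<eta>) * u \<le> exp (- x * u) * u" using assms by (intro mult_right_mono) auto
  moreover have "exp (- C * \<eta>) * min u (\<eta> * exp (- C * M)) \<le> exp (- C * \<eta>) * u"
    by (intro mult_left_mono) auto
  moreover have "exp (- x * u) * u = u * exp (- x * u)" by (rule mult.commute)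
  ultimately show ?thesis by linarith
next
  case False
  have "x * u \<le> C * M" using assms by (intro mult_mono) auto
  then have "\<eta> * exp (- C * M) \<le> u * exp (- x * u)" using assms False by (intro mult_mono) auto
  moreover have "exp (- C * \<eta>) * min u (\<eta> * exp (- C * M)) \<le> 1 * (\<eta> * exp (- C * M))"
    using assms by (intro mult_mono) auto
  ultimately show ?thesis by linarith
qed

text \<open>The logistic curve \<epsilon> / (1 + Q exp (- \<theta> (t - T))), which solves e' =
  \<theta> e (1 - e / \<epsilon>). It can start as low as a given solution demands, never exceeds
  \<epsilon>, and grows slowly enough that its delayed value stays close to the present one.\<close>

lemma logistic_growth:
  fixes T :: real
  assumes eps: "\<epsilon> > 0" and Q: "Q > 0" and th: "\<theta> > 0"
  obtains e e' where
    "\<And>t S. (e has_real_derivative e' t) (at t within S)"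
    "\<And>t. e' t \<le> \<theta> * e t" "\<And>t. 0 < e t" "\<And>t. e t \<le> \<epsilon>" "\<And>t. t \<le> T \<Longrightarrow> e t \<le> \<epsilon> / Q"
    "\<And>t h. 0 \<le> h \<Longrightarrow> (1 - \<theta> * h) * e t \<le> e (t - h)"
    "\<And>t. T + Q / \<theta> \<le> t \<Longrightarrow> \<epsilon> / 2 \<le> e t"
proof
  define E where "E = (\<lambda>t. Q * exp (- \<theta> * (t - T)))"
  have E: "E t > 0" for t using Q by (simp add: E_def)
  define e where "e = (\<lambda>t. \<epsilon> / (1 + E t))"
  define e' where "e' = (\<lambda>t. \<epsilon> * \<theta> * E t / (1 + E t)\<^sup>2)"
  have nz: "1 + E t > 0" for t using E[of t] by linarith
  have dE: "(E has_real_derivative - \<theta> * E t) (at t within S)" for t S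
    unfolding E_def by (auto intro!: derivative_eq_intros)
  show "(e has_real_derivative e' t) (at t within S)" for t S
    unfolding e_def e'_def using nz[of t]
    by (auto intro!: derivative_eq_intros dE simp: power2_eq_square)
  show "0 < e t" for t using eps nz by (simp add: e_def)
  show "e t \<le> \<epsilon>" for t using eps E[of t] by (simp add: e_def field_simps)
  show "e' t \<le> \<theta> * e t" for t
  proof -
    have "e' t = \<theta> * e t * (E t / (1 + E t))" by (simp add: e_def e'_def power2_eq_square)
    also have "\<dots> \<le> \<theta> * e t * 1"
      using \<open>0 < e t\<close> th E[of t] nz[of t] by (intro mult_left_mono) (auto simp: field_simps)
    finally show ?thesis by simp
  qed
  show "e t \<le> \<epsilon> / Q" if "t \<le> T" for t
  proof -
    have "1 \<le> exp (- \<theta> * (t - T))" using that th by (simp add: mult_nonneg_nonpos)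
    then have "Q * 1 \<le> E t" unfolding E_def using Q by (intro mult_left_mono) auto
    then show ?thesis using eps Q unfolding e_def by (intro frac_le) auto
  qed
  show "(1 - \<theta> * h) * e t \<le> e (t - h)" if h: "0 \<le> h" for t h
  proof -
    have "E (t - h) = exp (\<theta> * h) * E t" by (simp add: E_def mult_exp_exp algebra_simps)
    moreover have "1 \<le> exp (\<theta> * h)" using h th by simp
    ultimately have "1 + E (t - h) \<le> exp (\<theta> * h) * (1 + E t)" by (simp add: algebra_simps)
    then have "\<epsilon> / (exp (\<theta> * h) * (1 + E t)) \<le> e (t - h)"
      unfolding e_def using eps nz by (intro divide_left_mono) auto
    moreover have "\<epsilon> / (exp (\<theta> * h) * (1 + E t)) = exp (- (\<theta> * h)) * e t"
      by (simp add: e_def exp_minus field_simps)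
    moreover have "(1 - \<theta> * h) * e t \<le> exp (- (\<theta> * h)) * e t"
      using exp_ge_add_one_self[of "- (\<theta> * h)"] \<open>0 < e t\<close> by (intro mult_right_mono) auto
    ultimately show ?thesis by linarith
  qed
  show "\<epsilon> / 2 \<le> e t" if t: "T + Q / \<theta> \<le> t" for t
  proof -
    \<comment> \<open>The waiting time Q / \<theta> comes from x \<le> exp x for x = \<theta> (t -
      T): once x \<ge> Q, the denominator of \<open>e\<close> is at most 2.\<close>
    have "Q \<le> \<theta> * (t - T)" using t th by (simp add: field_simps)
    also have "\<dots> \<le> exp (\<theta> * (t - T))" using exp_ge_add_one_self[of "\<theta> * (t - T)"] by linarith
    finally have "Q * exp (- \<theta> * (t - T)) \<le> exp (\<theta> * (t - T)) * exp (- \<theta> * (t - T))"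
      by (intro mult_right_mono) auto
    then have "E t \<le> 1" by (simp add: E_def mult_exp_exp)
    then show ?thesis unfolding e_def using eps nz[of t] by (intro divide_left_mono) auto
  qed
qed

context nicholson_hull
begin

section \<open>Averaged birth rates and the strict subsolution\<close>

definition max_delay :: real where "max_delay = (\<Sum>i\<in>UNIV. \<tau> i)"

lemma delay_le_max: "\<tau> i \<le> max_delay"
  unfolding max_delay_def by (rule member_le_sum) (simp_all add: tau less_imp_le)

lemma max_delay_pos: "0 < max_delay"
  using tau[of undefined] delay_le_max[of undefined] by (rule less_le_trans)

text \<open>\<open>A\<close> integrates the birth rate against the weight exp (- C (t - s)). The
  rate itself may come arbitrarily close to 0, but it is bounded below on recurring windows, so the
  weighted integral is eventually at least a fixed \<open>b\<close>. It is at most 1 because the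
  rate is at most \<open>C\<close>.\<close>

lemma accumulated_birth:
  obtains A b T where "b > 0" "T \<ge> 0"
    "\<And>i t. 0 \<le> t \<Longrightarrow> (A i has_real_derivative - C * A i t + bC (p t) i) (at t within {0..})"
    "\<And>i t. 0 \<le> t \<Longrightarrow> A i t \<le> 1" "\<And>i t. T \<le> t \<Longrightarrow> b \<le> A i t"
proof -
  define A where "A = (\<lambda>i t. exp (- C * t) * integral {0..t} (\<lambda>s. exp (C * s) * bC (p s) i))"
  have cont: "continuous_on {0..} (\<lambda>s. exp (C * s) * bC (p s) i)" for i
    by (intro continuous_intros hull_cont[OF p_in_hull])
  have dA: "(A i has_real_derivative - C * A i t + bC (p t) i) (at t within {0..})" if t: "0 \<le> t" for i t
  proof -
    have "((\<lambda>t. integral {0..t} (\<lambda>s. exp (C * s) * bC (p s) i)) has_real_derivative exp (C * t) * bC (p t) i)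
        (at t within {0..})"
      using integral_has_vector_derivative_atLeast[OF cont t]
      by (simp add: has_real_derivative_iff_has_vector_derivative)
    then have "(A i has_real_derivative
        (- C * exp (- C * t)) * integral {0..t} (\<lambda>s. exp (C * s) * bC (p s) i) +
        exp (C * t) * bC (p t) i * exp (- C * t)) (at t within {0..})"
      unfolding A_def by (intro DERIV_mult) (auto intro!: derivative_eq_intros)
    moreover have "(- C * exp (- C * t)) * integral {0..t} (\<lambda>s. exp (C * s) * bC (p s) i) +
        exp (C * t) * bC (p t) i * exp (- C * t) = - C * A i t + bC (p t) i"
      by (simp add: A_def exp_minus)
    ultimately show ?thesis by (rule DERIV_cong)
  qed
  have nn: "0 \<le> A i t" if "0 \<le> t" for i t
    unfolding A_def
    by (intro mult_nonneg_nonneg Henstock_Kurzweil_Integration.integral_nonneg integrable_continuous_real continuous_on_subset[OF cont])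
      (use p_bounds(3) in auto)
  have le: "A i t \<le> 1" if t: "0 \<le> t" for i t
  proof -
    have "A i t \<le> exp (- C * (t - 0)) * A i 0 + C / C * (1 - exp (- C * (t - 0)))"
    proof (rule linear_upper_bound[OF C_pos t, where f' = "\<lambda>t. - C * A i t + bC (p t) i"])
      fix r assume r: "0 \<le> r" "r \<le> t"
      show "(A i has_real_derivative - C * A i r + bC (p r) i) (at r within {0..t})"
        by (rule DERIV_subset[OF dA[OF r(1)]]) auto
      show "- C * A i r + bC (p r) i \<le> - C * A i r + C" using p_bounds(3)[OF r(1)] by simp
    qed
    moreover have "A i 0 = 0" by (simp add: A_def)
    ultimately have "A i t \<le> 1 - exp (- C * t)" using C_pos by simp
    then show ?thesis using exp_ge_zero[of "- C * t"] by linarith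
  qed
  define \<delta> where "\<delta> = Min (range (bC (p 0))) / 2"
  have "Min (range (bC (p 0))) \<in> range (bC (p 0))" by (intro Min_in) auto
  then have d: "\<delta> > 0" using p_birth by (auto simp: \<delta>_def)
  have dl: "\<delta> < bC (p 0) i" for i
  proof -
    have "Min (range (bC (p 0))) \<le> bC (p 0) i" by (intro Min_le) auto
    then show ?thesis using d unfolding \<delta>_def by linarith
  qed
  have "open (\<Inter>i. {z :: 'n coeffs. \<delta> < bC z i})"
    by (intro open_INT open_Collect_less continuous_intros ballI) auto
  moreover have "p 0 \<in> (\<Inter>i. {z. \<delta> < bC z i})" using dl by auto
  ultimately obtain h L where hL: "h > 0" "L > 0"
    "\<And>\<omega> t. \<omega> \<in> \<Omega> \<Longrightarrow> \<exists>s\<ge>t. s + h \<le> t + L \<and> (\<forall>r\<in>{s..s+h}. \<omega> r \<in> (\<Inter>i. {z. \<delta> < bC z i}))"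
    by (rule recurrence) blast
  define b where "b = exp (- C * L) * (\<delta> / C * (1 - exp (- C * h)))"
  have b: "b > 0" using d C_pos hL by (simp add: b_def)
  have low: "b \<le> A i t" if t: "L \<le> t" for i t
    unfolding b_def
  proof (rule recurrent_source_lower_bound[OF C_pos _ hL(1,2), where T = 0 and f = "A i" and t = t and \<delta> = \<delta>
        and f' = "\<lambda>t. - C * A i t + bC (p t) i" and b = "\<lambda>t. bC (p t) i"])
    fix t :: real
    obtain s where "s \<ge> t" "s + h \<le> t + L" "\<forall>r\<in>{s..s+h}. p r \<in> (\<Inter>i. {z. \<delta> < bC z i})"
      using hL(3)[OF p_in_hull, of t] by blast
    then show "\<exists>s\<ge>t. s + h \<le> t + L \<and> (\<forall>r\<in>{s..s+h}. \<delta> \<le> bC (p r) i)"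
      by (intro exI[of _ s]) (auto intro: order_less_imp_le)
  qed (use d t dA nn p_bounds(3) in auto)
  show ?thesis by (rule that[OF b order_less_imp_le[OF hL(2)] dA le low])
qed

text \<open>A persistent solution \<open>w\<close> is a subsolution of the linear system in which the birth rate is
  multiplied by \<open>exp (- c0 m)\<close>. Relaxing the factor to \<open>exp (- c0 m / 2)\<close> gives a gain
  proportional to \<open>\<beta>\<close>, which may vanish at times; the summand \<open>q (A - b)\<close> added to \<open>w\<close> averages it
  into a gain \<open>\<zeta>\<close> that is uniform in time and hence survives small perturbations of the coefficients.\<close>

lemma strict_subsolution:
  assumes \<phi>: "\<phi> \<in> phase_cone \<tau>" and m: "m > 0" and T0: "T0 \<ge> 0"
    and lower: "\<forall>t\<ge>T0. \<forall>i\<in>K. m \<le> family_sol \<tau> p \<phi> i t"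
    and zero: "\<forall>t\<ge>0. \<forall>i\<in>-K. family_sol \<tau> p \<phi> i t = 0"
  obtains W W' B \<zeta> T where "B > 0" "\<zeta> > 0" "T \<ge> 0"
    "\<And>i t. i \<in> K \<Longrightarrow> T \<le> t \<Longrightarrow> m \<le> W i t \<and> W i t \<le> B"
    "\<And>i t. i \<in> K \<Longrightarrow> T \<le> t \<Longrightarrow> (W i has_real_derivative W' i t) (at t within {0..})"
    "\<And>i t. i \<in> K \<Longrightarrow> T \<le> t \<Longrightarrow> T \<le> t - \<tau> i \<Longrightarrow> W' i t \<le> - dC (p t) i * W i t +
        (\<Sum>j\<in>K. aC (p t) i j * W j t) + bC (p t) i * (exp (- (c0 * m / 2)) * W i (t - \<tau> i)) - \<zeta>"
proof -
  define w where "w = family_sol \<tau> p \<phi>"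
  define \<kappa>' where "\<kappa>' = exp (- (c0 * m / 2))"
  define \<kappa> where "\<kappa> = exp (- (c0 * m))"
  \<comment> \<open>For w \<ge> m the relaxation from \<kappa> to \<kappa>' gains at least q times
    the birth rate, which is exactly the source that enters \<open>x'\<close>.\<close>
  define q where "q = (\<kappa>' - \<kappa>) * m"
  have kk: "0 < \<kappa>" "\<kappa> < \<kappa>'" "\<kappa>' \<le> 1" using m c0 by (auto simp: \<kappa>_def \<kappa>'_def)
  have q: "q > 0" using kk m by (simp add: q_def)
  obtain M where "M > 0" and ub: "\<And>\<omega> \<phi>. \<omega> \<in> \<Omega> \<Longrightarrow> \<phi> \<in> phase_cone \<tau> \<Longrightarrow>
      \<exists>T\<ge>0. \<forall>t\<ge>T. \<forall>i. family_sol \<tau> \<omega> \<phi> i t \<le> M"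
    using ultimate_bound by blast
  obtain T1 where T1: "\<And>t i. T1 \<le> t \<Longrightarrow> w i t \<le> M" using ub[OF p_in_hull \<phi>] unfolding w_def by blast
  obtain A b TA where b: "b > 0" "TA \<ge> 0"
    and dA: "\<And>i t. 0 \<le> t \<Longrightarrow> (A i has_real_derivative - C * A i t + bC (p t) i) (at t within {0..})"
    and A: "\<And>i t. 0 \<le> t \<Longrightarrow> A i t \<le> 1" "\<And>i t. TA \<le> t \<Longrightarrow> b \<le> A i t"
    by (rule accumulated_birth) (rule that)
  define T where "T = max T0 (max T1 TA)"
  have T: "T0 \<le> T" "T1 \<le> T" "TA \<le> T" "0 \<le> T" using b by (auto simp: T_def)
  \<comment> \<open>With \<open>b\<close> subtracted, \<open>x\<close> is still nonnegative beyond
    \<open>TA\<close>, and the equation for \<open>A\<close> becomes x' = - C x - q C b + q \<beta>.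
    Its constant term is the uniform gain.\<close>
  define x where "x = (\<lambda>i t. q * (A i t - b))"
  define W where "W = (\<lambda>i t. w i t + x i t)"
  define x' where "x' = (\<lambda>i t. q * (- C * A i t + bC (p t) i))"
  define W' where "W' = (\<lambda>i t. vector_field \<tau> p w i t + x' i t)"
  have x: "0 \<le> x i t" "x i t \<le> q" if t: "T \<le> t" for i t
  proof -
    have "b \<le> A i t" "A i t \<le> 1" using A t T by auto
    then show "0 \<le> x i t" "x i t \<le> q" using q b by (auto simp: x_def mult_le_cancel_left1)
  qed
  have wb: "m \<le> w i t" "w i t \<le> M" if "T \<le> t" "i \<in> K" for i t
    using that lower T1 T by (auto simp: w_def)
  have "M + q > 0" using \<open>M > 0\<close> q by simp
  moreover have "q * C * b > 0" using q C_pos b by simp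
  moreover have "T \<ge> 0" by (rule T)
  moreover have "m \<le> W i t \<and> W i t \<le> M + q" if "i \<in> K" "T \<le> t" for i t
    using wb[OF that(2,1)] x[OF that(2), of i] by (auto simp: W_def)
  moreover have "(W i has_real_derivative W' i t) (at t within {0..})" if "i \<in> K" "T \<le> t" for i t
  proof -
    have t: "0 \<le> t" using that T by simp
    have "(x i has_real_derivative x' i t) (at t within {0..})"
      unfolding x_def x'_def by (auto intro!: derivative_eq_intros dA[OF t])
    then show ?thesis
      unfolding W_def W'_def w_def by (intro DERIV_add sol_deriv[OF p_in_hull \<phi> t])
  qed
  moreover have "W' i t \<le> - dC (p t) i * W i t + (\<Sum>j\<in>K. aC (p t) i j * W j t) +
      bC (p t) i * (\<kappa>' * W i (t - \<tau> i)) - q * C * b"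
    if i: "i \<in> K" and t: "T \<le> t" "T \<le> t - \<tau> i" for i t
  proof -
    define y where "y = w i (t - \<tau> i)"
    have t0: "0 \<le> t" using t T by simp
    have y: "m \<le> y" using wb[OF t(2) i] by (simp add: y_def)
    have ci: "c0 \<le> cC (p t) i" and bi: "0 \<le> bC (p t) i" using p_bounds(3,4)[OF t0, of i] by auto
    have "(\<Sum>j\<in>UNIV. aC (p t) i j * w j t) = (\<Sum>j\<in>K. aC (p t) i j * w j t)"
      by (rule sum.mono_neutral_right) (use zero t0 in \<open>auto simp: w_def\<close>)
    also have "\<dots> \<le> (\<Sum>j\<in>K. aC (p t) i j * W j t)"
      using p_bounds(2)[OF t0] x[OF t(1)] by (intro sum_mono mult_left_mono) (auto simp: W_def)
    finally have 1: "(\<Sum>j\<in>UNIV. aC (p t) i j * w j t) \<le> (\<Sum>j\<in>K. aC (p t) i j * W j t)" .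
    have "c0 * m \<le> cC (p t) i * y" using ci y c0 m by (intro mult_mono) auto
    then have "y * exp (- cC (p t) i * y) \<le> y * \<kappa>" using y m by (intro mult_left_mono) (auto simp: \<kappa>_def)
    also have "\<dots> = \<kappa>' * y - (\<kappa>' - \<kappa>) * y" by (simp add: algebra_simps)
    also have "\<dots> \<le> \<kappa>' * y - q" unfolding q_def using kk y by simp
    also have "\<dots> \<le> \<kappa>' * W i (t - \<tau> i) - q"
      using x[OF t(2), of i] kk by (simp add: W_def y_def)
    finally have "bC (p t) i * (y * exp (- cC (p t) i * y)) \<le> bC (p t) i * (\<kappa>' * W i (t - \<tau> i) - q)"
      using bi by (rule mult_left_mono)
    then have 2: "bC (p t) i * y * exp (- cC (p t) i * y) \<le> bC (p t) i * (\<kappa>' * W i (t - \<tau> i)) - bC (p t) i * q"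
      by (simp add: algebra_simps)
    have "dC (p t) i * x i t \<le> C * x i t" using p_bounds(1)[OF t0, of i] x[OF t(1), of i] by (intro mult_right_mono) auto
    moreover have "x' i t = - (C * x i t) - q * C * b + bC (p t) i * q" by (simp add: x'_def x_def algebra_simps)
    ultimately have 3: "x' i t \<le> - (dC (p t) i * x i t) - q * C * b + bC (p t) i * q" by linarith
    have "- dC (p t) i * W i t = - dC (p t) i * w i t - dC (p t) i * x i t" by (simp add: W_def algebra_simps)
    then show ?thesis using 1 2 3 unfolding W'_def vector_field_def y_def by linarith
  qed
  ultimately show ?thesis by (rule that[folded \<kappa>'_def])
qed

text \<open>The comparison function is e U, with \<open>U\<close> a translate of the strict
  subsolution matched to \<omega> and \<open>e\<close> a logistic curve. Half of the gain \<zeta>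
  absorbs the exchange of the coefficients of \<open>p\<close> for those of \<omega>; the other half
  absorbs the growth of \<open>e\<close> and its lag over the delay. The bound \<epsilon> m / 2 is
  fixed before \<omega> and the solution are chosen.\<close>

lemma persistence_transfers_to_hull:
  assumes \<phi>: "\<phi> \<in> phase_cone \<tau>" and m: "m > 0" and T0: "T0 \<ge> 0"
    and lower: "\<forall>t\<ge>T0. \<forall>i\<in>K. m \<le> family_sol \<tau> p \<phi> i t"
    and zero: "\<forall>t\<ge>0. \<forall>i\<in>-K. family_sol \<tau> p \<phi> i t = 0"
  shows "\<exists>\<mu>>0. \<forall>\<omega>\<in>\<Omega>. \<forall>\<phi>\<in>phase_cone \<tau>. \<forall>T\<ge>0. (\<forall>i\<in>K. 0 < family_sol \<tau> \<omega> \<phi> i T) \<longrightarrow>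
    (\<exists>t0\<ge>0. \<forall>t\<ge>t0. \<forall>i\<in>K. \<mu> \<le> family_sol \<tau> \<omega> \<phi> i t)"
proof -
  \<comment> \<open>Chosen so that C \<eta>0 = c0 m / 2: the factor in
    \<open>ricker_ge_truncation\<close> is then exactly the relaxed factor \<kappa>.\<close>
  define \<eta>0 where "\<eta>0 = c0 * m / (2 * C)"
  define \<kappa> where "\<kappa> = exp (- (c0 * m / 2))"
  have eta0: "\<eta>0 > 0" using c0 m C_pos by (simp add: \<eta>0_def)
  have \<kappa>: "0 < \<kappa>" "\<kappa> \<le> 1" "\<kappa> = exp (- C * \<eta>0)" using c0 m C_pos by (auto simp: \<kappa>_def \<eta>0_def)
  obtain M where M: "M > 0" and ub: "\<And>\<omega> \<phi>. \<omega> \<in> \<Omega> \<Longrightarrow> \<phi> \<in> phase_cone \<tau> \<Longrightarrow>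
      \<exists>T\<ge>0. \<forall>t\<ge>T. \<forall>i. family_sol \<tau> \<omega> \<phi> i t \<le> M"
    using ultimate_bound by blast
  define \<eta> where "\<eta> = \<eta>0 * exp (- C * M)"
  have eta: "\<eta> > 0" using eta0 by (simp add: \<eta>_def)
  obtain W W' B \<zeta> T1 where B: "B > 0" and \<zeta>: "\<zeta> > 0" and T1: "T1 \<ge> 0"
    and W: "\<And>i t. i \<in> K \<Longrightarrow> T1 \<le> t \<Longrightarrow> m \<le> W i t \<and> W i t \<le> B"
    and dW: "\<And>i t. i \<in> K \<Longrightarrow> T1 \<le> t \<Longrightarrow> (W i has_real_derivative W' i t) (at t within {0..})"
    and W': "\<And>i t. i \<in> K \<Longrightarrow> T1 \<le> t \<Longrightarrow> T1 \<le> t - \<tau> i \<Longrightarrow> W' i t \<le> - dC (p t) i * W i t +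
        (\<Sum>j\<in>K. aC (p t) i j * W j t) + bC (p t) i * (\<kappa> * W i (t - \<tau> i)) - \<zeta>"
    by (rule strict_subsolution[OF \<phi> m T0 lower zero, folded \<kappa>_def]) (rule that)
  \<comment> \<open>As W \<le> B, a multiple of \<open>W\<close> by at most \<epsilon> stays below
    the truncation level \<eta>.\<close>
  define \<epsilon> where "\<epsilon> = \<eta> / B"
  have eps: "\<epsilon> > 0" using eta B by (simp add: \<epsilon>_def)
  \<comment> \<open>With X = e B, growth of \<open>e\<close> costs at most \<theta> X and its lag in
    the birth term at most C \<theta> \<open>max_delay\<close> X. The choice of \<theta> makes the
    sum equal to e \<zeta> / 2.\<close>
  define G where "G = 1 + C * max_delay"
  have G: "G > 0" using C_pos max_delay_pos by (simp add: G_def add_pos_pos)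
  define \<theta> where "\<theta> = \<zeta> / (2 * B * G)"
  have th: "\<theta> > 0" "\<theta> * B * G = \<zeta> / 2" using \<zeta> B G by (auto simp: \<theta>_def)
  \<comment> \<open>Each perturbed coefficient costs at most z B: at most \<open>CARD('n)\<close>
    couplings, the decay and the birth rate. Together they cost at most \<zeta> / 2.\<close>
  define N where "N = real CARD('n) + 2"
  define z where "z = \<zeta> / (2 * N * B)"
  have N: "N > 0" by (simp add: N_def)
  have z: "z > 0" "N * (z * B) = \<zeta> / 2" using \<zeta> B N by (auto simp: z_def)
  have "\<exists>t0\<ge>0. \<forall>t\<ge>t0. \<forall>i\<in>K. \<epsilon> / 2 * m \<le> family_sol \<tau> \<omega> \<phi> i t"
    if w: "\<omega> \<in> \<Omega>" and \<phi>: "\<phi> \<in> phase_cone \<tau>" and T: "T \<ge> 0" "\<forall>i\<in>K. 0 < family_sol \<tau> \<omega> \<phi> i T" for \<omega> \<phi> T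
  proof -
    define y where "y = family_sol \<tau> \<omega> \<phi>"
    have ynn: "0 \<le> y i t" if "- \<tau> i \<le> t" for i t
      unfolding y_def by (rule sol_nonneg[OF w \<phi> that])
    \<comment> \<open>The extra \<open>max_delay\<close> keeps the delayed arguments of
      \<open>W\<close> beyond T1 as well.\<close>
    obtain s where s: "s \<ge> T1 + max_delay" "\<And>t. dist (p (s + t)) (\<omega> t) < z"
      using hull_uniform_approx[OF p_cont p_ap w z(1)] by blast
    define U where "U = (\<lambda>i t. W i (s + t))"
    define U' where "U' = (\<lambda>i t. W' i (s + t))"
    have sT: "T1 \<le> s + t" if "- \<tau> i \<le> t" for i t using s that delay_le_max[of i] by linarith
    have U: "m \<le> U i t" "U i t \<le> B" if "i \<in> K" "- \<tau> i \<le> t" for i t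
      using W[OF that(1) sT[OF that(2)]] by (auto simp: U_def)
    have dU: "(U i has_real_derivative U' i t) (at t within {a..})" if "i \<in> K" "0 \<le> a" "a \<le> t" for i t a
    proof -
      have "(W i has_real_derivative W' i (s + t)) (at (s + t) within (+) s ` {a..})"
        by (rule DERIV_subset[OF dW[OF that(1)]]) (use s T1 max_delay_pos that in auto)
      then have "(W i \<circ> (+) s has_real_derivative W' i (s + t) * 1) (at t within {a..})"
        by (rule DERIV_image_chain) (auto intro!: derivative_eq_intros)
      then show ?thesis by (simp add: U_def U'_def o_def)
    qed
    have U': "U' i t \<le> - dC (\<omega> t) i * U i t + (\<Sum>j\<in>K. aC (\<omega> t) i j * U j t) +
        bC (\<omega> t) i * (\<kappa> * U i (t - \<tau> i)) - \<zeta> / 2" if i: "i \<in> K" and t: "0 \<le> t" for i t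
    proof -
      have close: "\<bar>dC (p (s + t)) i - dC (\<omega> t) i\<bar> \<le> z" "\<bar>aC (p (s + t)) i j - aC (\<omega> t) i j\<bar> \<le> z"
        "\<bar>bC (p (s + t)) i - bC (\<omega> t) i\<bar> \<le> z" for j
        by (rule order_trans[OF coeff_dist_le(1) less_imp_le[OF s(2)]]
              order_trans[OF coeff_dist_le(2) less_imp_le[OF s(2)]]
              order_trans[OF coeff_dist_le(3) less_imp_le[OF s(2)]])+
      have Ut: "0 \<le> U j t" "U j t \<le> B" if "j \<in> K" for j
        using U[OF that, of t] m t tau[of j] by auto
      have Ud: "0 \<le> U i (t - \<tau> i)" "U i (t - \<tau> i) \<le> B" using U[OF i, of "t - \<tau> i"] m t by auto
      have pert: "u * v \<le> u' * v + z * B" if "\<bar>u - u'\<bar> \<le> z" "0 \<le> v" "v \<le> B" for u u' v :: real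
      proof -
        have "(u - u') * v \<le> z * B" using that z by (intro mult_mono) auto
        then show ?thesis by (simp add: algebra_simps)
      qed
      have 1: "- dC (p (s + t)) i * U i t \<le> - dC (\<omega> t) i * U i t + z * B"
        by (rule pert) (use close(1) Ut[OF i] in auto)
      have "(\<Sum>j\<in>K. aC (p (s + t)) i j * U j t) \<le> (\<Sum>j\<in>K. aC (\<omega> t) i j * U j t + z * B)"
        by (intro sum_mono pert close Ut)
      also have "\<dots> = (\<Sum>j\<in>K. aC (\<omega> t) i j * U j t) + real (card K) * (z * B)" by (simp add: sum.distrib)
      also have "real (card K) * (z * B) \<le> real CARD('n) * (z * B)"
        using z B by (intro mult_right_mono) (auto intro: card_mono)
      finally have 2: "(\<Sum>j\<in>K. aC (p (s + t)) i j * U j t) \<le> (\<Sum>j\<in>K. aC (\<omega> t) i j * U j t) + real CARD('n) * (z * B)"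
        by simp
      have "\<kappa> * U i (t - \<tau> i) \<le> 1 * B" using \<kappa> Ud B by (intro mult_mono) auto
      then have 3: "bC (p (s + t)) i * (\<kappa> * U i (t - \<tau> i)) \<le> bC (\<omega> t) i * (\<kappa> * U i (t - \<tau> i)) + z * B"
        by (intro pert close) (use \<kappa> Ud in auto)
      have "N * (z * B) = real CARD('n) * (z * B) + z * B + z * B" by (simp add: N_def algebra_simps)
      moreover have "U' i t \<le> - dC (p (s + t)) i * U i t + (\<Sum>j\<in>K. aC (p (s + t)) i j * U j t) +
          bC (p (s + t)) i * (\<kappa> * U i (t - \<tau> i)) - \<zeta>"
        using W'[OF i, of "s + t"] s(1) t delay_le_max[of i] max_delay_pos
        by (simp add: U_def U'_def add_diff_eq)
      ultimately show ?thesis using 1 2 3 z(2) by linarith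
    qed
    obtain T2 where T2: "T2 \<ge> T" "\<And>t i. T2 \<le> t \<Longrightarrow> y i t \<le> M"
      using ub[OF w \<phi>] unfolding y_def by (meson max.bounded_iff max.cobounded1)
    \<comment> \<open>Bounds all components in \<open>K\<close> from below on [T2, T2 + max_delay],
      which contains the initial intervals of the comparison. The inserted 1 keeps the minimum
      meaningful for empty \<open>K\<close>.\<close>
    define l where "l = exp (- C * max_delay) * Min (insert 1 ((\<lambda>i. y i T2) ` K))"
    have ypos: "0 < y i T2" if "i \<in> K" for i
      unfolding y_def by (rule sol_pos[OF w \<phi> T(1) T2(1)]) (use that T(2) in auto)
    have l: "l > 0" using ypos by (auto simp: l_def)
    have yl: "l \<le> y i t" if i: "i \<in> K" and t: "T2 \<le> t" "t \<le> T2 + max_delay" for i t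
    proof -
      have "l \<le> exp (- C * (t - T2)) * y i T2"
        unfolding l_def using i t C_pos by (intro mult_mono) (auto intro: Min_le less_imp_le ypos)
      then show ?thesis using sol_decay[OF w \<phi>, of T2 t i] T T2 t by (simp add: y_def)
    qed
    define T3 where "T3 = T2 + max_delay"
    have T3: "0 \<le> T3" "\<And>i. T2 \<le> T3 - \<tau> i" using T T2 max_delay_pos delay_le_max by (auto simp: T3_def)
    \<comment> \<open>With Q = \<eta> / l the curve satisfies e \<le> \<epsilon> / Q = l / B up to
      T3, so e U \<le> l \<le> y on the initial intervals.\<close>
    have Q: "\<eta> / l > 0" using eta l by simp
    obtain e e' where de: "\<And>t S. (e has_real_derivative e' t) (at t within S)"
      and e: "\<And>t. e' t \<le> \<theta> * e t" "\<And>t. 0 < e t" "\<And>t. e t \<le> \<epsilon>" "\<And>t. t \<le> T3 \<Longrightarrow> e t \<le> \<epsilon> / (\<eta> / l)"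
        "\<And>t h. 0 \<le> h \<Longrightarrow> (1 - \<theta> * h) * e t \<le> e (t - h)"
        "\<And>t. T3 + \<eta> / l / \<theta> \<le> t \<Longrightarrow> \<epsilon> / 2 \<le> e t"
      by (rule logistic_growth[OF eps Q th(1), of T3]) (rule that)
    define v where "v = (\<lambda>i t. y i t - e t * U i t)"
    define v' where "v' = (\<lambda>i t. vector_field \<tau> \<omega> y i t - (e' t * U i t + U' i t * e t))"
    have "0 \<le> v i t" if i: "i \<in> K" and t: "T3 \<le> t" for i t
    proof (rule delay_cooperative_nonneg[where I = K and T = T3 and v = v and v' = v' and \<tau> = \<tau> and C = C
          and D = "\<lambda>i t. dC (\<omega> t) i" and A = "\<lambda>i j t. aC (\<omega> t) i j"])
      fix i t assume i: "i \<in> K" and t: "T3 \<le> t"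
      have t0: "0 \<le> t" using t T3 by simp
      show "(v i has_real_derivative v' i t) (at t within {T3..})"
        unfolding v_def v'_def
      proof (intro DERIV_diff DERIV_mult de dU[OF i T3(1) t])
        show "(y i has_real_derivative vector_field \<tau> \<omega> y i t) (at t within {T3..})"
          unfolding y_def by (rule sol_deriv_subset[OF w \<phi> t0]) (use T3 in auto)
      qed
      show "\<bar>dC (\<omega> t) i\<bar> \<le> C" using hull_bounds(1)[OF w, of t i] by auto
      assume "\<And>j. j \<in> K \<Longrightarrow> 0 \<le> v j (t - \<tau> j)"
      from this[OF i] have vd: "e (t - \<tau> i) * U i (t - \<tau> i) \<le> y i (t - \<tau> i)" by (simp add: v_def)
      define X where "X = e t * B"
      have X: "X > 0" using e(2) B by (simp add: X_def)
      have td: "T2 \<le> t - \<tau> i" using t T3(2)[of i] by linarith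
      have Ud: "0 \<le> U i (t - \<tau> i)" "U i (t - \<tau> i) \<le> B" using U[OF i, of "t - \<tau> i"] m t0 by auto
      have Ut: "0 \<le> U i t" "U i t \<le> B" using U[OF i, of t] m t0 tau[of i] by auto
      have bi: "0 \<le> bC (\<omega> t) i" "bC (\<omega> t) i \<le> C" using hull_bounds(3)[OF w, of t i] by auto
      have ci: "0 \<le> cC (\<omega> t) i" "cC (\<omega> t) i \<le> C" using hull_bounds(4)[OF w, of t i] c0 by auto
      have yd: "0 \<le> y i (t - \<tau> i)" "y i (t - \<tau> i) \<le> M" using ynn[of i "t - \<tau> i"] t0 T2(2)[OF td] by auto
      have "e (t - \<tau> i) * U i (t - \<tau> i) \<le> \<epsilon> * B"
        using e(2)[of "t - \<tau> i"] e(3)[of "t - \<tau> i"] Ud eps by (intro mult_mono) auto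
      also have "\<epsilon> * B = \<eta>" using B by (simp add: \<epsilon>_def)
      finally have "e (t - \<tau> i) * U i (t - \<tau> i) \<le> min (y i (t - \<tau> i)) \<eta>" using vd by simp
      \<comment> \<open>Exchanges the delayed value of \<open>e\<close> for the present one; the
        estimate that follows bounds the loss by \<theta> \<open>max_delay\<close> X.\<close>
      moreover have "(1 - \<theta> * \<tau> i) * e t * U i (t - \<tau> i) \<le> e (t - \<tau> i) * U i (t - \<tau> i)"
        using e(5)[of "\<tau> i" t] tau[of i] Ud by (intro mult_right_mono) auto
      moreover have "\<theta> * \<tau> i * e t * U i (t - \<tau> i) \<le> \<theta> * max_delay * e t * B"
        using delay_le_max[of i] tau[of i] th(1) e(2)[of t] Ud by (intro mult_mono) auto
      ultimately have "e t * U i (t - \<tau> i) - \<theta> * max_delay * X \<le> min (y i (t - \<tau> i)) \<eta>"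
        by (simp add: X_def algebra_simps)
      then have "\<kappa> * (e t * U i (t - \<tau> i) - \<theta> * max_delay * X) \<le> \<kappa> * min (y i (t - \<tau> i)) \<eta>"
        using \<kappa> by (intro mult_left_mono) auto
      also have "\<dots> \<le> y i (t - \<tau> i) * exp (- cC (\<omega> t) i * y i (t - \<tau> i))"
        unfolding \<kappa>(3) \<eta>_def using yd ci eta0 by (intro ricker_ge_truncation) auto
      finally have "bC (\<omega> t) i * (\<kappa> * (e t * U i (t - \<tau> i) - \<theta> * max_delay * X)) \<le>
          bC (\<omega> t) i * (y i (t - \<tau> i) * exp (- cC (\<omega> t) i * y i (t - \<tau> i)))"
        using bi by (intro mult_left_mono) auto
      moreover have "bC (\<omega> t) i * \<kappa> * (\<theta> * max_delay * X) \<le> C * 1 * (\<theta> * max_delay * X)"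
        using bi \<kappa> th X max_delay_pos C_pos by (intro mult_mono) auto
      ultimately have 1: "bC (\<omega> t) i * (\<kappa> * U i (t - \<tau> i)) * e t - C * (\<theta> * max_delay * X) \<le>
          bC (\<omega> t) i * y i (t - \<tau> i) * exp (- cC (\<omega> t) i * y i (t - \<tau> i))"
        by (simp add: algebra_simps)
      have "e' t * U i t \<le> \<theta> * e t * U i t" using e(1)[of t] Ut by (intro mult_right_mono) auto
      also have "\<dots> \<le> \<theta> * e t * B" using th(1) e(2)[of t] Ut by (intro mult_left_mono) auto
      finally have 2: "e' t * U i t \<le> \<theta> * X" by (simp add: X_def mult.assoc)
      have "U' i t * e t \<le> (- dC (\<omega> t) i * U i t + (\<Sum>j\<in>K. aC (\<omega> t) i j * U j t) +
        bC (\<omega> t) i * (\<kappa> * U i (t - \<tau> i)) - \<zeta> / 2) * e t"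
        using U'[OF i t0] e(2)[of t] by (intro mult_right_mono) auto
      also have "\<dots> = - dC (\<omega> t) i * (e t * U i t) + (\<Sum>j\<in>K. aC (\<omega> t) i j * (e t * U j t)) +
        bC (\<omega> t) i * (\<kappa> * U i (t - \<tau> i)) * e t - \<zeta> / 2 * e t"
        by (simp add: algebra_simps sum_distrib_left)
      finally have 3: "U' i t * e t \<le> - dC (\<omega> t) i * (e t * U i t) + (\<Sum>j\<in>K. aC (\<omega> t) i j * (e t * U j t)) +
        bC (\<omega> t) i * (\<kappa> * U i (t - \<tau> i)) * e t - \<zeta> / 2 * e t" .
      have "\<zeta> / 2 * e t = \<theta> * B * G * e t" by (simp only: th(2))
      also have "\<dots> = \<theta> * X + C * (\<theta> * max_delay * X)" by (simp add: X_def G_def algebra_simps)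
      finally have 4: "\<zeta> / 2 * e t = \<theta> * X + C * (\<theta> * max_delay * X)" .
      have 5: "(\<Sum>j\<in>K. aC (\<omega> t) i j * y j t) \<le> (\<Sum>j\<in>UNIV. aC (\<omega> t) i j * y j t)"
      proof (rule sum_mono2)
        show "0 \<le> aC (\<omega> t) i j * y j t" for j
          using hull_bounds(2)[OF w, of t i j] ynn[of j t] t0 tau[of j] by simp
      qed auto
      have 6: "(\<Sum>j\<in>K. aC (\<omega> t) i j * v j t) =
          (\<Sum>j\<in>K. aC (\<omega> t) i j * y j t) - (\<Sum>j\<in>K. aC (\<omega> t) i j * (e t * U j t))"
        by (simp add: v_def right_diff_distrib sum_subtractf)
      have 7: "- dC (\<omega> t) i * v i t = - dC (\<omega> t) i * y i t - (- dC (\<omega> t) i * (e t * U i t))"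
        by (simp add: v_def algebra_simps)
      show "- dC (\<omega> t) i * v i t + (\<Sum>j\<in>K. aC (\<omega> t) i j * v j t) \<le> v' i t"
        unfolding v'_def vector_field_def using 1 2 3 4 5 6 7 by linarith
    next
      fix i t assume i: "i \<in> K" and t: "T3 - \<tau> i \<le> t" "t \<le> T3"
      have t2: "T2 \<le> t" using T3(2)[of i] t by linarith
      have Ut: "0 \<le> U i t" "U i t \<le> B" using U[OF i, of t] m t2 T T2 tau[of i] by auto
      have "e t * U i t \<le> \<epsilon> / (\<eta> / l) * B"
        using e(4)[OF t(2)] e(2)[of t] Ut by (intro mult_mono) auto
      also have "\<dots> = l" using B eta l by (simp add: \<epsilon>_def)
      also have "l \<le> y i t" by (rule yl[OF i t2]) (use t in \<open>simp add: T3_def\<close>)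
      finally show "0 \<le> v i t" by (simp add: v_def)
    qed (use i t tau C_pos hull_bounds(2)[OF w] in auto)
    then have main: "e t * U i t \<le> y i t" if "i \<in> K" "T3 \<le> t" for i t
      using that by (simp add: v_def)
    have th0: "0 \<le> \<eta> / l / \<theta>" using eta l th by simp
    have "\<epsilon> / 2 * m \<le> y i t" if i: "i \<in> K" and t: "T3 + \<eta> / l / \<theta> \<le> t" for i t
    proof -
      have t3: "T3 \<le> t" using t th0 by linarith
      have "\<epsilon> / 2 * m \<le> e t * U i t"
        using e(6)[OF t] U(1)[OF i, of t] t3 T3(1) tau[of i] eps m e(2)[of t] by (intro mult_mono) auto
      then show ?thesis using main[OF i t3] by linarith
    qed
    then show ?thesis using T3(1) th0 unfolding y_def by (intro exI[of _ "T3 + \<eta> / l / \<theta>"]) auto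
  qed
  moreover have "\<epsilon> / 2 * m > 0" using eps m by simp
  ultimately show ?thesis by blast
qed

end

section \<open>Terminal components and the main theorem\<close>

context nicholson_hull
begin

text \<open>\<open>reach k\<close> is the set of components that \<open>k\<close> eventually feeds; minimal nonempty sets of this form
  (terminal strong components of the coupling graph) are the blocks on which strict persistence is decided.\<close>

definition reach :: "'n \<Rightarrow> 'n set" where
  "reach k = {(j, i). \<exists>t. aC (p t) i j \<noteq> 0}\<^sup>* `` {k}"

definition terminal :: "'n \<Rightarrow> bool" where
  "terminal k \<longleftrightarrow> (\<forall>i\<in>reach k. k \<in> reach i)"

lemma reach_refl: "k \<in> reach k"
  by (simp add: reach_def)

lemma reach_trans: "j \<in> reach k \<Longrightarrow> i \<in> reach j \<Longrightarrow> i \<in> reach k"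
  unfolding reach_def by auto

lemma reach_closed:
  assumes "i \<notin> reach k" "j \<in> reach k"
  shows "aC (p t) i j = 0"
proof (rule ccontr)
  assume "aC (p t) i j \<noteq> 0"
  then have "(j, i) \<in> {(j, i). \<exists>t. aC (p t) i j \<noteq> 0}" by blast
  then have "i \<in> reach k" using assms(2) unfolding reach_def by (auto intro: rtrancl_into_rtrancl)
  then show False using assms(1) by simp
qed

lemma reach_induct [consumes 1, case_names base step]:
  assumes "i \<in> reach k" and "P k"
    and "\<And>i j t. j \<in> reach k \<Longrightarrow> aC (p t) i j \<noteq> 0 \<Longrightarrow> P j \<Longrightarrow> P i"
  shows "P i"
proof -
  have "(k, i) \<in> {(j, i). \<exists>t. aC (p t) i j \<noteq> 0}\<^sup>*" using assms(1) by (simp add: reach_def)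
  then show ?thesis
  proof (induction rule: rtrancl_induct)
    case (step j i)
    then show ?case using assms(3)[of j _ i] by (auto simp: reach_def)
  qed (rule assms(2))
qed

text \<open>Take a reach set of least cardinality inside \<open>reach i\<close>. The sets reached
  from its members are contained in it, hence equal to it, so its starting point can be reached
  back.\<close>

lemma terminal_exists:
  obtains k where "k \<in> reach i" "terminal k"
proof -
  obtain k where k: "k \<in> reach i" and min: "\<And>j. j \<in> reach i \<Longrightarrow> card (reach k) \<le> card (reach j)"
    using ex_has_least_nat[of "\<lambda>k. k \<in> reach i" i "\<lambda>k. card (reach k)"] reach_refl by blast
  have "terminal k"
    unfolding terminal_def
  proof
    fix j assume j: "j \<in> reach k"
    have "reach j \<subseteq> reach k" using reach_trans[OF j] by blast
    moreover have "card (reach k) \<le> card (reach j)" using min reach_trans[OF k j] by blast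
    ultimately have "reach j = reach k" by (intro card_seteq) auto
    then show "k \<in> reach j" using reach_refl by blast
  qed
  then show ?thesis using that k by blast
qed

lemma uniform_time:
  fixes P :: "'n \<Rightarrow> real \<Rightarrow> bool"
  assumes "\<And>i. i \<in> K \<Longrightarrow> \<exists>T\<ge>0. \<forall>t\<ge>T. P i t"
  shows "\<exists>T\<ge>0. \<forall>t\<ge>T. \<forall>i\<in>K. P i t"
proof -
  have "\<forall>i\<in>K. \<exists>T. 0 \<le> T \<and> (\<forall>t\<ge>T. P i t)" using assms by blast
  then obtain T where T: "\<forall>i\<in>K. 0 \<le> T i \<and> (\<forall>t\<ge>T i. P i t)" by (rule bchoice[THEN exE])
  have "T i \<le> (\<Sum>i\<in>K. T i)" if "i \<in> K" for i by (rule member_le_sum) (use T that in auto)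
  moreover have "0 \<le> (\<Sum>i\<in>K. T i)" using T by (intro sum_nonneg) auto
  ultimately show ?thesis using T by (intro exI[of _ "\<Sum>i\<in>K. T i"]) fastforce
qed

lemma positive_on_reach:
  assumes w: "\<omega> \<in> \<Omega>" and \<phi>: "\<phi> \<in> phase_cone \<tau>" and pos: "0 < \<phi> k 0"
  shows "\<exists>T\<ge>0. \<forall>t\<ge>T. \<forall>i\<in>reach k. 0 < family_sol \<tau> \<omega> \<phi> i t"
proof (rule uniform_time)
  fix i assume "i \<in> reach k"
  then have "\<exists>T\<ge>0. 0 < family_sol \<tau> \<omega> \<phi> i T"
  proof (induction rule: reach_induct)
    case base
    show ?case using pos sol_init[OF w \<phi>, of k 0] tau[of k] by (intro exI[of _ 0]) simp
  next
    case (step i j t)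
    then show ?case using positivity_spreads[OF w \<phi>] by blast
  qed
  then show "\<exists>T\<ge>0. \<forall>t\<ge>T. 0 < family_sol \<tau> \<omega> \<phi> i t" using sol_pos[OF w \<phi>] by blast
qed

text \<open>The bound may shrink along every edge of a path from \<open>k\<close>; since there are
  finitely many components, a positive minimum remains.\<close>

lemma lower_bound_on_reach:
  assumes w: "\<omega> \<in> \<Omega>" and \<phi>: "\<phi> \<in> phase_cone \<tau>" and m: "m > 0"
    and k: "\<exists>T\<ge>0. \<forall>t\<ge>T. m \<le> family_sol \<tau> \<omega> \<phi> k t"
  shows "\<exists>m'>0. \<exists>T\<ge>0. \<forall>t\<ge>T. \<forall>i\<in>reach k. m' \<le> family_sol \<tau> \<omega> \<phi> i t"
proof -
  have "\<exists>m'>0. \<exists>T\<ge>0. \<forall>t\<ge>T. m' \<le> family_sol \<tau> \<omega> \<phi> i t" if "i \<in> reach k" for i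
    using that
  proof (induction rule: reach_induct)
    case base
    show ?case using m k by blast
  next
    case (step i j t)
    then obtain m1 where m1: "m1 > 0" "\<exists>T\<ge>0. \<forall>t\<ge>T. m1 \<le> family_sol \<tau> \<omega> \<phi> j t" by blast
    obtain m' where "m' > 0" and "\<forall>\<omega>\<in>\<Omega>. \<forall>\<phi>\<in>phase_cone \<tau>. (\<exists>T\<ge>0. \<forall>t\<ge>T. m1 \<le> family_sol \<tau> \<omega> \<phi> j t) \<longrightarrow>
           (\<exists>T\<ge>0. \<forall>t\<ge>T. m' \<le> family_sol \<tau> \<omega> \<phi> i t)"
      using lower_bound_spreads[OF step(2) m1(1)] by blast
    then show ?case using w \<phi> m1(2) by blast
  qed
  then have "\<forall>i\<in>reach k. \<exists>m'. m' > 0 \<and> (\<exists>T\<ge>0. \<forall>t\<ge>T. m' \<le> family_sol \<tau> \<omega> \<phi> i t)" by blast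
  then obtain f where f: "\<forall>i\<in>reach k. f i > 0 \<and> (\<exists>T\<ge>0. \<forall>t\<ge>T. f i \<le> family_sol \<tau> \<omega> \<phi> i t)"
    by (rule bchoice[THEN exE])
  define m' where "m' = Min (f ` reach k)"
  have "f ` reach k \<noteq> {}" using reach_refl by blast
  then have "m' > 0" using f by (simp add: m'_def)
  moreover have "\<exists>T\<ge>0. \<forall>t\<ge>T. \<forall>i\<in>reach k. m' \<le> family_sol \<tau> \<omega> \<phi> i t"
  proof (rule uniform_time)
    fix i assume i: "i \<in> reach k"
    then have "m' \<le> f i" by (simp add: m'_def)
    then show "\<exists>T\<ge>0. \<forall>t\<ge>T. m' \<le> family_sol \<tau> \<omega> \<phi> i t" using f i by (meson order_trans)
  qed
  ultimately show ?thesis by blast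
qed

section \<open>The order of the phase space and the two equivalences\<close>

lemma constant_history_in_cone: "(\<And>i. 0 \<le> x i) \<Longrightarrow> (\<lambda>i s. x i) \<in> phase_cone \<tau>"
  by (auto simp: phase_cone_def phase_space_def)

lemma phase_spos_imp_cone: "phase_spos \<tau> \<phi> \<Longrightarrow> \<phi> \<in> phase_cone \<tau>"
  by (auto simp: phase_spos_def phase_cone_def intro: less_imp_le)

lemma phase_geD: "phase_ge \<tau> \<phi> \<psi> \<Longrightarrow> s \<in> {- \<tau> i..0} \<Longrightarrow> \<psi> i s \<le> \<phi> i s"
  by (auto simp: phase_ge_def phase_cone_def)

text \<open>Waiting for one more \<open>max_delay\<close> moves the whole history segment beyond
  \<open>T\<close>.\<close>

lemma segment_ge_constant:
  assumes w: "\<omega> \<in> \<Omega>" and \<phi>: "\<phi> \<in> phase_cone \<tau>"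
    and T: "T \<ge> 0" "\<forall>t\<ge>T. \<forall>i. x i \<le> family_sol \<tau> \<omega> \<phi> i t"
  shows "\<exists>t0\<ge>0. \<forall>t\<ge>t0. phase_ge \<tau> (segment (family_sol \<tau> \<omega> \<phi>) t) (\<lambda>i s. x i)"
proof (intro exI[of _ "T + max_delay"] conjI allI impI)
  show "0 \<le> T + max_delay" using T max_delay_pos by simp
  fix t assume t: "T + max_delay \<le> t"
  have s: "T \<le> t + s" if "s \<in> {- \<tau> i..0}" for i s using t that delay_le_max[of i] by auto
  have "continuous_on {- \<tau> i..0} (\<lambda>s. family_sol \<tau> \<omega> \<phi> i (t + s) - x i)" for i
    by (intro continuous_intros continuous_on_compose2[OF sol_cont[OF w \<phi>]])
      (use s[of _ i] T(1) in fastforce)+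
  then show "phase_ge \<tau> (segment (family_sol \<tau> \<omega> \<phi>) t) (\<lambda>i s. x i)"
    using T(2) s by (auto simp: phase_ge_def phase_cone_def phase_space_def segment_def)
qed

text \<open>Forward, the solution of (N) with constant history 1 serves as the persistent solution,
  with all components in \<open>K\<close>. Backward, a history with \<phi>(0) \<gg> 0 may vanish at
  earlier times, so the family property is applied to a later segment.\<close>

lemma uniform_persistence_iff:
  "(\<exists>m>0. \<forall>\<phi>\<in>phase_cone \<tau>. vec_spos (at_zero \<phi>) \<longrightarrow>
      (\<exists>t0\<ge>0. \<forall>t\<ge>t0. \<forall>i. m \<le> family_sol \<tau> p \<phi> i t)) \<longleftrightarrow>
   family_uniformly_persistent \<tau> \<Omega>" (is "?single \<longleftrightarrow> _")
proof
  assume ?single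
  then obtain m where m: "m > 0" and per: "\<And>\<phi>. \<phi> \<in> phase_cone \<tau> \<Longrightarrow> vec_spos (at_zero \<phi>) \<Longrightarrow>
      \<exists>t0\<ge>0. \<forall>t\<ge>t0. \<forall>i. m \<le> family_sol \<tau> p \<phi> i t" by blast
  define \<phi>1 :: "'n history" where "\<phi>1 = (\<lambda>i s. 1)"
  have c1: "\<phi>1 \<in> phase_cone \<tau>" unfolding \<phi>1_def by (rule constant_history_in_cone) simp
  have "vec_spos (at_zero \<phi>1)" by (simp add: vec_spos_def at_zero_def \<phi>1_def)
  then obtain T0 where T0: "T0 \<ge> 0" "\<forall>t\<ge>T0. \<forall>i\<in>UNIV. m \<le> family_sol \<tau> p \<phi>1 i t"
    using per[OF c1] by blast
  obtain \<mu> where \<mu>: "\<mu> > 0" "\<forall>\<omega>\<in>\<Omega>. \<forall>\<phi>\<in>phase_cone \<tau>. \<forall>T\<ge>0. (\<forall>i\<in>UNIV. 0 < family_sol \<tau> \<omega> \<phi> i T) \<longrightarrow>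
    (\<exists>t0\<ge>0. \<forall>t\<ge>t0. \<forall>i\<in>UNIV. \<mu> \<le> family_sol \<tau> \<omega> \<phi> i t)"
    using persistence_transfers_to_hull[OF c1 m T0] by auto
  have "phase_spos \<tau> (\<lambda>i s. \<mu>)" using \<mu>(1) by (auto simp: phase_spos_def phase_space_def)
  moreover have "\<exists>t0\<ge>0. \<forall>t\<ge>t0. phase_ge \<tau> (segment (family_sol \<tau> \<omega> \<phi>) t) (\<lambda>i s. \<mu>)"
    if w: "\<omega> \<in> \<Omega>" and sp: "phase_spos \<tau> \<phi>" for \<omega> \<phi>
  proof -
    have \<phi>: "\<phi> \<in> phase_cone \<tau>" by (rule phase_spos_imp_cone[OF sp])
    have "0 < family_sol \<tau> \<omega> \<phi> i 0" for i
      using sp sol_init[OF w \<phi>, of i 0] tau[of i] by (auto simp: phase_spos_def)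
    then have "\<exists>t0\<ge>0. \<forall>t\<ge>t0. \<forall>i\<in>UNIV. \<mu> \<le> family_sol \<tau> \<omega> \<phi> i t" using \<mu>(2) w \<phi> by blast
    then show ?thesis using segment_ge_constant[OF w \<phi>, of _ "\<lambda>_. \<mu>"] by blast
  qed
  ultimately show "family_uniformly_persistent \<tau> \<Omega>" unfolding family_uniformly_persistent_def by blast
next
  assume "family_uniformly_persistent \<tau> \<Omega>"
  then obtain \<psi> where \<psi>: "phase_spos \<tau> \<psi>" and per: "\<And>\<omega> \<phi>. \<omega> \<in> \<Omega> \<Longrightarrow> phase_spos \<tau> \<phi> \<Longrightarrow>
      \<exists>t0\<ge>0. \<forall>t\<ge>t0. phase_ge \<tau> (segment (family_sol \<tau> \<omega> \<phi>) t) \<psi>"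
    unfolding family_uniformly_persistent_def by blast
  define m where "m = Min (range (\<lambda>i. \<psi> i 0))"
  have "0 < \<psi> i 0" for i using \<psi> tau[of i] by (auto simp: phase_spos_def)
  then have "m > 0" by (simp add: m_def)
  moreover have "\<exists>t0\<ge>0. \<forall>t\<ge>t0. \<forall>i. m \<le> family_sol \<tau> p \<phi> i t"
    if \<phi>: "\<phi> \<in> phase_cone \<tau>" and pos: "vec_spos (at_zero \<phi>)" for \<phi>
  proof -
    define y where "y = family_sol \<tau> p \<phi>"
    \<comment> \<open>By this time all values in the segment are taken at t \<ge> 0, where the
      solution is positive; the shifted coefficients are again in the hull.\<close>
    define T where "T = max_delay"
    have T: "0 \<le> T" "\<tau> i \<le> T" for i using max_delay_pos delay_le_max by (auto simp: T_def)
    have w': "p \<cdot>\<^sub>t T \<in> \<Omega>" by (rule translate_in_hull[OF p_cont])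
    note shift = sol_shift[OF p_in_hull w' \<phi> T(2)]
    have "0 < y i t" if "0 \<le> t" for i t
      unfolding y_def using pos sol_init[OF p_in_hull \<phi>, of i 0] tau[of i]
      by (intro sol_pos[OF p_in_hull \<phi> order.refl that]) (auto simp: vec_spos_def at_zero_def)
    moreover have "0 \<le> T + s" if "s \<in> {- \<tau> i..0}" for i s using T(2)[of i] that by auto
    ultimately have "phase_spos \<tau> (segment y T)"
      using shift(1) by (auto simp: phase_spos_def phase_cone_def y_def[symmetric] segment_def)
    then obtain t0 where t0: "t0 \<ge> 0"
      "\<forall>t\<ge>t0. phase_ge \<tau> (segment (family_sol \<tau> (p \<cdot>\<^sub>t T) (segment y T)) t) \<psi>"
      using per[OF w'] by blast
    have "m \<le> y i t" if t: "T + t0 \<le> t" for i t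
    proof -
      have "phase_ge \<tau> (segment (family_sol \<tau> (p \<cdot>\<^sub>t T) (segment y T)) (t - T)) \<psi>" using t0(2) t by simp
      then have "\<psi> i 0 \<le> family_sol \<tau> (p \<cdot>\<^sub>t T) (segment y T) i (t - T)"
        using phase_geD[of _ \<psi> 0 i] tau[of i] by (force simp: segment_def)
      also have "\<dots> = y i t" using shift(2)[of i "t - T"] t t0(1) tau[of i] by (simp add: y_def)
      finally have "\<psi> i 0 \<le> y i t" .
      moreover have "m \<le> \<psi> i 0" by (simp add: m_def)
      ultimately show ?thesis by linarith
    qed
    then show ?thesis using T(1) t0(1) by (intro exI[of _ "T + t0"]) (auto simp: y_def)
  qed
  ultimately show ?single by blast
qed

text \<open>Forward, each terminal \<open>k\<close> contributes one constant history, supported on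
  \<open>reach k\<close>, to \<open>E\<close>. Backward, a nonzero e \<ge> 0 is positive at some
  point (i, s), and the order relation evaluated there bounds component \<open>i\<close>.\<close>

lemma strict_persistence_iff:
  "(\<exists>m>0. \<forall>\<phi>\<in>phase_cone \<tau>. vec_pos (at_zero \<phi>) \<longrightarrow>
      (\<exists>t0\<ge>0. \<exists>i. \<forall>t\<ge>t0. m \<le> family_sol \<tau> p \<phi> i t)) \<longleftrightarrow>
   family_strictly_persistent_at_0 \<tau> \<Omega>" (is "?single \<longleftrightarrow> _")
proof
  assume ?single
  then obtain m where m: "m > 0" and per: "\<And>\<phi>. \<phi> \<in> phase_cone \<tau> \<Longrightarrow> vec_pos (at_zero \<phi>) \<Longrightarrow>
      \<exists>t0\<ge>0. \<exists>i. \<forall>t\<ge>t0. m \<le> family_sol \<tau> p \<phi> i t" by blast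
  have "\<exists>\<mu>>0. \<forall>\<omega>\<in>\<Omega>. \<forall>\<phi>\<in>phase_cone \<tau>. \<forall>T\<ge>0. (\<forall>i\<in>reach k. 0 < family_sol \<tau> \<omega> \<phi> i T) \<longrightarrow>
    (\<exists>t0\<ge>0. \<forall>t\<ge>t0. \<forall>i\<in>reach k. \<mu> \<le> family_sol \<tau> \<omega> \<phi> i t)" if k: "terminal k" for k
  proof -
    \<comment> \<open>Supported on \<open>reach k\<close>, so that the solution stays 0 elsewhere
      and the component that persists must lie in \<open>reach k\<close>.\<close>
    define \<xi> :: "'n history" where "\<xi> = (\<lambda>i s. if i \<in> reach k then 1 else 0)"
    have \<xi>: "\<xi> \<in> phase_cone \<tau>" unfolding \<xi>_def by (rule constant_history_in_cone) simp
    have "at_zero \<xi> $ k = 1" using reach_refl by (simp add: at_zero_def \<xi>_def)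
    then have "at_zero \<xi> \<noteq> 0" by auto
    then have "vec_pos (at_zero \<xi>)" unfolding vec_pos_def by (simp add: at_zero_def \<xi>_def)
    then obtain T i where T: "T \<ge> 0" "\<forall>t\<ge>T. m \<le> family_sol \<tau> p \<xi> i t" using per[OF \<xi>] by blast
    have zero: "\<forall>t\<ge>0. \<forall>i\<in>- reach k. family_sol \<tau> p \<xi> i t = 0"
      using zero_off_closed_set[OF p_in_hull \<xi>, of "reach k"] reach_closed by (auto simp: \<xi>_def)
    have "i \<in> reach k" using zero T m by (metis ComplI not_le order.refl)
    \<comment> \<open>Terminality lets the bound on the unknown component \<open>i\<close> spread
      back over all of \<open>reach k\<close>.\<close>
    then have ik: "reach k = reach i" using k reach_trans unfolding terminal_def by blast
    obtain m' T' where "m' > 0" "T' \<ge> 0" "\<forall>t\<ge>T'. \<forall>i\<in>reach k. m' \<le> family_sol \<tau> p \<xi> i t"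
      using lower_bound_on_reach[OF p_in_hull \<xi> m, of i] T unfolding ik by blast
    then show ?thesis using persistence_transfers_to_hull[OF \<xi> _ _ _ zero] by blast
  qed
  then have "\<forall>k\<in>{k. terminal k}. \<exists>\<mu>. \<mu> > 0 \<and> (\<forall>\<omega>\<in>\<Omega>. \<forall>\<phi>\<in>phase_cone \<tau>. \<forall>T\<ge>0.
      (\<forall>i\<in>reach k. 0 < family_sol \<tau> \<omega> \<phi> i T) \<longrightarrow>
      (\<exists>t0\<ge>0. \<forall>t\<ge>t0. \<forall>i\<in>reach k. \<mu> \<le> family_sol \<tau> \<omega> \<phi> i t))" by blast
  then obtain \<mu> where \<mu>: "\<forall>k\<in>{k. terminal k}. \<mu> k > 0 \<and> (\<forall>\<omega>\<in>\<Omega>. \<forall>\<phi>\<in>phase_cone \<tau>. \<forall>T\<ge>0.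
      (\<forall>i\<in>reach k. 0 < family_sol \<tau> \<omega> \<phi> i T) \<longrightarrow>
      (\<exists>t0\<ge>0. \<forall>t\<ge>t0. \<forall>i\<in>reach k. \<mu> k \<le> family_sol \<tau> \<omega> \<phi> i t))" by (rule bchoice[THEN exE])
  define x where "x = (\<lambda>k i. if i \<in> reach k then \<mu> k else 0)"
  define E :: "'n history set" where "E = (\<lambda>k i s. x k i) ` {k. terminal k}"
  have "finite E" by (simp add: E_def)
  moreover have "\<forall>e\<in>E. phase_pos \<tau> e"
  proof
    fix e assume "e \<in> E"
    then obtain k where k: "terminal k" and e: "e = (\<lambda>i s. x k i)" by (auto simp: E_def)
    have "\<mu> k > 0" using \<mu> k by simp
    then have "e \<in> phase_cone \<tau>" unfolding e by (intro constant_history_in_cone) (simp add: x_def)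
    moreover have "e k 0 \<noteq> 0" using \<open>\<mu> k > 0\<close> reach_refl by (simp add: e x_def)
    moreover have "0 \<in> {- \<tau> k..0}" using tau[of k] by simp
    ultimately show "phase_pos \<tau> e" unfolding phase_pos_def by blast
  qed
  moreover have "\<exists>t0\<ge>0. \<exists>e\<in>E. \<forall>t\<ge>t0. phase_ge \<tau> (segment (family_sol \<tau> \<omega> \<phi>) t) e"
    if w: "\<omega> \<in> \<Omega>" and \<phi>: "\<phi> \<in> phase_cone \<tau>" and pos: "vec_pos (at_zero \<phi>)" for \<omega> \<phi>
  proof -
    obtain j where "0 < \<phi> j 0"
      using pos unfolding vec_pos_def by (auto simp: at_zero_def vec_eq_iff less_le)
    then obtain T where T: "T \<ge> 0" "\<forall>t\<ge>T. \<forall>i\<in>reach j. 0 < family_sol \<tau> \<omega> \<phi> i t"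
      using positive_on_reach[OF w \<phi>] by blast
    obtain k where k: "k \<in> reach j" "terminal k" by (rule terminal_exists)
    have "\<forall>i\<in>reach k. 0 < family_sol \<tau> \<omega> \<phi> i T" using T reach_trans[OF k(1)] by blast
    then obtain t1 where t1: "t1 \<ge> 0" "\<forall>t\<ge>t1. \<forall>i\<in>reach k. \<mu> k \<le> family_sol \<tau> \<omega> \<phi> i t"
      using \<mu> k(2) w \<phi> T(1) by blast
    have "x k i \<le> family_sol \<tau> \<omega> \<phi> i t" if "t1 \<le> t" for i t
      using t1 that sol_nonneg[OF w \<phi>, of i t] tau[of i] by (auto simp: x_def)
    then have "\<exists>t0\<ge>0. \<forall>t\<ge>t0. phase_ge \<tau> (segment (family_sol \<tau> \<omega> \<phi>) t) (\<lambda>i s. x k i)"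
      by (intro segment_ge_constant[OF w \<phi> t1(1)]) auto
    moreover have "(\<lambda>i s. x k i) \<in> E" using k(2) by (auto simp: E_def)
    ultimately show ?thesis by blast
  qed
  ultimately show "family_strictly_persistent_at_0 \<tau> \<Omega>"
    unfolding family_strictly_persistent_at_0_def by (intro exI[of _ E] conjI) blast+
next
  assume "family_strictly_persistent_at_0 \<tau> \<Omega>"
  then obtain E where E: "finite E" "\<forall>e\<in>E. phase_pos \<tau> e" and per: "\<forall>\<omega>\<in>\<Omega>. \<forall>\<phi>\<in>phase_cone \<tau>. vec_pos (at_zero \<phi>) \<longrightarrow>
      (\<exists>t0\<ge>0. \<exists>e\<in>E. \<forall>t\<ge>t0. phase_ge \<tau> (segment (family_sol \<tau> \<omega> \<phi>) t) e)"
    unfolding family_strictly_persistent_at_0_def by blast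
  have "\<exists>q. snd q \<in> {- \<tau> (fst q)..0} \<and> 0 < e (fst q) (snd q)" if e: "e \<in> E" for e
  proof -
    have pp: "phase_pos \<tau> e" using E(2) e by blast
    then obtain i s where "s \<in> {- \<tau> i..0}" "e i s \<noteq> 0" unfolding phase_pos_def by blast
    moreover from this have "0 \<le> e i s" using pp by (auto simp: phase_pos_def phase_cone_def)
    ultimately show ?thesis by (intro exI[of _ "(i, s)"]) simp
  qed
  then have "\<forall>e\<in>E. \<exists>q. snd q \<in> {- \<tau> (fst q)..0} \<and> 0 < e (fst q) (snd q)" by blast
  then obtain f where f: "\<forall>e\<in>E. snd (f e) \<in> {- \<tau> (fst (f e))..0} \<and> 0 < e (fst (f e)) (snd (f e))"
    by (rule bchoice[THEN exE])
  define m where "m = Min (insert 1 ((\<lambda>e. e (fst (f e)) (snd (f e))) ` E))"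
  have "m > 0" using E(1) f by (simp add: m_def)
  moreover have "\<exists>t0\<ge>0. \<exists>i. \<forall>t\<ge>t0. m \<le> family_sol \<tau> p \<phi> i t"
    if \<phi>: "\<phi> \<in> phase_cone \<tau>" and pos: "vec_pos (at_zero \<phi>)" for \<phi>
  proof -
    obtain t0 e where t0: "t0 \<ge> 0" "e \<in> E" "\<forall>t\<ge>t0. phase_ge \<tau> (segment (family_sol \<tau> p \<phi>) t) e"
      using per p_in_hull \<phi> pos by blast
    define i s where "i = fst (f e)" and "s = snd (f e)"
    have s: "s \<in> {- \<tau> i..0}" using f t0(2) by (simp add: i_def s_def)
    have "m \<le> e i s" unfolding m_def i_def s_def using E(1) t0(2) by (intro Min_le) auto
    have "m \<le> family_sol \<tau> p \<phi> i t" if t: "t0 \<le> t" for t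
    proof -
      \<comment> \<open>The segment at time t - s has the value of the solution at t in position s;
        as s \<le> 0, this time is not before t0.\<close>
      have "phase_ge \<tau> (segment (family_sol \<tau> p \<phi>) (t - s)) e" using t0(3) t s by simp
      then have "e i s \<le> family_sol \<tau> p \<phi> i t"
        using phase_geD[OF _ s] by (force simp: segment_def)
      then show ?thesis using \<open>m \<le> e i s\<close> by linarith
    qed
    then show ?thesis using t0(1) by blast
  qed
  ultimately show ?single by blast
qed

end

section \<open>From the hypotheses of the theorem to the hull setting\<close>

lemma almost_periodic_iff:
  "almost_periodic g \<longleftrightarrow> continuous_on UNIV g \<and> has_almost_periods g"
  by (simp add: almost_periodic_def has_almost_periods_def dist_real_def)

text \<open>Almost periods of the separate coefficients need not be common to all of them, so the
  passage to the vector goes through finite colourings of the translates and back.\<close>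

lemma coeff_map_almost_periodic:
  fixes d \<beta> c :: "'n::finite \<Rightarrow> real \<Rightarrow> real" and a :: "'n \<Rightarrow> 'n \<Rightarrow> real \<Rightarrow> real"
  assumes "\<And>i. almost_periodic (d i)" "\<And>i j. almost_periodic (a i j)"
    "\<And>i. almost_periodic (c i)" "\<And>i. almost_periodic (\<beta> i)"
  shows "continuous_on UNIV (coeff_map d a \<beta> c)" "has_almost_periods (coeff_map d a \<beta> c)"
proof -
  have c: "continuous_on UNIV (d i)" "continuous_on UNIV (a i j)" "continuous_on UNIV (c i)"
    "continuous_on UNIV (\<beta> i)" for i j
    using assms by (simp_all add: almost_periodic_iff)
  show "continuous_on UNIV (coeff_map d a \<beta> c)"
    unfolding coeff_map_def by (intro continuous_intros c)
  have "translation_precompact (d i)" "translation_precompact (a i j)" "translation_precompact (c i)"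
    "translation_precompact (\<beta> i)" for i j
    using assms by (simp_all add: almost_periodic_iff has_almost_periods_imp_precompact)
  then have "translation_precompact (coeff_map d a \<beta> c)"
    unfolding coeff_map_def by (intro translation_precompact_Pair translation_precompact_vec)
  then show "has_almost_periods (coeff_map d a \<beta> c)" by (rule precompact_imp_has_almost_periods)
qed

lemma coeff_map_components:
  "dC (coeff_map d a \<beta> c t) i = d i t" "aC (coeff_map d a \<beta> c t) i j = a i j t"
  "bC (coeff_map d a \<beta> c t) i = \<beta> i t" "cC (coeff_map d a \<beta> c t) i = c i t"
  by (simp_all add: coeff_map_def)

theorem theorem3p4:
  fixes \<tau> :: "'n::finite \<Rightarrow> real"
    and d \<beta> c :: "'n \<Rightarrow> real \<Rightarrow> real"
    and a :: "'n \<Rightarrow> 'n \<Rightarrow> real \<Rightarrow> real"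
  assumes tau: "\<And>i. \<tau> i > 0"
    and a1: "\<And>i. almost_periodic (d i)" "\<And>i j. almost_periodic (a i j)"
            "\<And>i. almost_periodic (c i)" "\<And>i. almost_periodic (\<beta> i)"
    and a2: "\<exists>d0>0. \<forall>t i. d i t \<ge> d0"
    and a3: "\<And>i j t. a i j t \<ge> 0" "\<And>i t. a i i t = 0"
    and a4: "\<And>i t. t \<ge> 0 \<Longrightarrow> \<beta> i t > 0"
    and a5: "\<exists>c0>0. \<forall>t\<ge>0. \<forall>i. c i t \<ge> c0"
    and a6: "\<And>i t. t \<ge> 0 \<Longrightarrow> d i t - (\<Sum>j\<in>UNIV. a j i t) > 0"
  shows "(uniformly_persistent_at_0 \<tau> d a \<beta> c \<longleftrightarrow>
            family_uniformly_persistent \<tau> (translation_hull (coeff_map d a \<beta> c))) \<and>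
         (strictly_persistent_at_0 \<tau> d a \<beta> c \<longleftrightarrow>
            family_strictly_persistent_at_0 \<tau> (translation_hull (coeff_map d a \<beta> c)))"
proof -
  define p where "p = coeff_map d a \<beta> c"
  have p: "continuous_on UNIV p" "has_almost_periods p"
    unfolding p_def by (rule coeff_map_almost_periodic[OF a1])+
  note comp = coeff_map_components[of d a \<beta> c, folded p_def]
  obtain c0 where c0: "c0 > 0" "\<And>t i. 0 \<le> t \<Longrightarrow> c0 \<le> c i t" using a5 by blast
  obtain d0 where d0: "d0 > 0" "\<And>t i. d0 \<le> d i t" using a2 by blast
  \<comment> \<open>The range of \<open>p\<close> is bounded around some centre \<open>z\<close>;
    moving the centre to 0 adds \<open>norm z\<close> and gives one upper bound for all
    coefficients.\<close>
  obtain z C where zC: "\<forall>y\<in>range p. dist z y \<le> C"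
    using has_almost_periods_imp_bounded[OF p] unfolding bounded_def by blast
  have C: "dist (p t) 0 \<le> C + norm z" for t
    using bspec[OF zC, of "p t"] dist_triangle[of "p t" 0 z] by (simp add: dist_commute)
  have upper: "d i t \<le> C + norm z" "a i j t \<le> C + norm z" "\<beta> i t \<le> C + norm z" "c i t \<le> C + norm z" for i j t
    using coeff_dist_le(1)[of "p t" i 0] coeff_dist_le(2)[of "p t" i j 0] coeff_dist_le(3)[of "p t" i 0]
      coeff_dist_le(4)[of "p t" i 0] C[of t] by (auto simp: comp)
  interpret nicholson_hull \<tau> p "C + norm z" c0
    by standard (use tau c0 p upper a3(1) a4 a6 d0 in \<open>auto simp: comp intro: less_imp_le order_trans\<close>)
  show ?thesis
    using uniform_persistence_iff strict_persistence_iff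
    unfolding uniformly_persistent_at_0_def strictly_persistent_at_0_def p_def family_sol_coeff_map by blast
qed

end
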